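(* For every $x\in\mathbb R$ the functions $$\ell_{\theta_i}(x),\quad \ell_{\theta_i}'(x),\quad \ell_{\theta_i\theta_j}(x),\qquad i,j=1,\ldots,4,$$ are well defined and continuous in $\theta\in\Theta_M^\circ$, and they are jointly continuous in $(x,\theta)$ on $\mathbb R\times\Theta_M^\circ$. Moreover, for each $\theta=(\mu,\sigma,\alpha,\beta)'\in\Theta_M^\circ$, the following hold for sufficiently large $|x|$, $x\in\mathbb R$ (i.e. as $|x|\to\infty$): $$\begin{array}{ll} \ell_\mu(x)=O(|x|^{-1}), & \ell_{\mu\mu}(x)=-\ell_\mu'(x)=O(|x|^{-2}),\\ \ell_\sigma(x)=O(1), & \ell_{\mu\sigma}(x)=-\ell_\sigma'(x)=O(|x|^{-1}),\\ \ell_\alpha(x)=O(\log|x|), & \ell_{\mu\alpha}(x)=-\ell_\alpha'(x)=O(|x|^{-1}\log|x|),\\ \ell_\beta(x)=O(1), & \ell_{\mu\beta}(x)=-\ell_\beta'(x)=O(|x|^{-1}), \end{array}$$ and $$\begin{array}{lll} \ell_{\sigma\sigma}(x)=O(1), & \ell_{\sigma\alpha}(x)=O(\log|x|), & \ell_{\sigma\beta}(x)=O(1),\\ \ell_{\alpha\alpha}(x)=O(\log^2|x|), & \ell_{\alpha\beta}(x)=O(\log|x|), & \ell_{\beta\beta}(x)=O(1). \end{array}$$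
   Context: Parameters: $\theta=(\theta_1,\theta_2,\theta_3,\theta_4)'=(\mu,\sigma,\alpha,\beta)'$, with parameter space $\Theta_M=\mathbb R\times(0,\infty)\times(0,2]\times[-1,1]$ and interior $\Theta_M^\circ=\mathbb R\times(0,\infty)\times(0,2)\times(-1,1)$. The stable density in the $(M_0)$ (continuous) parameterization is $f(x;\theta)=\frac1{2\pi}\int_{-\infty}^\infty e^{-itx}\varphi(t)\,dt$, where $$\varphi(t)=\exp\Big(-|\sigma t|^\alpha\big\{1+i\beta\,\mathrm{sign}(t)\tan\tfrac{\pi\alpha}{2}\,(|\sigma t|^{1-\alpha}-1)\big\}+i\mu t\Big)\quad\text{if }\alpha\ne1,$$ $$\varphi(t)=\exp\Big(-|\sigma t|-i\sigma t\,\tfrac{2\beta}{\pi}\log|\sigma t|+i\mu t\Big)\quad\text{if }\alpha=1.$$ Write $\ell(x;\theta)=\log f(x;\theta)$, $\ell_{\theta_i}(x)=\partial\ell/\partial\theta_i=f_{\theta_i}/f$, $\ell_{\theta_i}'(x)=\partial\ell_{\theta_i}/\partial x=(f_{\theta_i}'f-f_{\theta_i}f')/f^2$, and $\ell_{\theta_i\theta_j}(x)=\partial\ell_{\theta_i}/\partial\theta_j=(f_{\theta_i\theta_j}f-f_{\theta_i}f_{\theta_j})/f^2$, where subscripts denote partial derivatives in the parameters, primes denote derivatives in $x$, and all right-hand sides are evaluated at $(x;\theta)$. Constants in the $O(\cdot)$ terms may depend on $\theta$. *)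

theory Defs
  imports "HOL-Analysis.Analysis" "HOL-Library.Landau_Symbols"
begin

abbreviation par_mu :: 4 where "par_mu \<equiv> 1"
abbreviation par_sigma :: 4 where "par_sigma \<equiv> 2"
abbreviation par_alpha :: 4 where "par_alpha \<equiv> 3"
abbreviation par_beta :: 4 where "par_beta \<equiv> 4"

definition Theta_int :: "(real ^ 4) set" where
  "Theta_int = {\<theta>. 0 < \<theta> $ par_sigma \<and> 0 < \<theta> $ par_alpha \<and> \<theta> $ par_alpha < 2 \<and>
                    - 1 < \<theta> $ par_beta \<and> \<theta> $ par_beta < 1}"

text \<open>
  Characteristic function of the stable law in the continuous (M0) parameterization.
  At \<open>t = 0\<close> the conventions \<open>0 powr a = 0\<close> and \<open>ln 0 = 0\<close> give the correct value \<open>1\<close>.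
\<close>
definition stable_cf :: "real ^ 4 \<Rightarrow> real \<Rightarrow> complex" where
  "stable_cf \<theta> t =
    (let \<mu> = \<theta> $ par_mu; \<sigma> = \<theta> $ par_sigma; \<alpha> = \<theta> $ par_alpha; \<beta> = \<theta> $ par_beta in
     if \<alpha> \<noteq> 1 then
       exp (- of_real (\<bar>\<sigma> * t\<bar> powr \<alpha>) *
              (1 + \<i> * of_real (\<beta> * sgn t * tan (pi * \<alpha> / 2) * (\<bar>\<sigma> * t\<bar> powr (1 - \<alpha>) - 1)))
            + \<i> * of_real (\<mu> * t))
     else
       exp (- of_real \<bar>\<sigma> * t\<bar> - \<i> * of_real (\<sigma> * t * (2 * \<beta> / pi) * ln \<bar>\<sigma> * t\<bar>)
            + \<i> * of_real (\<mu> * t)))"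

text \<open>
  The inversion integral is real (lemma \<open>of_real_stable_density\<close> below), so taking the
  real part only changes its type.
\<close>
definition stable_density :: "real \<Rightarrow> real ^ 4 \<Rightarrow> real" where
  "stable_density x \<theta> =
    Re (1 / (2 * of_real pi) *
        (\<integral>t. exp (- \<i> * of_real (t * x)) * stable_cf \<theta> t \<partial>lborel))"

lemma cnj_stable_cf: "cnj (stable_cf \<theta> t) = stable_cf \<theta> (- t)"
  by (simp add: stable_cf_def Let_def exp_cnj algebra_simps)

lemma of_real_stable_density:
  "complex_of_real (stable_density x \<theta>) =
    1 / (2 * of_real pi) * (\<integral>t. exp (- \<i> * of_real (t * x)) * stable_cf \<theta> t \<partial>lborel)"
proof -
  let ?g = "\<lambda>t. exp (- \<i> * of_real (t * x)) * stable_cf \<theta> t"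
  have "cnj (integral\<^sup>L lborel ?g) = (\<integral>t. cnj (?g t) \<partial>lborel)"
    by (rule Bochner_Integration.integral_cnj [symmetric])
  also have "\<dots> = (\<integral>t. ?g (0 + (- 1) * t) \<partial>lborel)"
    by (simp add: cnj_stable_cf exp_cnj)
  also have "\<dots> = integral\<^sup>L lborel ?g"
    using lborel_integral_real_affine [of "- 1" ?g 0] by simp
  finally have "integral\<^sup>L lborel ?g \<in> \<real>"
    by (simp add: Reals_cnj_iff)
  then have "1 / (2 * of_real pi) * integral\<^sup>L lborel ?g \<in> \<real>"
    by (intro Reals_mult Reals_divide) auto
  then show ?thesis
    by (simp only: stable_density_def of_real_Re)
qed

text \<open>Partial differentiability and partial derivative in the \<open>i\<close>-th parameter.\<close>
definition par_differentiable :: "4 \<Rightarrow> (real ^ 4 \<Rightarrow> real) \<Rightarrow> real ^ 4 \<Rightarrow> bool" where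
  "par_differentiable i F \<theta> \<longleftrightarrow> (\<lambda>h. F (\<theta> + h *\<^sub>R axis i 1)) differentiable (at 0)"

definition par_deriv :: "4 \<Rightarrow> (real ^ 4 \<Rightarrow> real) \<Rightarrow> real ^ 4 \<Rightarrow> real" where
  "par_deriv i F \<theta> = deriv (\<lambda>h. F (\<theta> + h *\<^sub>R axis i 1)) 0"

definition loglik :: "real \<Rightarrow> real ^ 4 \<Rightarrow> real" where
  "loglik x \<theta> = ln (stable_density x \<theta>)"

definition loglik_par :: "4 \<Rightarrow> real \<Rightarrow> real ^ 4 \<Rightarrow> real" where
  "loglik_par i x \<theta> = par_deriv i (loglik x) \<theta>"

definition loglik_par_x :: "4 \<Rightarrow> real \<Rightarrow> real ^ 4 \<Rightarrow> real" where
  "loglik_par_x i x \<theta> = deriv (\<lambda>y. loglik_par i y \<theta>) x"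

definition loglik_par_par :: "4 \<Rightarrow> 4 \<Rightarrow> real \<Rightarrow> real ^ 4 \<Rightarrow> real" where
  "loglik_par_par i j x \<theta> = par_deriv j (loglik_par i x) \<theta>"

definition density_x :: "real \<Rightarrow> real ^ 4 \<Rightarrow> real" where
  "density_x x \<theta> = deriv (\<lambda>y. stable_density y \<theta>) x"

definition density_par :: "4 \<Rightarrow> real \<Rightarrow> real ^ 4 \<Rightarrow> real" where
  "density_par i x \<theta> = par_deriv i (stable_density x) \<theta>"

definition density_par_x :: "4 \<Rightarrow> real \<Rightarrow> real ^ 4 \<Rightarrow> real" where
  "density_par_x i x \<theta> = deriv (\<lambda>y. density_par i y \<theta>) x"

definition density_par_par :: "4 \<Rightarrow> 4 \<Rightarrow> real \<Rightarrow> real ^ 4 \<Rightarrow> real" where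
  "density_par_par i j x \<theta> = par_deriv j (density_par i x) \<theta>"

text \<open>
  The derivatives of the log-density exist at \<open>(x, \<theta>)\<close>, and so do the quotient expressions for
  them in terms of the density and its derivatives, with the same values. The existence clauses
  are needed because \<open>deriv\<close> has an unspecified value where the derivative does not exist, and
  \<open>0 < stable_density x \<theta>\<close> because \<open>ln\<close> and division are total. Positivity also entails that
  the inversion integral converges, as a divergent Bochner integral has value \<open>0\<close>.
\<close>
definition loglik_derivs_well_defined :: "real \<Rightarrow> real ^ 4 \<Rightarrow> bool" where
  "loglik_derivs_well_defined x \<theta> \<longleftrightarrow>
    0 < stable_density x \<theta> \<and>
    (\<lambda>y. stable_density y \<theta>) differentiable (at x) \<and>
    (\<forall>i. par_differentiable i (stable_density x) \<theta> \<and>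
         par_differentiable i (loglik x) \<theta> \<and>
         loglik_par i x \<theta> = density_par i x \<theta> / stable_density x \<theta> \<and>
         (\<lambda>y. density_par i y \<theta>) differentiable (at x) \<and>
         (\<lambda>y. loglik_par i y \<theta>) differentiable (at x) \<and>
         loglik_par_x i x \<theta> =
           (density_par_x i x \<theta> * stable_density x \<theta> - density_par i x \<theta> * density_x x \<theta>)
             / (stable_density x \<theta>)\<^sup>2) \<and>
    (\<forall>i j. par_differentiable j (density_par i x) \<theta> \<and>
           par_differentiable j (loglik_par i x) \<theta> \<and>
           loglik_par_par i j x \<theta> =
             (density_par_par i j x \<theta> * stable_density x \<theta> - density_par i x \<theta> * density_par j x \<theta>)
               / (stable_density x \<theta>)\<^sup>2)"

end

theory Submission
  imports Defs "HOL-Complex_Analysis.Complex_Analysis" "HOL-Probability.Probability" "HOL-Real_Asymp.Real_Asymp"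
begin

text \<open>
  The density is \<open>g z / \<sigma>\<close> with \<open>z = (x - \<mu>) / \<sigma>\<close>, where \<open>g\<close> is the standardized density with
  parameters \<open>\<alpha>\<close> and \<open>\<beta>\<close>, so every derivative in question is a finite sum of terms
  \<open>z ^ p * G / \<sigma> ^ c\<close> with \<open>G\<close> a partial derivative of \<open>g\<close>.

  The exponent of the characteristic function is holomorphic in the right half plane, so the path of
  the inversion integral can be moved to \<open>0\<close>, \<open>- \<i>\<close>, \<open>- \<i> + \<infinity>\<close>. For \<open>z \<longrightarrow> \<infinity>\<close> the horizontal ray
  contributes \<open>O(exp (- z))\<close>, and on the segment from \<open>0\<close> to \<open>- \<i>\<close> only the imaginary part of the
  integrand counts. Near \<open>0\<close> this is bounded by a multiple of \<open>v powr \<alpha> * ln v ^ j\<close>, so the \<open>k\<close>-th derivative in \<open>z\<close>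
  and \<open>j\<close>-th in \<open>\<alpha>\<close> is \<open>O(z powr (- \<alpha> - 1 - k) * ln z ^ j)\<close>, while \<open>g z\<close> itself is at least a constant times
  \<open>z powr (- \<alpha> - 1)\<close>. The case \<open>z \<longrightarrow> - \<infinity>\<close> follows from the reflection \<open>\<beta> \<mapsto> - \<beta>\<close>.

  Positivity of \<open>g\<close> comes in two steps. By the binomial series (Gruenwald's difference quotient of
  fractional order), the characteristic function is a limit of those of compound Poisson laws,
  which gives \<open>0 \<le> g\<close>; the case \<open>\<alpha> = 1\<close> follows by continuity in \<open>\<alpha>\<close>. By stability \<open>g\<close> is the
  convolution of a rescaled copy of itself with itself, and the tails of this copy are positive, so
  \<open>0 < g\<close>.
\<close>

text \<open>The path descends by one unit only. Along the whole negative imaginary axis the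
  integrand may blow up: for \<alpha> > 1 and \<beta> = 0 the exponent has real part cos(pi \<alpha>
  / 2) v^\<alpha> < 0 there, so that its negative exponential outgrows exp(- v z). In a strip of
  bounded height the real part differs from its value t^\<alpha> on the real axis by lower order
  only, so the integrand keeps its decay and one path serves all \<alpha> in (0, 2).

  At \<alpha> = 1 the tangent has a pole, which cancels against the difference s - s^\<alpha>. The
  skewness term is therefore written as a product of two factors, each holomorphic in \<alpha> near
  (0, 2), which makes the exponent differentiable across 1.

  Upper bounds alone say nothing about a quotient by the density: the lower bound must have the same
  power of z, and the density must not vanish anywhere. The tail estimate settles large |z| only,
  and a bounded range of z is out of its reach; this is why positivity takes an argument of a
  different kind.\<close>

no_notation fps_nth (infixl "$" 75)

section \<open>Integrals depending on a parameter\<close>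

lemma integrable_inverse_1_plus_square_lborel:
  "integrable lborel (\<lambda>x::real. 1 / (1 + x\<^sup>2))"
  using integrable_inverse_1_plus_square
  by (simp add: set_integrable_def einterval_eq_UNIV inverse_eq_divide)

lemma integral_inverse_1_plus_square_lborel:
  "(\<integral>x. 1 / (1 + (x::real)\<^sup>2) \<partial>lborel) = pi"
  using LBINT_inverse_1_plus_square
  by (simp add: interval_lebesgue_integral_def set_lebesgue_integral_def einterval_eq_UNIV
      inverse_eq_divide)

text \<open>The majorant \<open>w\<close> is only required near each parameter, because the bounds
  below are uniform on compact parameter sets and not on the whole space. First countability reduces
  the limit to sequences, for which dominated convergence is available; the shift by N skips the
  finitely many members outside the neighbourhood.\<close>

lemma continuous_on_integral_dominated:
  fixes F :: "'p::first_countable_topology \<Rightarrow> 'a \<Rightarrow> 'b::{banach,second_countable_topology}"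
  assumes meas: "\<And>p. p \<in> S \<Longrightarrow> F p \<in> borel_measurable M"
    and cont: "\<And>x. x \<in> space M \<Longrightarrow> continuous_on S (\<lambda>p. F p x)"
    and dom: "\<And>p. p \<in> S \<Longrightarrow> \<exists>U w. open U \<and> p \<in> U \<and> integrable M w \<and>
                (\<forall>q\<in>U \<inter> S. \<forall>x\<in>space M. norm (F q x) \<le> w x)"
  shows "continuous_on S (\<lambda>p. \<integral>x. F p x \<partial>M)"
  unfolding continuous_on_def
proof
  fix p assume p: "p \<in> S"
  from dom[OF p] obtain U w where U: "open U" "p \<in> U" "integrable M w"
    and b: "\<And>q x. q \<in> U \<Longrightarrow> q \<in> S \<Longrightarrow> x \<in> space M \<Longrightarrow> norm (F q x) \<le> w x" by blast
  show "((\<lambda>p. \<integral>x. F p x \<partial>M) \<longlongrightarrow> (\<integral>x. F p x \<partial>M)) (at p within S)"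
    unfolding tendsto_at_iff_sequentially
  proof (intro allI impI)
    fix X assume X: "\<forall>n::nat. X n \<in> S - {p}" "X \<longlonglongrightarrow> p"
    then have "\<forall>\<^sub>F n in sequentially. X n \<in> U"
      using U topological_tendstoD[of X p sequentially U] by auto
    then obtain N where N: "\<And>n. n \<ge> N \<Longrightarrow> X n \<in> U" by (auto simp: eventually_sequentially)
    have "(\<lambda>n. \<integral>x. F (X (n + N)) x \<partial>M) \<longlonglongrightarrow> (\<integral>x. F p x \<partial>M)"
    proof (rule integral_dominated_convergence[where w=w])
      show "AE x in M. (\<lambda>n. F (X (n + N)) x) \<longlonglongrightarrow> F p x"
      proof (intro AE_I2)
        fix x assume "x \<in> space M"
        from cont[OF this] have "(\<lambda>n. F (X n) x) \<longlonglongrightarrow> F p x"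
          using X p unfolding continuous_on_def tendsto_at_iff_sequentially by (auto simp: comp_def)
        then show "(\<lambda>n. F (X (n + N)) x) \<longlonglongrightarrow> F p x"
          by (rule LIMSEQ_ignore_initial_segment)
      qed
    qed (use X N U b meas p in auto)
    then show "((\<lambda>p. \<integral>x. F p x \<partial>M) \<circ> X) \<longlonglongrightarrow> (\<integral>x. F p x \<partial>M)"
      unfolding comp_def by (rule LIMSEQ_offset)
  qed
qed

text \<open>The mean value inequality turns the bound \<open>w\<close> on the derivative over the
  whole interval into a bound on every difference quotient; dominated convergence along a null
  sequence does the rest.\<close>

lemma DERIV_integral_dominated:
  fixes F F' :: "real \<Rightarrow> 'a \<Rightarrow> real"
  assumes r: "r > 0"
    and int: "\<And>y. \<bar>y - y0\<bar> < r \<Longrightarrow> integrable M (F y)"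
    and meas: "F' y0 \<in> borel_measurable M"
    and deriv: "\<And>y x. \<bar>y - y0\<bar> < r \<Longrightarrow> x \<in> space M \<Longrightarrow>
                  ((\<lambda>y. F y x) has_real_derivative F' y x) (at y)"
    and bound: "\<And>y x. \<bar>y - y0\<bar> < r \<Longrightarrow> x \<in> space M \<Longrightarrow> \<bar>F' y x\<bar> \<le> w x"
    and w: "integrable M w"
  shows "((\<lambda>y. \<integral>x. F y x \<partial>M) has_real_derivative (\<integral>x. F' y0 x \<partial>M)) (at y0)"
  unfolding DERIV_def tendsto_at_iff_sequentially
proof (intro allI impI)
  fix X :: "nat \<Rightarrow> real" assume X: "\<forall>i. X i \<in> UNIV - {0}" "X \<longlonglongrightarrow> 0"
  then have X0: "\<And>i. X i \<noteq> 0" by auto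
  from X r have "\<forall>\<^sub>F n in sequentially. \<bar>X n\<bar> < r"
    by (auto dest!: tendstoD[of X 0 _ r] simp: dist_real_def)
  then obtain N where N: "\<And>n. n \<ge> N \<Longrightarrow> \<bar>X n\<bar> < r" by (auto simp: eventually_sequentially)
  have "(\<lambda>n. \<integral>x. (F (y0 + X (n + N)) x - F y0 x) / X (n + N) \<partial>M) \<longlonglongrightarrow> (\<integral>x. F' y0 x \<partial>M)"
  proof (rule integral_dominated_convergence[where w=w])
    fix n
    show "(\<lambda>x. (F (y0 + X (n + N)) x - F y0 x) / X (n + N)) \<in> borel_measurable M"
      using int[of "y0 + X (n + N)"] int[of y0] N[of "n + N"] r by auto
    show "AE x in M. norm ((F (y0 + X (n + N)) x - F y0 x) / X (n + N)) \<le> w x"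
    proof (intro AE_I2)
      fix x assume x: "x \<in> space M"
      have "norm (F (y0 + X (n + N)) x - F y0 x) \<le> w x * norm (y0 + X (n + N) - y0)"
      proof (rule field_differentiable_bound[where S="ball y0 r" and f'="\<lambda>y. F' y x"])
        show "((\<lambda>y. F y x) has_field_derivative F' y x) (at y within ball y0 r)"
          if "y \<in> ball y0 r" for y
          using deriv[OF _ x, of y] that has_field_derivative_at_within
          by (auto simp: dist_real_def abs_minus_commute)
        show "norm (F' y x) \<le> w x" if "y \<in> ball y0 r" for y
          using bound[OF _ x, of y] that by (auto simp: dist_real_def abs_minus_commute)
      qed (use N[of "n + N"] r in \<open>auto simp: dist_real_def\<close>)
      then show "norm ((F (y0 + X (n + N)) x - F y0 x) / X (n + N)) \<le> w x"
        using X0[of "n + N"] by (simp add: field_simps)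
    qed
  next
    show "AE x in M. (\<lambda>n. (F (y0 + X (n + N)) x - F y0 x) / X (n + N)) \<longlonglongrightarrow> F' y0 x"
    proof (intro AE_I2)
      fix x assume x: "x \<in> space M"
      have "((\<lambda>h. (F (y0 + h) x - F y0 x) / h) \<longlongrightarrow> F' y0 x) (at 0)"
        using deriv[OF _ x, of y0] r by (simp add: DERIV_def)
      then have "(\<lambda>n. (F (y0 + X n) x - F y0 x) / X n) \<longlonglongrightarrow> F' y0 x"
        unfolding tendsto_at_iff_sequentially using X by (auto simp: comp_def)
      then show "(\<lambda>n. (F (y0 + X (n + N)) x - F y0 x) / X (n + N)) \<longlonglongrightarrow> F' y0 x"
        by (rule LIMSEQ_ignore_initial_segment)
    qed
  qed (use meas w in auto)
  also have "(\<lambda>n. \<integral>x. (F (y0 + X (n + N)) x - F y0 x) / X (n + N) \<partial>M) =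
      (\<lambda>n. ((\<integral>x. F (y0 + X (n + N)) x \<partial>M) - (\<integral>x. F y0 x \<partial>M)) / X (n + N))"
  proof
    fix n
    have "integrable M (F (y0 + X (n + N)))" "integrable M (F y0)"
      using int[of "y0 + X (n + N)"] int[of y0] N[of "n + N"] r by auto
    then show "(\<integral>x. (F (y0 + X (n + N)) x - F y0 x) / X (n + N) \<partial>M) =
      ((\<integral>x. F (y0 + X (n + N)) x \<partial>M) - (\<integral>x. F y0 x \<partial>M)) / X (n + N)"
      by simp
  qed
  finally show "((\<lambda>h. ((\<integral>x. F (y0 + h) x \<partial>M) - (\<integral>x. F y0 x \<partial>M)) / h) \<circ> X) \<longlonglongrightarrow> (\<integral>x. F' y0 x \<partial>M)"
    unfolding comp_def by (rule LIMSEQ_offset)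
qed

section \<open>The exponent of the standardized law\<close>

text \<open>
  \<open>expint 0 w\<close> is \<open>(exp w - 1) / w\<close> with the removable singularity filled in, and \<open>expint j\<close> is its
  \<open>j\<close>-th derivative. This is what makes the case \<open>\<alpha> = 1\<close> uniform with the others.
\<close>
definition expint :: "nat \<Rightarrow> complex \<Rightarrow> complex" where
  "expint j w = integral {0..1} (\<lambda>v. of_real v ^ j * exp (w * of_real v))"

lemma expint_integrable:
  "(\<lambda>v. of_real v ^ j * exp ((w::complex) * of_real v)) integrable_on {0..(1::real)}"
  by (intro integrable_continuous_real continuous_intros)

lemma expint_deriv: "(expint j has_field_derivative expint (Suc j) w) (at w)"
proof -
  have "((\<lambda>w. integral (cbox 0 1) (\<lambda>v::real. of_real v ^ j * exp (w * of_real v)))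
      has_field_derivative
      integral (cbox 0 1) (\<lambda>v::real. of_real v ^ Suc j * exp (w * of_real v))) (at w within UNIV)"
  proof (rule leibniz_rule_field_derivative)
    show "((\<lambda>x. of_real t ^ j * exp (x * of_real t)) has_field_derivative
        of_real t ^ Suc j * exp (x * of_real t)) (at x within UNIV)" for x :: complex and t :: real
      by (auto intro!: derivative_eq_intros)
    show "continuous_on (UNIV \<times> cbox 0 1)
        (\<lambda>(x::complex, t::real). of_real t ^ Suc j * exp (x * of_real t))"
      unfolding split_beta by (intro continuous_intros)
  qed (use expint_integrable in auto)
  then show ?thesis by (simp add: expint_def[abs_def])
qed

lemmas expint_deriv_chain [derivative_intros] = DERIV_chain2[OF expint_deriv]

lemma continuous_on_expint [continuous_intros]:
  "continuous_on S f \<Longrightarrow> continuous_on S (\<lambda>x. expint j (f x))"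
  by (rule continuous_on_compose2[of UNIV "expint j"])
    (use DERIV_continuous_on[OF DERIV_subset[OF expint_deriv]] in auto)

lemma norm_expint_le: "norm (expint j w) \<le> exp (max 0 (Re w))"
proof -
  have "norm (expint j w) \<le> integral {0..1} (\<lambda>_::real. exp (max 0 (Re w)))"
    unfolding expint_def
  proof (rule integral_norm_bound_integral)
    fix v :: real assume v: "v \<in> {0..1}"
    have "v ^ j \<le> 1" using v by (auto intro: power_le_one)
    moreover have "Re w * v \<le> max 0 (Re w)"
      using v mult_left_le[of v "Re w"] mult_nonpos_nonneg[of "Re w" v]
      by (cases "Re w \<ge> 0") auto
    ultimately have "v ^ j * exp (Re w * v) \<le> 1 * exp (max 0 (Re w))"
      using v by (intro mult_mono) auto
    then show "norm (of_real v ^ j * exp (w * of_real v)) \<le> exp (max 0 (Re w))"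
      using v by (simp add: norm_mult norm_power)
  qed (auto intro: expint_integrable)
  then show ?thesis by simp
qed

lemma expint_0: "w * expint 0 w = exp w - 1"
proof -
  have "((\<lambda>v. w * exp (w * of_real v)) has_integral
      exp (w * of_real 1) - exp (w * of_real 0)) {0..(1::real)}"
  proof (intro fundamental_theorem_of_calculus)
    fix x :: real
    have "((\<lambda>z. exp (w * z)) has_field_derivative w * exp (w * of_real x)) (at (of_real x))"
      by (auto intro!: derivative_eq_intros)
    then show "((\<lambda>x. exp (w * of_real x)) has_vector_derivative w * exp (w * of_real x))
        (at x within {0..1})"
      by (rule has_vector_derivative_at_within[OF has_vector_derivative_real_field])
  qed auto
  then have "integral {0..1} (\<lambda>v::real. w * exp (w * of_real v)) = exp w - 1"
    by (intro integral_unique) simp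
  then show ?thesis by (simp add: expint_def)
qed

lemma expint_0_0: "expint 0 0 = 1"
  by (simp add: expint_def)

text \<open>
  The \<open>j\<close>-th derivative in \<open>a\<close> of \<open>(s powr a - s) / (a - 1)\<close>.
\<close>
definition stabQ :: "nat \<Rightarrow> complex \<Rightarrow> complex \<Rightarrow> complex" where
  "stabQ j a s = s * Ln s ^ Suc j * expint j ((a - 1) * Ln s)"

lemma stabQ_deriv: "((\<lambda>a. stabQ j a s) has_field_derivative stabQ (Suc j) a s) (at a)"
  unfolding stabQ_def by (auto intro!: derivative_eq_intros)

lemma stabQ_0: "s \<noteq> 0 \<Longrightarrow> (a - 1) * stabQ 0 a s = exp (a * Ln s) - s"
proof -
  assume s: "s \<noteq> 0"
  have "(a - 1) * stabQ 0 a s = s * ((a - 1) * Ln s * expint 0 ((a - 1) * Ln s))"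
    by (simp add: stabQ_def)
  also have "\<dots> = s * exp (a * Ln s - Ln s) - s"
    unfolding expint_0 by (simp add: algebra_simps)
  also have "s * exp (a * Ln s - Ln s) = exp (a * Ln s)"
    using s by (simp add: exp_diff exp_Ln)
  finally show ?thesis .
qed

text \<open>
  On the real interval \<open>0 < a < 2\<close> this is \<open>- (a - 1) * tan (pi * a / 2)\<close>, continued through \<open>a = 1\<close>,
  where the value is \<open>2 / pi\<close>.
\<close>
definition stabT :: "complex \<Rightarrow> complex" where
  "stabT a = (1 + exp (\<i> * pi * (a - 1))) / (pi * expint 0 (\<i> * pi * (a - 1)))"

definition stabT_dom :: "complex set" where
  "stabT_dom = {a. expint 0 (\<i> * pi * (a - 1)) \<noteq> 0}"

lemma open_stabT_dom: "open stabT_dom"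
  unfolding stabT_dom_def by (intro open_Collect_neq continuous_intros)

text \<open>By \<open>expint_0\<close>, a zero of \<open>expint 0\<close> is a nonzero multiple of 2
  pi i, and |a - 1| < 1 keeps i pi (a - 1) away from those. At 0, where \<open>expint_0\<close> says
  nothing, the value is 1.\<close>

lemma stabT_dom_real: assumes "0 < a" "a < 2" shows "complex_of_real a \<in> stabT_dom"
proof (cases "a = 1")
  case False
  have "exp (\<i> * pi * (complex_of_real a - 1)) \<noteq> 1"
  proof
    assume "exp (\<i> * pi * (complex_of_real a - 1)) = 1"
    then obtain n :: int where n: "pi * (a - 1) = of_int (2 * n) * pi"
      by (auto simp: exp_eq_1)
    then have "a - 1 = of_int (2 * n)" by simp
    with assms have "of_int (2 * n) < (1::real)" "- 1 < (of_int (2 * n) :: real)" by linarith+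
    then have "2 * n < 1" "-1 < 2 * n" by linarith+
    then have "n = 0" by linarith
    with \<open>a - 1 = of_int (2 * n)\<close> False show False by simp
  qed
  then show ?thesis
    using expint_0[of "\<i> * pi * (complex_of_real a - 1)"] by (auto simp: stabT_dom_def)
qed (simp add: stabT_dom_def expint_0_0)

lemma stabT_holomorphic: "(deriv ^^ j) stabT holomorphic_on stabT_dom"
proof (rule holomorphic_higher_deriv[OF _ open_stabT_dom])
  have "expint 0 holomorphic_on UNIV"
    using expint_deriv by (auto simp: holomorphic_on_open intro: exI[of _ "expint 1 _"])
  then have "(\<lambda>a. expint 0 (\<i> * pi * (a - 1))) holomorphic_on stabT_dom"
    by (intro holomorphic_on_compose_gen[of "\<lambda>a. \<i> * pi * (a - 1)" _ "expint 0" UNIV, unfolded comp_def])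
      (auto intro!: holomorphic_intros)
  then show "stabT holomorphic_on stabT_dom"
    unfolding stabT_def[abs_def]
    by (intro holomorphic_intros) (auto simp: stabT_dom_def)
qed

lemma stabT_deriv: "a \<in> stabT_dom \<Longrightarrow>
    ((deriv ^^ j) stabT has_field_derivative (deriv ^^ Suc j) stabT a) (at a)"
  using holomorphic_derivI[OF stabT_holomorphic open_stabT_dom, of a j] by simp

lemma stabT_1: "stabT 1 = 2 / pi"
  by (simp add: stabT_def expint_0_0)

text \<open>With v = pi (a - 1) / 2 both numerator and denominator contain the factor
  \<open>cis v\<close>. What remains is 2 v cot v / pi, and tan(pi a / 2) = tan(v + pi / 2) = - cot
  v.\<close>

lemma stabT_real:
  assumes a: "0 < a" "a < 2" "a \<noteq> 1"
  shows "stabT (of_real a) = of_real (- (a - 1) * tan (pi * a / 2))"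
proof -
  define v where "v = pi * (a - 1) / 2"
  have sv: "sin v \<noteq> 0"
  proof -
    have "\<bar>v\<bar> < pi" "v \<noteq> 0" using a by (auto simp: v_def abs_mult)
    then show ?thesis
      by (metis abs_less_iff neg_equal_0_iff_equal sin_eq_0_pi minus_less_iff)
  qed
  have w: "\<i> * pi * (complex_of_real a - 1) = 2 * \<i> * of_real v" by (simp add: v_def)
  have v0: "v \<noteq> 0" using sv by auto
  have e: "exp (2 * \<i> * of_real v) = cis v * cis v"
    by (simp add: cis_mult) (simp add: cis_conv_exp mult_ac)
  have "2 * \<i> * of_real v * expint 0 (2 * \<i> * of_real v) = cis v * cis v - 1"
    using expint_0[of "2 * \<i> * of_real v"] e by simp
  also have "\<dots> = cis v * (cis v - cis (- v))" by (simp add: right_diff_distrib cis_mult)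
  also have "cis v - cis (- v) = 2 * \<i> * sin v" by (simp add: complex_eq_iff)
  finally have E: "expint 0 (2 * \<i> * of_real v) = cis v * sin v / v"
    using v0 by (simp add: field_simps)
  have "1 + exp (2 * \<i> * of_real v) = cis v * (cis v + cis (- v))"
    by (simp add: e distrib_left cis_mult)
  also have "cis v + cis (- v) = 2 * cos v" by (simp add: complex_eq_iff)
  finally have N: "1 + exp (2 * \<i> * of_real v) = cis v * (2 * cos v)" .
  have "stabT (of_real a) = of_real (2 * cos v * v / (pi * sin v))"
    unfolding stabT_def w E N by (simp add: field_simps)
  also have "2 * cos v * v / (pi * sin v) = - (a - 1) * tan (pi * a / 2)"
  proof -
    have "pi * a / 2 = v + pi / 2" by (simp add: v_def field_simps)
    then have "tan (pi * a / 2) = tan (v + pi / 2)" by (simp only:)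
    also have "\<dots> = - cos v / sin v"
      by (simp add: tan_def sin_add cos_add)
    finally have "tan (pi * a / 2) = - cos v / sin v" .
    then show ?thesis using sv by (simp add: v_def field_simps)
  qed
  finally show ?thesis .
qed

text \<open>The Leibniz rule for the \<open>j\<close>-th derivative in \<open>a\<close> of the
  product \<open>stabT a * stabQ 0 a s\<close>, which is the skewness term of the exponent without
  the factor i \<beta>.\<close>

definition stabeta :: "nat \<Rightarrow> complex \<Rightarrow> complex \<Rightarrow> complex" where
  "stabeta j a s = (\<Sum>i\<le>j. of_nat (j choose i) * (deriv ^^ i) stabT a * stabQ (j - i) a s)"

lemma stabeta_deriv:
  assumes "j < 2" "a \<in> stabT_dom"
  shows "((\<lambda>a. stabeta j a s) has_field_derivative stabeta (Suc j) a s) (at a)"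
proof -
  note d = stabT_deriv[OF assms(2), of 0, simplified] stabT_deriv[OF assms(2), of 1, simplified]
  from assms consider "j = 0" | "j = 1" by linarith
  then show ?thesis
  proof cases
    case 1 then show ?thesis unfolding stabeta_def
      by (auto intro!: derivative_eq_intros d stabQ_deriv)
  next
    case 2 then show ?thesis unfolding stabeta_def
      by (auto intro!: derivative_eq_intros d stabQ_deriv simp: algebra_simps numeral_2_eq_2)
  qed
qed

lemma stabeta_0: "stabeta 0 a s = stabT a * stabQ 0 a s"
  by (simp add: stabeta_def)

text \<open>The pole of the tangent at a = 1 is cancelled in advance: \<open>stabT\<close> carries
  the factor a - 1 and \<open>stabQ 0\<close> the division by it. Off 1 this is the tangent form of
  the exponent, and by \<open>stabeta_1\<close> the value at 1 is the logarithmic form.\<close>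

lemma stabeta_tan:
  assumes "0 < a" "a < 2" "a \<noteq> 1" "s \<noteq> 0"
  shows "stabeta 0 (of_real a) s = of_real (tan (pi * a / 2)) * (s - exp (of_real a * Ln s))"
proof -
  have "stabeta 0 (of_real a) s = - of_real (tan (pi * a / 2)) * ((of_real a - 1) * stabQ 0 (of_real a) s)"
    unfolding stabeta_0 stabT_real[OF assms(1-3)] of_real_mult of_real_minus of_real_diff of_real_1
    by algebra
  then show ?thesis unfolding stabQ_0[OF assms(4)] by algebra
qed

lemma stabeta_1: "stabeta 0 1 s = of_real (2 / pi) * (s::complex) * Ln s"
  by (simp add: stabeta_0 stabT_1 stabQ_def expint_0_0)

text \<open>
  \<open>exp (- stabA 0 \<alpha> \<beta> s)\<close> continues the standardized characteristic function from the positive half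
  line to the right half plane; \<open>stabA j\<close> is the \<open>j\<close>-th derivative in \<open>\<alpha>\<close> of the exponent, and
  \<open>\<i> * stabeta j\<close> is its mixed derivative, \<open>j\<close> times in \<open>\<alpha>\<close> and once in \<open>\<beta>\<close>.
\<close>
definition stabA :: "nat \<Rightarrow> complex \<Rightarrow> complex \<Rightarrow> complex \<Rightarrow> complex" where
  "stabA j a b s = exp (a * Ln s) * Ln s ^ j + \<i> * b * stabeta j a s"

lemma stabA_deriv_a:
  assumes "j < 2" "a \<in> stabT_dom"
  shows "((\<lambda>a. stabA j a b s) has_field_derivative stabA (Suc j) a b s) (at a)"
  unfolding stabA_def by (auto intro!: derivative_eq_intros stabeta_deriv assms)

lemma stabA_deriv_b: "((\<lambda>b. stabA j a b s) has_field_derivative \<i> * stabeta j a s) (at b)"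
  unfolding stabA_def by (auto intro!: derivative_eq_intros)

text \<open>
  \<open>jetD j l\<close> below is the mixed derivative of \<open>exp (- stabA 0 a b s)\<close>, \<open>j\<close> times in \<open>a\<close> and \<open>l\<close> times in \<open>b\<close>,
  and \<open>jetP j l\<close> is its polynomial factor. Only the orders \<open>j + l \<le> 2\<close> are meaningful.
\<close>
fun jetP :: "nat \<Rightarrow> nat \<Rightarrow> complex \<Rightarrow> complex \<Rightarrow> complex \<Rightarrow> complex" where
  "jetP 0 0 a b s = 1"
| "jetP (Suc 0) 0 a b s = - stabA 1 a b s"
| "jetP 0 (Suc 0) a b s = - (\<i> * stabeta 0 a s)"
| "jetP (Suc (Suc 0)) 0 a b s = (stabA 1 a b s)\<^sup>2 - stabA 2 a b s"
| "jetP (Suc 0) (Suc 0) a b s = \<i> * stabeta 0 a s * stabA 1 a b s - \<i> * stabeta 1 a s"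
| "jetP 0 (Suc (Suc 0)) a b s = (\<i> * stabeta 0 a s)\<^sup>2"
| "jetP _ _ a b s = 0"

definition jetD :: "nat \<Rightarrow> nat \<Rightarrow> complex \<Rightarrow> complex \<Rightarrow> complex \<Rightarrow> complex" where
  "jetD j l a b s = jetP j l a b s * exp (- stabA 0 a b s)"

lemma jetD_deriv_a:
  assumes "j + l < 2" "a \<in> stabT_dom"
  shows "((\<lambda>a. jetD j l a b s) has_field_derivative jetD (Suc j) l a b s) (at a)"
proof -
  note d = stabA_deriv_a[OF _ assms(2), of 0, simplified] stabA_deriv_a[OF _ assms(2), of 1, simplified]
    stabeta_deriv[OF _ assms(2), of 0, simplified]
  from assms(1) consider "j = 0" "l = 0" | "j = 1" "l = 0" | "j = 0" "l = 1" by linarith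
  then show ?thesis
    by cases (auto simp: jetD_def[abs_def] power2_eq_square algebra_simps numeral_2_eq_2
        intro!: derivative_eq_intros d)
qed

lemma jetD_deriv_b:
  assumes "j + l < 2"
  shows "((\<lambda>b. jetD j l a b s) has_field_derivative jetD j (Suc l) a b s) (at b)"
proof -
  note d = stabA_deriv_b
  from assms(1) consider "j = 0" "l = 0" | "j = 1" "l = 0" | "j = 0" "l = 1" by linarith
  then show ?thesis
    by cases (auto simp: jetD_def[abs_def] power2_eq_square algebra_simps numeral_2_eq_2
        intro!: derivative_eq_intros d)
qed

text \<open>Polynomial growth in \<open>s\<close>, uniform for \<open>a\<close> and \<open>b\<close>
  in compact intervals. The class is closed under the ring operations, so it passes from
  \<open>stabA\<close> and \<open>stabeta\<close> to every \<open>jetP\<close>; the point 0 is left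
  out because of the logarithm. The decay of exp(- \<open>stabA\<close>) in the strip beats any such
  growth.\<close>

definition poly_bdd :: "real \<Rightarrow> real \<Rightarrow> real \<Rightarrow> (complex \<Rightarrow> complex \<Rightarrow> complex \<Rightarrow> complex) \<Rightarrow> bool" where
  "poly_bdd a0 a1 B X \<longleftrightarrow> (\<exists>C N. \<forall>a\<in>{a0..a1}. \<forall>b\<in>{-B..B}. \<forall>s. s \<noteq> 0 \<longrightarrow>
     norm (X (complex_of_real a) (complex_of_real b) s) \<le> C * (1 + norm s) ^ N)"

lemma poly_bddI:
  assumes "\<And>a b s. a \<in> {a0..a1} \<Longrightarrow> b \<in> {-B..B} \<Longrightarrow> s \<noteq> 0 \<Longrightarrow>
     norm (X (complex_of_real a) (complex_of_real b) s) \<le> C * (1 + norm s) ^ N"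
  shows "poly_bdd a0 a1 B X"
  unfolding poly_bdd_def using assms by blast

lemma poly_bddE:
  assumes "poly_bdd a0 a1 B X"
  obtains C N where "C \<ge> 0"
    "\<And>a b s. a \<in> {a0..a1} \<Longrightarrow> b \<in> {-B..B} \<Longrightarrow> s \<noteq> 0 \<Longrightarrow>
     norm (X (complex_of_real a) (complex_of_real b) s) \<le> C * (1 + norm s) ^ N"
proof -
  from assms obtain C N where C: "\<And>a b s. a \<in> {a0..a1} \<Longrightarrow> b \<in> {-B..B} \<Longrightarrow> s \<noteq> 0 \<Longrightarrow>
     norm (X (complex_of_real a) (complex_of_real b) s) \<le> C * (1 + norm s) ^ N"
    unfolding poly_bdd_def by blast
  show ?thesis
  proof (rule that[of "max C 0" N])
    fix a b s assume "a \<in> {a0..a1}" "b \<in> {-B..B}" "s \<noteq> (0::complex)"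
    from C[OF this] show "norm (X (complex_of_real a) (complex_of_real b) s) \<le> max C 0 * (1 + norm s) ^ N"
      by (rule order_trans) (auto intro!: mult_right_mono)
  qed simp
qed

lemma poly_bdd_mult:
  assumes "poly_bdd a0 a1 B X" "poly_bdd a0 a1 B Y"
  shows "poly_bdd a0 a1 B (\<lambda>a b s. X a b s * Y a b s)"
proof -
  from assms(1) obtain C N where C: "C \<ge> 0" "\<And>a b s. a \<in> {a0..a1} \<Longrightarrow> b \<in> {-B..B} \<Longrightarrow> s \<noteq> 0 \<Longrightarrow>
     norm (X (complex_of_real a) (complex_of_real b) s) \<le> C * (1 + norm s) ^ N" by (rule poly_bddE) blast
  from assms(2) obtain D M where D: "D \<ge> 0" "\<And>a b s. a \<in> {a0..a1} \<Longrightarrow> b \<in> {-B..B} \<Longrightarrow> s \<noteq> 0 \<Longrightarrow>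
     norm (Y (complex_of_real a) (complex_of_real b) s) \<le> D * (1 + norm s) ^ M" by (rule poly_bddE) blast
  show ?thesis
  proof (rule poly_bddI)
    fix a b s assume *: "a \<in> {a0..a1}" "b \<in> {-B..B}" "s \<noteq> (0::complex)"
    have "norm (X a b s * Y a b s) \<le> (C * (1 + norm s) ^ N) * (D * (1 + norm s) ^ M)"
      unfolding norm_mult using C D * by (intro mult_mono) auto
    then show "norm (X a b s * Y a b s) \<le> (C * D) * (1 + norm s) ^ (N + M)"
      by (simp add: power_add mult_ac)
  qed
qed

lemma poly_bdd_add:
  assumes "poly_bdd a0 a1 B X" "poly_bdd a0 a1 B Y"
  shows "poly_bdd a0 a1 B (\<lambda>a b s. X a b s + Y a b s)"
proof -
  from assms(1) obtain C N where C: "C \<ge> 0" "\<And>a b s. a \<in> {a0..a1} \<Longrightarrow> b \<in> {-B..B} \<Longrightarrow> s \<noteq> 0 \<Longrightarrow>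
     norm (X (complex_of_real a) (complex_of_real b) s) \<le> C * (1 + norm s) ^ N" by (rule poly_bddE) blast
  from assms(2) obtain D M where D: "D \<ge> 0" "\<And>a b s. a \<in> {a0..a1} \<Longrightarrow> b \<in> {-B..B} \<Longrightarrow> s \<noteq> 0 \<Longrightarrow>
     norm (Y (complex_of_real a) (complex_of_real b) s) \<le> D * (1 + norm s) ^ M" by (rule poly_bddE) blast
  show ?thesis
  proof (rule poly_bddI)
    fix a b s assume *: "a \<in> {a0..a1}" "b \<in> {-B..B}" "s \<noteq> (0::complex)"
    have "norm (X a b s + Y a b s) \<le> C * (1 + norm s) ^ N + D * (1 + norm s) ^ M"
      using C(2)[OF *] D(2)[OF *] norm_triangle_ineq by (meson add_mono order_trans)
    also have "\<dots> \<le> C * (1 + norm s) ^ (N + M) + D * (1 + norm s) ^ (N + M)"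
      using C(1) D(1) by (intro add_mono mult_left_mono power_increasing) auto
    finally show "norm (X a b s + Y a b s) \<le> (C + D) * (1 + norm s) ^ (N + M)"
      by (simp add: algebra_simps)
  qed
qed

lemma poly_bdd_const: "poly_bdd a0 a1 B (\<lambda>a b s. c)"
  by (rule poly_bddI[where C="norm c" and N=0]) simp

lemma poly_bdd_uminus: "poly_bdd a0 a1 B X \<Longrightarrow> poly_bdd a0 a1 B (\<lambda>a b s. - X a b s)"
  by (simp add: poly_bdd_def)

lemma poly_bdd_power: "poly_bdd a0 a1 B X \<Longrightarrow> poly_bdd a0 a1 B (\<lambda>a b s. X a b s ^ n)"
  by (induction n) (auto intro: poly_bdd_const poly_bdd_mult)

lemma poly_bdd_diff:
  "poly_bdd a0 a1 B X \<Longrightarrow> poly_bdd a0 a1 B Y \<Longrightarrow> poly_bdd a0 a1 B (\<lambda>a b s. X a b s - Y a b s)"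
  using poly_bdd_add[of a0 a1 B X "\<lambda>a b s. - Y a b s"] by (simp add: poly_bdd_uminus)

lemma poly_bdd_sum: "(\<And>i. i \<in> I \<Longrightarrow> poly_bdd a0 a1 B (X i)) \<Longrightarrow>
    poly_bdd a0 a1 B (\<lambda>a b s. \<Sum>i\<in>I. X i a b s)"
  by (induction I rule: infinite_finite_induct) (auto intro: poly_bdd_const poly_bdd_add)

lemma poly_bdd_b: "poly_bdd a0 a1 B (\<lambda>a b s. b)"
  by (rule poly_bddI[where C=B and N=0]) auto

text \<open>Near 0 the power has to absorb the logarithms, for large \<open>r\<close> everything is
  polynomial; the constant adds the two cases so that one bound holds throughout. The summand pi
  comes from the imaginary part of \<open>Ln\<close>.\<close>

lemma powr_log_le:
  assumes "0 < p0" "p0 \<le> p" "p \<le> 2" "r > 0"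
  shows "r powr p * (\<bar>ln r\<bar> + pi) ^ j \<le> ((real (Suc j) / p0 + pi) ^ j + 4 ^ j) * (1 + r) ^ (2 + j)"
proof (cases "r \<le> 1")
  case True
  \<comment> \<open>The exponent \<open>p0\<close> is divided among \<open>Suc j\<close> factors:
    each of the \<open>j\<close> logarithms costs r^(-d), and d j <= p0 <= p leaves a nonnegative
    power of r.\<close>
  define d where "d = p0 / real (Suc j)"
  have d: "d > 0" using assms by (simp add: d_def)
  have dj: "d * j \<le> p"
  proof -
    have "d * j \<le> d * real (Suc j)" using d by (intro mult_left_mono) auto
    also have "\<dots> = p0" by (simp add: d_def)
    finally show ?thesis using assms by simp
  qed
  have "\<bar>ln r\<bar> = ln (1 / r)" using True assms by (simp add: ln_div)
  also have "\<dots> \<le> (1 / r) powr d / d" using True assms d by (intro ln_powr_bound) auto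
  finally have "\<bar>ln r\<bar> + pi \<le> (1 / r) powr d / d + pi * (1 / r) powr d"
    using True assms d ge_one_powr_ge_zero[of "1/r" d] by (intro add_mono) auto
  also have "\<dots> = (1 / d + pi) * r powr (- d)"
    using assms by (simp add: powr_minus powr_divide field_simps)
  finally have "(\<bar>ln r\<bar> + pi) ^ j \<le> ((1 / d + pi) * r powr (- d)) ^ j"
    by (intro power_mono) auto
  also have "\<dots> = (1 / d + pi) ^ j * r powr (- (d * j))"
    using assms by (simp add: power_mult_distrib powr_powr flip: powr_realpow)
  finally have "r powr p * (\<bar>ln r\<bar> + pi) ^ j \<le> r powr p * ((1 / d + pi) ^ j * r powr (- (d * j)))"
    by (intro mult_left_mono) auto
  also have "\<dots> = (1 / d + pi) ^ j * r powr (p - d * j)"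
    using assms by (simp add: powr_diff powr_minus field_simps)
  also have "\<dots> \<le> (1 / d + pi) ^ j * 1"
    using True assms dj d by (intro mult_left_mono powr_le1) auto
  also have "\<dots> \<le> ((real (Suc j) / p0 + pi) ^ j + 4 ^ j) * 1"
    by (simp add: d_def)
  also have "\<dots> \<le> ((real (Suc j) / p0 + pi) ^ j + 4 ^ j) * (1 + r) ^ (2 + j)"
    using assms by (intro mult_left_mono one_le_power add_nonneg_nonneg zero_le_power) auto
  finally show ?thesis .
next
  case False
  then have r: "r > 1" by simp
  have "r powr p \<le> r powr 2" using r assms by (intro powr_mono) auto
  also have "\<dots> \<le> (1 + r) ^ 2" using r by (simp add: power_mono)
  finally have 1: "r powr p \<le> (1 + r) ^ 2" .
  have "ln r \<le> r" using r ln_le_minus_one[of r] by simp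
  then have "\<bar>ln r\<bar> + pi \<le> 4 * (1 + r)" using r pi_less_4 by simp
  then have 2: "(\<bar>ln r\<bar> + pi) ^ j \<le> (4 * (1 + r)) ^ j" by (intro power_mono) auto
  have "r powr p * (\<bar>ln r\<bar> + pi) ^ j \<le> (1 + r) ^ 2 * (4 * (1 + r)) ^ j"
    using 1 2 r by (intro mult_mono) auto
  also have "\<dots> = 4 ^ j * (1 + r) ^ (2 + j)"
    by (simp only: power_mult_distrib power_add mult_ac)
  also have "\<dots> \<le> ((real (Suc j) / p0 + pi) ^ j + 4 ^ j) * (1 + r) ^ (2 + j)"
    using r assms by (intro mult_right_mono) auto
  finally show ?thesis .
qed

lemma norm_Ln_le: "s \<noteq> 0 \<Longrightarrow> norm (Ln s) \<le> \<bar>ln (norm s)\<bar> + pi"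
proof -
  assume s: "s \<noteq> 0"
  have "norm (Ln s) \<le> \<bar>Re (Ln s)\<bar> + \<bar>Im (Ln s)\<bar>" by (rule cmod_le)
  also have "\<bar>Im (Ln s)\<bar> \<le> pi" using mpi_less_Im_Ln[OF s] Im_Ln_le_pi[OF s] by simp
  finally show ?thesis using s by simp
qed

lemma norm_exp_Ln: "s \<noteq> 0 \<Longrightarrow> norm (exp (complex_of_real a * Ln s)) = norm s powr a"
  by (simp add: powr_def mult.commute)

lemma poly_bdd_power_log:
  assumes "0 < a0" "a1 \<le> 2"
  shows "poly_bdd a0 a1 B (\<lambda>a b s. exp (a * Ln s) * Ln s ^ j)"
proof (rule poly_bddI)
  fix a b s assume *: "a \<in> {a0..a1}" "b \<in> {-B..B}" "s \<noteq> (0::complex)"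
  have "norm (exp (of_real a * Ln s) * Ln s ^ j) = norm s powr a * norm (Ln s) ^ j"
    using * by (simp add: norm_mult norm_power norm_exp_Ln del: norm_exp_eq_Re)
  also have "\<dots> \<le> norm s powr a * (\<bar>ln (norm s)\<bar> + pi) ^ j"
    using * norm_Ln_le by (intro mult_left_mono power_mono) auto
  also have "\<dots> \<le> ((real (Suc j) / a0 + pi) ^ j + 4 ^ j) * (1 + norm s) ^ (2 + j)"
    using * assms by (intro powr_log_le) auto
  finally show "norm (exp (of_real a * Ln s) * Ln s ^ j) \<le>
    ((real (Suc j) / a0 + pi) ^ j + 4 ^ j) * (1 + norm s) ^ (2 + j)" .
qed

text \<open>\<open>expint\<close> is bounded by the maximum of 1 and |s|^(a - 1). Taking the sum
  instead of the maximum removes the distinction of a < 1 from a > 1 and of |s| < 1 from |s| >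
  1.\<close>

lemma norm_stabQ_le:
  assumes "s \<noteq> 0"
  shows "norm (stabQ j (of_real a) s) \<le> (norm s + norm s powr a) * (\<bar>ln (norm s)\<bar> + pi) ^ Suc j"
proof -
  have "norm (expint j ((of_real a - 1) * Ln s)) \<le> exp (max 0 ((a - 1) * ln (norm s)))"
    using norm_expint_le[of j "(of_real a - 1) * Ln s"] assms by simp
  also have "\<dots> \<le> 1 + norm s powr (a - 1)"
    using assms by (auto simp: max_def powr_def)
  finally have e: "norm (expint j ((of_real a - 1) * Ln s)) \<le> 1 + norm s powr (a - 1)" .
  have "norm (stabQ j (of_real a) s) =
      norm s * norm (Ln s) ^ Suc j * norm (expint j ((of_real a - 1) * Ln s))"
    by (simp add: stabQ_def norm_mult norm_power)
  also have "\<dots> \<le> norm s * (\<bar>ln (norm s)\<bar> + pi) ^ Suc j * (1 + norm s powr (a - 1))"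
    using e assms norm_Ln_le by (intro mult_mono power_mono) auto
  also have "\<dots> = (norm s + norm s powr a) * (\<bar>ln (norm s)\<bar> + pi) ^ Suc j"
    using assms by (simp add: powr_diff field_simps)
  finally show ?thesis .
qed

lemma poly_bdd_stabQ:
  assumes "0 < a0" "a1 \<le> 2"
  shows "poly_bdd a0 a1 B (\<lambda>a b s. stabQ j a s)"
proof (rule poly_bddI)
  fix a b s assume *: "a \<in> {a0..a1}" "b \<in> {-B..B}" "s \<noteq> (0::complex)"
  have "norm (stabQ j (of_real a) s) \<le> norm s powr 1 * (\<bar>ln (norm s)\<bar> + pi) ^ Suc j
      + norm s powr a * (\<bar>ln (norm s)\<bar> + pi) ^ Suc j"
    using norm_stabQ_le[of s j a] * by (simp add: algebra_simps)
  also have "\<dots> \<le> ((real (Suc (Suc j)) / min 1 a0 + pi) ^ Suc j + 4 ^ Suc j) * (1 + norm s) ^ (2 + Suc j)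
     + ((real (Suc (Suc j)) / min 1 a0 + pi) ^ Suc j + 4 ^ Suc j) * (1 + norm s) ^ (2 + Suc j)"
    using * assms by (intro add_mono powr_log_le) auto
  finally show "norm (stabQ j (of_real a) s) \<le>
     (2 * ((real (Suc (Suc j)) / min 1 a0 + pi) ^ Suc j + 4 ^ Suc j)) * (1 + norm s) ^ (2 + Suc j)"
    by (simp only: mult_2 distrib_right)
qed

lemma poly_bdd_stabT:
  assumes "0 < a0" "a1 < 2"
  shows "poly_bdd a0 a1 B (\<lambda>a b s. (deriv ^^ j) stabT a)"
proof -
  have "complex_of_real ` {a0..a1} \<subseteq> stabT_dom"
    using assms stabT_dom_real by auto
  then have "compact ((deriv ^^ j) stabT ` complex_of_real ` {a0..a1})"
    by (intro compact_continuous_image continuous_intros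
        holomorphic_on_imp_continuous_on[OF holomorphic_on_subset[OF stabT_holomorphic]]) auto
  then have "bounded ((deriv ^^ j) stabT ` complex_of_real ` {a0..a1})"
    by (rule compact_imp_bounded)
  then obtain C where "\<forall>y\<in>(deriv ^^ j) stabT ` complex_of_real ` {a0..a1}. norm y \<le> C"
    unfolding bounded_iff by auto
  then show ?thesis by (intro poly_bddI[where C=C and N=0]) auto
qed

lemma poly_bdd_stabeta:
  assumes "0 < a0" "a1 < 2"
  shows "poly_bdd a0 a1 B (\<lambda>a b s. stabeta j a s)"
  unfolding stabeta_def using assms
  by (intro poly_bdd_sum poly_bdd_mult poly_bdd_const poly_bdd_stabT poly_bdd_stabQ) auto

lemma poly_bdd_stabA:
  assumes "0 < a0" "a1 < 2"
  shows "poly_bdd a0 a1 B (stabA j)"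
  unfolding stabA_def[abs_def] using assms
  by (intro poly_bdd_add poly_bdd_power_log poly_bdd_mult poly_bdd_const poly_bdd_b poly_bdd_stabeta) auto

lemma poly_bdd_jetP:
  assumes "0 < a0" "a1 < 2"
  shows "poly_bdd a0 a1 B (jetP j l)"
proof -
  have "jetP j l = (if j = 0 \<and> l = 0 then (\<lambda>a b s. 1)
     else if j = 1 \<and> l = 0 then (\<lambda>a b s. - stabA 1 a b s)
     else if j = 0 \<and> l = 1 then (\<lambda>a b s. - (\<i> * stabeta 0 a s))
     else if j = 2 \<and> l = 0 then (\<lambda>a b s. stabA 1 a b s ^ 2 - stabA 2 a b s)
     else if j = 1 \<and> l = 1 then (\<lambda>a b s. \<i> * stabeta 0 a s * stabA 1 a b s - \<i> * stabeta 1 a s)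
     else if j = 0 \<and> l = 2 then (\<lambda>a b s. (\<i> * stabeta 0 a s) ^ 2) else (\<lambda>a b s. 0))"
    by (intro ext, cases "(j, l, 0::complex, 0::complex, 0::complex)" rule: jetP.cases) (auto simp: numeral_2_eq_2)
  then show ?thesis
    using poly_bdd_stabA[OF assms] poly_bdd_stabeta[OF assms]
    by (auto intro!: poly_bdd_const poly_bdd_mult poly_bdd_diff poly_bdd_uminus poly_bdd_power)
qed

section \<open>Joint continuity of the exponent and its jets\<close>

lemma continuous_on_stabQ [continuous_intros]:
  assumes "continuous_on S f" "continuous_on S g" "\<And>x. x \<in> S \<Longrightarrow> g x \<notin> \<real>\<^sub>\<le>\<^sub>0"
  shows "continuous_on S (\<lambda>x. stabQ j (f x) (g x))"
  unfolding stabQ_def using assms by (intro continuous_intros) auto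

lemma continuous_on_stabT [continuous_intros]:
  assumes "continuous_on S f" "\<And>x. x \<in> S \<Longrightarrow> f x \<in> stabT_dom"
  shows "continuous_on S (\<lambda>x. (deriv ^^ j) stabT (f x))"
  by (rule continuous_on_compose2[OF holomorphic_on_imp_continuous_on[OF stabT_holomorphic] assms(1)])
    (use assms in auto)

lemma continuous_on_stabeta [continuous_intros]:
  assumes "continuous_on S f" "continuous_on S g" "\<And>x. x \<in> S \<Longrightarrow> f x \<in> stabT_dom"
    "\<And>x. x \<in> S \<Longrightarrow> g x \<notin> \<real>\<^sub>\<le>\<^sub>0"
  shows "continuous_on S (\<lambda>x. stabeta j (f x) (g x))"
  unfolding stabeta_def using assms by (intro continuous_intros) auto

lemma continuous_on_stabA [continuous_intros]:
  assumes "continuous_on S f" "continuous_on S h" "continuous_on S g"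
    "\<And>x. x \<in> S \<Longrightarrow> f x \<in> stabT_dom" "\<And>x. x \<in> S \<Longrightarrow> g x \<notin> \<real>\<^sub>\<le>\<^sub>0"
  shows "continuous_on S (\<lambda>x. stabA j (f x) (h x) (g x))"
  unfolding stabA_def using assms by (intro continuous_intros) auto

lemma continuous_on_jetD [continuous_intros]:
  assumes "continuous_on S f" "continuous_on S h" "continuous_on S g"
    "\<And>x. x \<in> S \<Longrightarrow> f x \<in> stabT_dom" "\<And>x. x \<in> S \<Longrightarrow> g x \<notin> \<real>\<^sub>\<le>\<^sub>0"
  shows "continuous_on S (\<lambda>x. jetD j l (f x) (h x) (g x))"
proof -
  have "continuous_on S (\<lambda>x. jetP j l (f x) (h x) (g x))"
    by (cases "(j, l, 0::complex, 0::complex, 0::complex)" rule: jetP.cases)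
      (use assms in \<open>auto intro!: continuous_intros\<close>)
  then show ?thesis
    unfolding jetD_def using assms by (intro continuous_intros) auto
qed

section \<open>The exponent on the half line and in the strip\<close>

lemma stabeta_real:
  assumes "0 < a" "a < 2" "t > 0"
  shows "stabeta 0 (of_real a) (of_real t) \<in> \<real>"
proof (cases "a = 1")
  case True
  then show ?thesis using assms by (simp add: stabeta_1 Ln_of_real)
next
  case False
  have "exp (complex_of_real a * Ln (of_real t)) = of_real (exp (a * ln t))"
    using assms by (simp add: Ln_of_real flip: exp_of_real)
  then show ?thesis using False assms by (simp add: stabeta_tan)
qed

text \<open>For real \<open>t\<close> the skewness term is i \<beta> times a real number, so it
  changes only the phase: the modulus of the characteristic function is exp(- t^a) for every
  \<beta>.\<close>

lemma Re_stabA_real: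
  assumes "0 < a" "a < 2" "t > 0"
  shows "Re (stabA 0 (of_real a) (of_real b) (of_real t)) = t powr a"
proof -
  obtain e where e: "stabeta 0 (of_real a) (of_real t) = of_real e"
    using stabeta_real[OF assms] by (auto elim: Reals_cases)
  have "exp (complex_of_real a * Ln (of_real t)) = of_real (t powr a)"
    using assms by (simp add: Ln_of_real powr_def flip: of_real_mult exp_of_real)
  then show ?thesis by (simp add: stabA_def e)
qed

lemma stabA_deriv_s:
  assumes "s \<notin> \<real>\<^sub>\<le>\<^sub>0"
  shows "((\<lambda>s. stabA 0 a b s) has_field_derivative
      a * exp (a * Ln s) / s + \<i> * b * (stabT a *
        ((1 + Ln s) * expint 0 ((a - 1) * Ln s) + (a - 1) * Ln s * expint 1 ((a - 1) * Ln s)))) (at s)"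
proof -
  have "s \<noteq> 0" using assms by auto
  then show ?thesis
    unfolding stabA_def stabeta_0 stabQ_def using assms
    by (auto intro!: derivative_eq_intros simp: field_simps)
qed

lemma norm_expint_log_le:
  assumes "s \<noteq> 0"
  shows "norm (expint j ((of_real a - 1) * Ln s)) \<le> 1 + norm s powr (a - 1)"
proof -
  have "norm (expint j ((of_real a - 1) * Ln s)) \<le> exp (max 0 ((a - 1) * ln (norm s)))"
    using norm_expint_le[of j "(of_real a - 1) * Ln s"] assms by simp
  also have "\<dots> \<le> 1 + norm s powr (a - 1)"
    using assms by (auto simp: max_def powr_def)
  finally show ?thesis .
qed

text \<open>On the real axis the real part is t^a. Moving down by y <= 1 changes it by at most the
  supremum of the derivative in \<open>s\<close> over the vertical segment, which is O((1 + ln t) (1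
  + t^(a - 1))) and hence of lower order than t^a, uniformly in \<open>a\<close> and
  \<open>b\<close>.\<close>

lemma Re_stabA_ge:
  assumes a01: "0 < a0" "a1 < 2"
  obtains D where "D \<ge> 0"
    "\<And>a b t y. a \<in> {a0..a1} \<Longrightarrow> b \<in> {-B..B} \<Longrightarrow> t \<ge> 1 \<Longrightarrow> y \<in> {0..1} \<Longrightarrow>
      Re (stabA 0 (complex_of_real a) (complex_of_real b) (Complex t (- y))) \<ge>
        t powr a - D * (1 + ln (1 + t)) * (1 + t powr a / t)"
proof (cases "B \<ge> 0")
  case False
  then show ?thesis using that[of 0] by auto
next
  case B: True
  obtain CT where CT: "\<And>a. a \<in> {a0..a1} \<Longrightarrow> norm (stabT (complex_of_real a)) \<le> CT"
  proof -
    obtain C N where "\<And>a b s. a \<in> {a0..a1} \<Longrightarrow> b \<in> {-B..B} \<Longrightarrow> s \<noteq> (0::complex) \<Longrightarrow>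
     norm (stabT (complex_of_real a)) \<le> C * (1 + norm s) ^ N"
      using poly_bdd_stabT[OF a01, of B 0, simplified] by (rule poly_bddE) blast
    from this[of _ 0 1] B show ?thesis by (intro that) auto
  qed
  define CT' where "CT' = max CT 0"
  have CT': "CT' \<ge> 0" "\<And>a. a \<in> {a0..a1} \<Longrightarrow> norm (stabT (complex_of_real a)) \<le> CT'"
    using CT unfolding CT'_def by force+
  \<comment> \<open>\<open>2 + 10 * B * CT'\<close> bounds the derivative up to its logarithm and
    the factor \<open>1 + p\<close>; the outer 10 covers the comparison
    \<open>1 + p \<le> 5 * P\<close>.\<close>
  define D where "D = 10 * (2 + 10 * B * CT')"
  show ?thesis
  proof (rule that[of D])
    show "D \<ge> 0" using B CT' by (simp add: D_def)
    fix a b t y assume *: "a \<in> {a0..a1}" "b \<in> {-B..B}" "t \<ge> (1::real)" "y \<in> {0..(1::real)}"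
    define \<psi> where "\<psi> = (\<lambda>s. stabA 0 (complex_of_real a) (complex_of_real b) s)"
    define \<psi>' where "\<psi>' = (\<lambda>s. a * exp (a * Ln s) / s + \<i> * b * (stabT a *
        ((1 + Ln s) * expint 0 ((of_real a - 1) * Ln s)
          + (of_real a - 1) * Ln s * expint 1 ((of_real a - 1) * Ln s))))"
    define S where "S = closed_segment (complex_of_real t) (Complex t (- y))"
    have S: "Re s = t" "\<bar>Im s\<bar> \<le> 1" if "s \<in> S" for s
      using that * by (auto simp: S_def closed_segment_same_Re closed_segment_eq_real_ivl complex_eq_iff split: if_splits)
    define K where "K = D * (1 + ln (1 + t)) * (1 + t powr a / t)"
    have "norm (\<psi> (Complex t (- y)) - \<psi> (complex_of_real t)) \<le> K * norm (Complex t (- y) - complex_of_real t)"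
    proof (rule field_differentiable_bound[where S=S and f'=\<psi>'])
      fix s assume s: "s \<in> S"
      have s': "s \<notin> \<real>\<^sub>\<le>\<^sub>0" "s \<noteq> 0"
        using S[OF s] * by (auto simp: complex_nonpos_Reals_iff complex_eq_iff)
      show "(\<psi> has_field_derivative \<psi>' s) (at s within S)"
        unfolding \<psi>_def \<psi>'_def by (rule has_field_derivative_at_within[OF stabA_deriv_s[OF s'(1)]])
      have n1: "norm s \<le> 1 + t" using cmod_le[of s] S[OF s] * by auto
      have n2: "norm s \<ge> t" using complex_Re_le_cmod[of s] S[OF s] by auto
      define p where "p = norm s powr (a - 1)"
      define P where "P = 1 + t powr a / t"
      \<comment> \<open>On the segment t <= |s| <= 2 t. For a >= 1 the power is compared with that
        of 2 t, for a < 1 it is at most 1.\<close>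
      have pP: "1 + p \<le> 5 * P"
      proof (cases "a \<ge> 1")
        case True
        have "p \<le> (2 * t) powr (a - 1)" unfolding p_def
          using True n1 * n2 by (intro powr_mono2) auto
        also have "\<dots> = 2 powr (a - 1) * (t powr a / t)"
          using * by (simp add: powr_mult powr_diff)
        also have "\<dots> \<le> 2 powr 1 * (t powr a / t)"
          using a01 * by (intro mult_right_mono powr_mono) auto
        finally have "p \<le> 2 * (t powr a / t)" by simp
        moreover have "t powr a / t \<ge> 0" using * by simp
        moreover have "1 + p \<le> 5 * (1 + q)" if "p \<le> 2 * q" "0 \<le> q" for q :: real
          using that by simp
        ultimately show ?thesis unfolding P_def by blast
      next
        case False
        then have "p \<le> norm s powr 0" unfolding p_def using n2 * by (intro powr_mono) auto
        then have "p \<le> 1" using s' by simp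
        then show ?thesis using * by (simp add: P_def add_increasing2)
      qed
      have p0: "p \<ge> 0" "P \<ge> 1" using * by (auto simp: p_def P_def)
      have L: "norm (Ln s) \<le> ln (1 + t) + 4"
      proof -
        have "\<bar>ln (norm s)\<bar> = ln (norm s)" using n2 * by simp
        also have "\<dots> \<le> ln (1 + t)" using n1 s' * by (subst ln_le_cancel_iff) auto
        finally show ?thesis using norm_Ln_le[OF s'(2)] pi_less_4 by linarith
      qed
      have l0: "ln (1 + t) \<ge> 0" using * by simp
      have "norm (a * exp (a * Ln s) / s) = \<bar>a\<bar> * p"
        unfolding norm_divide norm_mult norm_exp_Ln[OF s'(2)] p_def using s' by (simp add: powr_diff)
      also have "\<dots> \<le> 2 * p" using * a01 p0 by (intro mult_right_mono) auto
      finally have t1: "norm (a * exp (a * Ln s) / s) \<le> 2 * p" .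
      have e: "norm (expint j ((of_real a - 1) * Ln s)) \<le> 1 + p" for j
        unfolding p_def by (rule norm_expint_log_le[OF s'(2)])
      have "norm ((1 + Ln s) * expint 0 ((of_real a - 1) * Ln s)) \<le> (5 + ln (1 + t)) * (1 + p)"
        unfolding norm_mult using e L norm_triangle_ineq[of 1 "Ln s"] l0 by (intro mult_mono) auto
      moreover have "norm ((of_real a - 1) * Ln s * expint 1 ((of_real a - 1) * Ln s))
          \<le> 1 * (ln (1 + t) + 4) * (1 + p)"
      proof -
        have "norm (complex_of_real a - 1) = \<bar>a - 1\<bar>"
          by (metis norm_of_real of_real_1 of_real_diff)
        then have "norm (complex_of_real a - 1) \<le> 1" using * a01 by auto
        then show ?thesis
          unfolding norm_mult using e[of 1] L l0 by (intro mult_mono) auto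
      qed
      ultimately have "norm ((1 + Ln s) * expint 0 ((of_real a - 1) * Ln s) +
          (of_real a - 1) * Ln s * expint 1 ((of_real a - 1) * Ln s))
          \<le> (5 + ln (1 + t)) * (1 + p) + 1 * (ln (1 + t) + 4) * (1 + p)"
        by (rule norm_triangle_mono)
      also have "\<dots> \<le> 10 * (1 + ln (1 + t)) * (1 + p)"
        using l0 p0 by (simp add: algebra_simps)
      finally have t2: "norm ((1 + Ln s) * expint 0 ((of_real a - 1) * Ln s) +
          (of_real a - 1) * Ln s * expint 1 ((of_real a - 1) * Ln s))
          \<le> 10 * (1 + ln (1 + t)) * (1 + p)" .
      have "norm (\<i> * b * (stabT a * ((1 + Ln s) * expint 0 ((of_real a - 1) * Ln s) +
          (of_real a - 1) * Ln s * expint 1 ((of_real a - 1) * Ln s))))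
          \<le> 1 * B * (CT' * (10 * (1 + ln (1 + t)) * (1 + p)))"
        unfolding norm_mult[of "\<i> * b"] norm_mult[of "\<i>"] norm_mult[of "stabT a"]
        using t2 CT' * B by (intro mult_mono) auto
      with t1 have "norm (\<psi>' s) \<le> 2 * p + 1 * B * (CT' * (10 * (1 + ln (1 + t)) * (1 + p)))"
        unfolding \<psi>'_def by (rule norm_triangle_mono)
      also have "\<dots> \<le> 2 * (1 + ln (1 + t)) * (1 + p) + (10 * B * CT') * (1 + ln (1 + t)) * (1 + p)"
      proof -
        have "p \<le> (1 + ln (1 + t)) * (1 + p)"
          using l0 p0 by (simp add: algebra_simps)
        then have "2 * p \<le> 2 * (1 + ln (1 + t)) * (1 + p)"
          unfolding mult.assoc by (intro mult_left_mono) auto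
        moreover have "1 * B * (CT' * (10 * (1 + ln (1 + t)) * (1 + p))) =
            (10 * B * CT') * (1 + ln (1 + t)) * (1 + p)" by (simp only: mult_ac mult_1_left)
        ultimately show ?thesis by linarith
      qed
      also have "\<dots> = (2 + 10 * B * CT') * (1 + ln (1 + t)) * (1 + p)"
        by (simp add: algebra_simps)
      also have "\<dots> \<le> (2 + 10 * B * CT') * (1 + ln (1 + t)) * (5 * P)"
        using pP l0 B CT' by (intro mult_left_mono) auto
      also have "\<dots> \<le> K"
        unfolding K_def D_def P_def[symmetric] using l0 B CT' p0 by simp
      finally show "norm (\<psi>' s) \<le> K" .
    qed (auto simp: S_def)
    moreover have "norm (Complex t (- y) - complex_of_real t) \<le> 1"
    proof -
      have "Complex t (- y) - complex_of_real t = - (\<i> * of_real y)"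
        by (simp add: complex_eq_iff)
      then show ?thesis using * by (simp add: norm_mult)
    qed
    moreover have "K \<ge> 0"
      unfolding K_def using \<open>D \<ge> 0\<close> * by (intro mult_nonneg_nonneg) auto
    ultimately have "norm (\<psi> (Complex t (- y)) - \<psi> (complex_of_real t)) \<le> K"
      by (meson mult_left_le order_trans)
    then have "\<bar>Re (\<psi> (Complex t (- y))) - Re (\<psi> (complex_of_real t))\<bar> \<le> K"
      using abs_Re_le_cmod[of "\<psi> (Complex t (- y)) - \<psi> (complex_of_real t)"] by simp
    moreover have "Re (\<psi> (complex_of_real t)) = t powr a"
      unfolding \<psi>_def using * a01 by (intro Re_stabA_real) auto
    ultimately show "Re (stabA 0 (complex_of_real a) (complex_of_real b) (Complex t (- y))) \<ge>
        t powr a - D * (1 + ln (1 + t)) * (1 + t powr a / t)"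
      unfolding K_def[symmetric] \<psi>_def by linarith
  qed
qed

text \<open>The closed half strip bounded by the real axis and the shifted path, without the branch
  point 0 of \<open>Ln\<close>; its other points avoid the cut.\<close>

definition strip :: "complex set" where
  "strip = {s. 0 \<le> Re s \<and> - 1 \<le> Im s \<and> Im s \<le> 0 \<and> s \<noteq> 0}"

lemma strip_notin_nonpos: "s \<in> strip \<Longrightarrow> s \<notin> \<real>\<^sub>\<le>\<^sub>0"
  by (auto simp: strip_def complex_nonpos_Reals_iff complex_eq_iff)

text \<open>For large Re s the exponential beats every polynomial, and for bounded Re s all factors
  are bounded. The shape of the right-hand side is chosen for the path \<open>contour\<close>: there
  v <= 1 + Re s, so it turns into the integrable kernel 1 / (1 + v^2).\<close>

lemma jetD_strip_bound:
  assumes a01: "0 < a0" "a1 < 2"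
  obtains C where
    "C \<ge> 0" "\<And>a b s. a \<in> {a0..a1} \<Longrightarrow> b \<in> {-B..B} \<Longrightarrow> s \<in> strip \<Longrightarrow>
      norm (s ^ k * jetD j l (complex_of_real a) (complex_of_real b) s) \<le> C / (1 + (1 + Re s)\<^sup>2)"
proof -
  obtain D where D: "D \<ge> 0" "\<And>a b t y. a \<in> {a0..a1} \<Longrightarrow> b \<in> {-B..B} \<Longrightarrow> t \<ge> 1 \<Longrightarrow> y \<in> {0..1} \<Longrightarrow>
      Re (stabA 0 (complex_of_real a) (complex_of_real b) (Complex t (- y))) \<ge>
        t powr a - D * (1 + ln (1 + t)) * (1 + t powr a / t)"
    using Re_stabA_ge[OF a01, of B] by metis
  obtain C1 N where C1: "C1 \<ge> 0" "\<And>a b s. a \<in> {a0..a1} \<Longrightarrow> b \<in> {-B..B} \<Longrightarrow> s \<noteq> 0 \<Longrightarrow>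
     norm (jetP j l (complex_of_real a) (complex_of_real b) s) \<le> C1 * (1 + norm s) ^ N"
    using poly_bdd_jetP[OF a01, of B j l] by (rule poly_bddE) blast
  obtain C2 M where C2: "C2 \<ge> 0" "\<And>a b s. a \<in> {a0..a1} \<Longrightarrow> b \<in> {-B..B} \<Longrightarrow> s \<noteq> 0 \<Longrightarrow>
     norm (stabA 0 (complex_of_real a) (complex_of_real b) s) \<le> C2 * (1 + norm s) ^ M"
    using poly_bdd_stabA[OF a01, of B 0] by (rule poly_bddE) blast
  \<comment> \<open>The first limit makes the correction to t^a at most half of it. In the second,
    exp(- t^a0 / 2) absorbs the polynomial bound, the factor (1 + t)^D left over from the
    logarithmic correction, and two more powers that pay for the kernel.\<close>
  have "((\<lambda>t. D * (1 + ln (1 + t)) / t) \<longlongrightarrow> 0) at_top" by real_asymp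
  then have e1: "\<forall>\<^sub>F t in at_top. D * (1 + ln (1 + t)) / t < 1 / 2"
    by (rule order_tendstoD) simp
  have "((\<lambda>t. (2 + t) ^ (k + N + 2) * (1 + t) powr D * exp (- (t powr a0) / 2)) \<longlongrightarrow> 0) at_top"
    using a01 by real_asymp
  then have e2: "\<forall>\<^sub>F t in at_top. (2 + t) ^ (k + N + 2) * (1 + t) powr D * exp (- (t powr a0) / 2) < 1"
    by (rule order_tendstoD) simp
  from eventually_conj[OF e1 e2] obtain t0 where t0: "\<And>t. t \<ge> t0 \<Longrightarrow> D * (1 + ln (1 + t)) / t < 1 / 2"
     "\<And>t. t \<ge> t0 \<Longrightarrow> (2 + t) ^ (k + N + 2) * (1 + t) powr D * exp (- (t powr a0) / 2) < 1"
    by (auto simp: eventually_at_top_linorder)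
  define t1 where "t1 = max t0 1"
  \<comment> \<open>One summand for each of the cases t >= t1 and t < t1; the factor 2 comes from 1
    + (1 + t)^2 <= 2 (2 + t)^2.\<close>
  define C where "C = 2 * C1 * exp D + (2 + t1) ^ (k + N + 2) * 2 * C1 * exp (C2 * (2 + t1) ^ M)"
  show ?thesis
  proof (rule that[of C])
    show "C \<ge> 0" using C1 by (simp add: C_def t1_def)
    fix a b s assume *: "a \<in> {a0..a1}" "b \<in> {-B..B}" "s \<in> strip"
    define t where "t = Re s"
    have t: "t \<ge> 0" "Im s \<in> {-1..0}" "s \<noteq> 0" using * by (auto simp: strip_def t_def)
    have ns: "norm s \<le> 1 + t" using cmod_le[of s] t by (auto simp: t_def)
    let ?E = "exp (- Re (stabA 0 (complex_of_real a) (complex_of_real b) s))"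
    have "norm (s ^ k * jetD j l (complex_of_real a) (complex_of_real b) s) =
        norm s ^ k * norm (jetP j l (complex_of_real a) (complex_of_real b) s) * ?E"
      by (simp add: jetD_def norm_mult norm_power)
    also have "\<dots> \<le> (2 + t) ^ k * (C1 * (2 + t) ^ N) * ?E"
    proof -
      have "norm (jetP j l (complex_of_real a) (complex_of_real b) s) \<le> C1 * (1 + norm s) ^ N"
        using C1 * t by auto
      also have "\<dots> \<le> C1 * (2 + t) ^ N"
        using ns C1 by (intro mult_left_mono power_mono) auto
      finally show ?thesis
        using ns C1 t by (intro mult_mono power_mono mult_nonneg_nonneg) auto
    qed
    finally have 1: "norm (s ^ k * jetD j l (complex_of_real a) (complex_of_real b) s) \<le>
        C1 * ((2 + t) ^ (k + N) * ?E)" by (simp add: power_add mult_ac)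
    have "(2 + t) ^ (k + N + 2) * ?E \<le> exp D + (2 + t1) ^ (k + N + 2) * exp (C2 * (2 + t1) ^ M)"
    proof (cases "t \<ge> t1")
      case True
      then have tt: "t \<ge> 1" "t \<ge> t0" by (auto simp: t1_def)
      have "s = Complex t (- (- Im s))" by (simp add: t_def)
      then have "Re (stabA 0 (complex_of_real a) (complex_of_real b) s) \<ge>
         t powr a - D * (1 + ln (1 + t)) * (1 + t powr a / t)"
        using D(2)[OF *(1,2) tt(1), of "- Im s"] t by auto
      moreover have "D * (1 + ln (1 + t)) * (t powr a / t) \<le> 1 / 2 * t powr a"
        using mult_right_mono[OF less_imp_le[OF t0(1)[OF tt(2)]], of "t powr a"] by simp
      moreover have "t powr a0 \<le> t powr a" using tt * by (intro powr_mono) auto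
      ultimately have "Re (stabA 0 (complex_of_real a) (complex_of_real b) s) \<ge>
         t powr a0 / 2 - D * (1 + ln (1 + t))"
        by (simp add: distrib_left)
      then have "?E \<le> exp (- (t powr a0) / 2 + D * (1 + ln (1 + t)))" by simp
      also have "\<dots> = exp D * ((1 + t) powr D * exp (- (t powr a0) / 2))"
        using tt by (simp add: powr_def distrib_left flip: exp_add)
      finally have "(2 + t) ^ (k + N + 2) * ?E \<le> (2 + t) ^ (k + N + 2) * \<dots>"
        using t by (intro mult_left_mono) auto
      also have "\<dots> = exp D * ((2 + t) ^ (k + N + 2) * (1 + t) powr D * exp (- (t powr a0) / 2))"
        by (simp only: mult_ac)
      also have "\<dots> \<le> exp D * 1"
        using t0(2)[OF tt(2)] by (intro mult_left_mono) auto
      finally show ?thesis by (simp add: t1_def add_increasing2)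
    next
      case False
      have "- Re (stabA 0 (complex_of_real a) (complex_of_real b) s)
          \<le> norm (stabA 0 (complex_of_real a) (complex_of_real b) s)"
        using abs_Re_le_cmod[of "stabA 0 (complex_of_real a) (complex_of_real b) s"] by linarith
      also have "\<dots> \<le> C2 * (1 + norm s) ^ M" using C2 * t by auto
      also have "\<dots> \<le> C2 * (2 + t1) ^ M"
        using ns C2 False by (intro mult_left_mono power_mono) auto
      finally have "(2 + t) ^ (k + N + 2) * ?E \<le> (2 + t1) ^ (k + N + 2) * exp (C2 * (2 + t1) ^ M)"
        using False t by (intro mult_mono power_mono) auto
      then show ?thesis by (simp add: add_increasing)
    qed
    then have "2 * C1 * ((2 + t) ^ (k + N + 2) * ?E) \<le>
        2 * C1 * (exp D + (2 + t1) ^ (k + N + 2) * exp (C2 * (2 + t1) ^ M))"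
      using C1 by (intro mult_left_mono) auto
    also have "\<dots> = C" by (simp only: C_def distrib_left mult_ac)
    finally have 2: "2 * C1 * ((2 + t) ^ (k + N + 2) * ?E) \<le> C" .
    have "C1 * ((2 + t) ^ (k + N) * ?E) * (1 + (1 + t)\<^sup>2) \<le> C1 * ((2 + t) ^ (k + N) * ?E) * (2 * (2 + t)\<^sup>2)"
      using C1 t by (intro mult_left_mono) (auto simp: power2_eq_square algebra_simps)
    also have "\<dots> = 2 * C1 * ((2 + t) ^ (k + N + 2) * ?E)"
      by (simp only: power_add mult_ac)
    also note 2
    finally have "C1 * ((2 + t) ^ (k + N) * ?E) \<le> C / (1 + (1 + t)\<^sup>2)"
      by (simp add: field_simps add_pos_nonneg)
    with 1 show "norm (s ^ k * jetD j l (complex_of_real a) (complex_of_real b) s) \<le> C / (1 + (1 + Re s)\<^sup>2)"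
      unfolding t_def by linarith
  qed
qed

section \<open>The density as a contour integral\<close>

text \<open>
  The path from \<open>0\<close> straight down to \<open>- \<i>\<close> and then to the right, where \<open>exp (- \<i> * s * z)\<close> has modulus
  \<open>exp (- z)\<close>. It is parametrized by \<open>v > 0\<close>; \<open>contour_deriv\<close> vanishes for \<open>v \<le> 0\<close> to make the integrals below run over the
  whole real line.
\<close>
definition contour :: "real \<Rightarrow> complex" where
  "contour v = (if v \<le> 1 then Complex 0 (- v) else Complex (v - 1) (- 1))"

definition contour_deriv :: "real \<Rightarrow> complex" where
  "contour_deriv v = (if v \<le> 0 then 0 else if v \<le> 1 then - \<i> else 1)"

lemma contour_strip: "v > 0 \<Longrightarrow> contour v \<in> strip"
  by (auto simp: contour_def strip_def complex_eq_iff)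

lemma contour_notin_nonpos: "v > 0 \<Longrightarrow> contour v \<notin> \<real>\<^sub>\<le>\<^sub>0"
  using contour_strip strip_notin_nonpos by blast

lemma Re_contour: "v > 0 \<Longrightarrow> v \<le> 1 + Re (contour v)"
  by (auto simp: contour_def)

lemma continuous_on_contour [continuous_intros]: "continuous_on S contour"
proof -
  have contour_eq: "contour = (\<lambda>v. Complex (max 0 (v - 1)) (- min v 1))"
    by (auto simp: contour_def fun_eq_iff complex_eq_iff)
  show ?thesis unfolding contour_eq Complex_eq by (intro continuous_intros)
qed

lemma measurable_contour_deriv [measurable]: "contour_deriv \<in> borel_measurable borel"
  unfolding contour_deriv_def[abs_def] by measurable

lemma norm_contour_deriv_le: "norm (contour_deriv v) \<le> 1"
  by (simp add: contour_deriv_def)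

text \<open>The integrand along the path: each derivative in \<open>z\<close> brings down a factor -
  i s from the exponential.\<close>

definition stabF :: "nat \<Rightarrow> nat \<Rightarrow> nat \<Rightarrow> real \<Rightarrow> real \<Rightarrow> real \<Rightarrow> real \<Rightarrow> complex" where
  "stabF k j l z a b v = contour_deriv v * (- \<i> * contour v) ^ k * exp (- \<i> * contour v * of_real z) *
     jetD j l (of_real a) (of_real b) (contour v)"

lemma stabF_nonpos: "v \<le> 0 \<Longrightarrow> stabF k j l z a b v = 0"
  by (simp add: stabF_def contour_deriv_def)

lemma stabF_measurable:
  assumes "0 < a" "a < 2"
  shows "stabF k j l z a b \<in> borel_measurable borel"
proof -
  have "continuous_on {0<..} (\<lambda>v. (- \<i> * contour v) ^ k * exp (- \<i> * contour v * of_real z) *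
     jetD j l (of_real a) (of_real b) (contour v))"
    using contour_notin_nonpos stabT_dom_real[OF assms] by (intro continuous_intros) auto
  then have "(\<lambda>v. indicator {0<..} v *\<^sub>R ((- \<i> * contour v) ^ k * exp (- \<i> * contour v * of_real z) *
     jetD j l (of_real a) (of_real b) (contour v))) \<in> borel_measurable borel"
    by (intro borel_measurable_continuous_on_indicator) auto
  then have "(\<lambda>v. contour_deriv v * (indicator {0<..} v *\<^sub>R ((- \<i> * contour v) ^ k * exp (- \<i> * contour v * of_real z) *
     jetD j l (of_real a) (of_real b) (contour v)))) \<in> borel_measurable borel"
    by measurable
  also have "(\<lambda>v. contour_deriv v * (indicator {0<..} v *\<^sub>R ((- \<i> * contour v) ^ k * exp (- \<i> * contour v * of_real z) *
     jetD j l (of_real a) (of_real b) (contour v)))) = stabF k j l z a b"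
    by (auto simp: fun_eq_iff stabF_def contour_deriv_def indicator_def)
  finally show ?thesis .
qed

lemma norm_exp_contour: "v > 0 \<Longrightarrow> norm (exp (- \<i> * contour v * of_real z)) = exp (- (min v 1 * z))"
  by (auto simp: contour_def min_def)

text \<open>For z < 0 the exponential grows along the path, up to exp |z|. The bound is thus only
  locally uniform in \<open>z\<close>, which suffices for differentiation under the integral; decay
  for large \<open>z\<close> is obtained from \<open>stabF_segment\<close> and
  \<open>stabF_ray_bound\<close>.\<close>

lemma stabF_bound:
  assumes a01: "0 < a0" "a1 < 2"
  obtains C where
    "C \<ge> 0" "\<And>z a b v. a \<in> {a0..a1} \<Longrightarrow> b \<in> {-B..B} \<Longrightarrow>
      norm (stabF k j l z a b v) \<le> exp \<bar>z\<bar> * C * (1 / (1 + v\<^sup>2))"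
proof -
  obtain C where C: "C \<ge> 0" "\<And>a b s. a \<in> {a0..a1} \<Longrightarrow> b \<in> {-B..B} \<Longrightarrow> s \<in> strip \<Longrightarrow>
      norm (s ^ k * jetD j l (complex_of_real a) (complex_of_real b) s) \<le> C / (1 + (1 + Re s)\<^sup>2)"
    using jetD_strip_bound[OF a01, where B=B and k=k and j=j and l=l] by metis
  show ?thesis
  proof (rule that[OF C(1)])
    fix z a b v assume *: "a \<in> {a0..a1}" "b \<in> {-B..(B::real)}"
    show "norm (stabF k j l z a b v) \<le> exp \<bar>z\<bar> * C * (1 / (1 + v\<^sup>2))"
    proof (cases "v > 0")
      case False
      then show ?thesis using C(1) by (simp add: stabF_nonpos)
    next
      case True
      have "norm (stabF k j l z a b v) = norm (contour_deriv v) * norm (exp (- \<i> * contour v * of_real z)) *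
          norm (contour v ^ k * jetD j l (of_real a) (of_real b) (contour v))"
        by (simp add: stabF_def norm_mult norm_power)
      also have "\<dots> \<le> 1 * exp \<bar>z\<bar> * (C / (1 + (1 + Re (contour v))\<^sup>2))"
      proof (intro mult_mono)
        show "norm (exp (- \<i> * contour v * of_real z)) \<le> exp \<bar>z\<bar>"
        proof -
          have "- (min v 1 * z) \<le> \<bar>min v 1 * z\<bar>" by linarith
          also have "\<dots> \<le> 1 * \<bar>z\<bar>" unfolding abs_mult using True by (intro mult_right_mono) auto
          finally show ?thesis unfolding norm_exp_contour[OF True] by simp
        qed
        show "norm (contour v ^ k * jetD j l (of_real a) (of_real b) (contour v)) \<le> C / (1 + (1 + Re (contour v))\<^sup>2)"
          using C(2)[OF * contour_strip[OF True]] .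
      qed (use norm_contour_deriv_le in auto)
      also have "\<dots> \<le> 1 * exp \<bar>z\<bar> * (C / (1 + v\<^sup>2))"
        using C(1) Re_contour[OF True] True
        by (intro mult_left_mono divide_left_mono add_left_mono power_mono mult_pos_pos add_pos_nonneg) auto
      finally show ?thesis by simp
    qed
  qed
qed

lemma stabF_integrable:
  assumes "0 < a" "a < 2"
  shows "integrable lborel (stabF k j l z a b)"
proof -
  obtain C where C: "C \<ge> 0" "\<And>z a' b' v. a' \<in> {a..a} \<Longrightarrow> b' \<in> {-\<bar>b\<bar>..\<bar>b\<bar>} \<Longrightarrow>
      norm (stabF k j l z a' b' v) \<le> exp \<bar>z\<bar> * C * (1 / (1 + v\<^sup>2))"
    using stabF_bound[OF assms, where B="\<bar>b\<bar>" and k=k and j=j and l=l] by metis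
  show ?thesis
  proof (rule Bochner_Integration.integrable_bound)
    show "integrable lborel (\<lambda>v. exp \<bar>z\<bar> * C * (1 / (1 + v\<^sup>2)))"
      by (intro integrable_mult_right integrable_inverse_1_plus_square_lborel)
    show "AE v in lborel. norm (stabF k j l z a b v) \<le> norm (exp \<bar>z\<bar> * C * (1 / (1 + v\<^sup>2)))"
    proof (intro AE_I2)
      fix v
      have "norm (stabF k j l z a b v) \<le> exp \<bar>z\<bar> * C * (1 / (1 + v\<^sup>2))" by (rule C) auto
      also have "\<dots> \<le> norm \<dots>" by (simp add: divide_right_mono)
      finally show "norm (stabF k j l z a b v) \<le> norm (exp \<bar>z\<bar> * C * (1 / (1 + v\<^sup>2)))" .
    qed
  qed (use stabF_measurable[OF assms] in simp)
qed

text \<open>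
  \<open>stabG k j l z \<alpha> \<beta>\<close> is the derivative of the standardized density, \<open>k\<close> times in \<open>z\<close>, \<open>j\<close> times in \<open>\<alpha>\<close> and
  \<open>l\<close> times in \<open>\<beta>\<close>.
\<close>
definition stabG :: "nat \<Rightarrow> nat \<Rightarrow> nat \<Rightarrow> real \<Rightarrow> real \<Rightarrow> real \<Rightarrow> real" where
  "stabG k j l z a b = (\<integral>v. Re (stabF k j l z a b v) \<partial>lborel) / pi"

lemma DERIV_Re_of_real:
  assumes "(f has_field_derivative f') (at (of_real x))"
  shows "((\<lambda>x. Re (f (complex_of_real x))) has_real_derivative Re f') (at x)"
  using bounded_linear.has_vector_derivative[OF bounded_linear_Re has_vector_derivative_real_field[OF assms]]
  by (simp add: has_real_derivative_iff_has_vector_derivative)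

lemma stabF_deriv_z:
  "((\<lambda>z. Re (stabF k j l z a b v)) has_real_derivative Re (stabF (Suc k) j l z a b v)) (at z)"
  unfolding stabF_def by (rule DERIV_Re_of_real) (auto intro!: derivative_eq_intros)

lemma stabF_deriv_a:
  assumes "j + l < 2" "0 < a" "a < 2"
  shows "((\<lambda>a. Re (stabF k j l z a b v)) has_real_derivative Re (stabF k (Suc j) l z a b v)) (at a)"
  unfolding stabF_def
  by (rule DERIV_Re_of_real)
    (auto intro!: derivative_eq_intros jetD_deriv_a stabT_dom_real assms)

lemma stabF_deriv_b:
  assumes "j + l < 2"
  shows "((\<lambda>b. Re (stabF k j l z a b v)) has_real_derivative Re (stabF k j (Suc l) z a b v)) (at b)"
  unfolding stabF_def
  by (rule DERIV_Re_of_real) (auto intro!: derivative_eq_intros jetD_deriv_b assms)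

lemma Re_stabF_measurable:
  "0 < a \<Longrightarrow> a < 2 \<Longrightarrow> (\<lambda>v. Re (stabF k j l z a b v)) \<in> borel_measurable lborel"
  using stabF_measurable[of a k j l z b] by simp

lemma integrable_exp_bound: "integrable lborel (\<lambda>v. exp Z * C * (1 / (1 + v\<^sup>2)) :: real)"
  by (intro integrable_mult_right integrable_inverse_1_plus_square_lborel)

lemma Re_stabF_bound:
  assumes a01: "0 < a0" "a1 < 2"
  obtains C where
    "\<And>z a b v. \<bar>z\<bar> \<le> Z \<Longrightarrow> a \<in> {a0..a1} \<Longrightarrow> b \<in> {-B..B} \<Longrightarrow>
      \<bar>Re (stabF k j l z a b v)\<bar> \<le> exp Z * C * (1 / (1 + v\<^sup>2))"
proof -
  obtain C where C: "C \<ge> 0" "\<And>z a b v. a \<in> {a0..a1} \<Longrightarrow> b \<in> {-B..B} \<Longrightarrow>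
      norm (stabF k j l z a b v) \<le> exp \<bar>z\<bar> * C * (1 / (1 + v\<^sup>2))"
    using stabF_bound[OF a01, where B=B and k=k and j=j and l=l] by metis
  show ?thesis
  proof (rule that[of C])
    fix z a b v assume *: "\<bar>z\<bar> \<le> Z" "a \<in> {a0..a1}" "b \<in> {-B..B}"
    have "\<bar>Re (stabF k j l z a b v)\<bar> \<le> norm (stabF k j l z a b v)" by (rule abs_Re_le_cmod)
    also have "\<dots> \<le> exp \<bar>z\<bar> * C * (1 / (1 + v\<^sup>2))" using C(2) * by blast
    also have "\<dots> \<le> exp Z * C * (1 / (1 + v\<^sup>2))"
      using * C(1) by (intro mult_right_mono) auto
    finally show "\<bar>Re (stabF k j l z a b v)\<bar> \<le> exp Z * C * (1 / (1 + v\<^sup>2))" .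
  qed
qed

lemma stabG_deriv_z:
  assumes "0 < a" "a < 2"
  shows "((\<lambda>z. stabG k j l z a b) has_real_derivative stabG (Suc k) j l z a b) (at z)"
proof -
  obtain C where C: "\<And>z' a' b' v. \<bar>z'\<bar> \<le> \<bar>z\<bar> + 1 \<Longrightarrow> a' \<in> {a..a} \<Longrightarrow> b' \<in> {-\<bar>b\<bar>..\<bar>b\<bar>} \<Longrightarrow>
      \<bar>Re (stabF (Suc k) j l z' a' b' v)\<bar> \<le> exp (\<bar>z\<bar> + 1) * C * (1 / (1 + v\<^sup>2))"
    using Re_stabF_bound[OF assms, where B="\<bar>b\<bar>" and k="Suc k" and j=j and l=l and Z="\<bar>z\<bar> + 1"] by metis
  have "((\<lambda>z. \<integral>v. Re (stabF k j l z a b v) \<partial>lborel) has_real_derivative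
      (\<integral>v. Re (stabF (Suc k) j l z a b v) \<partial>lborel)) (at z)"
  proof (rule DERIV_integral_dominated[where r=1 and F'="\<lambda>z v. Re (stabF (Suc k) j l z a b v)"])
    show "\<bar>Re (stabF (Suc k) j l y a b x)\<bar> \<le> exp (\<bar>z\<bar> + 1) * C * (1 / (1 + x\<^sup>2))"
      if "\<bar>y - z\<bar> < 1" for y x
      by (rule C) (use that in auto)
  qed (use stabF_integrable[OF assms] Re_stabF_measurable[OF assms] stabF_deriv_z integrable_exp_bound
      in auto)
  then show ?thesis unfolding stabG_def by (rule DERIV_cdivide)
qed

lemma stabG_deriv_b:
  assumes "0 < a" "a < 2" "j + l < 2"
  shows "((\<lambda>b. stabG k j l z a b) has_real_derivative stabG k j (Suc l) z a b) (at b)"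
proof -
  obtain C where C: "\<And>z' a' b' v. \<bar>z'\<bar> \<le> \<bar>z\<bar> \<Longrightarrow> a' \<in> {a..a} \<Longrightarrow> b' \<in> {-(\<bar>b\<bar>+1)..\<bar>b\<bar>+1} \<Longrightarrow>
      \<bar>Re (stabF k j (Suc l) z' a' b' v)\<bar> \<le> exp \<bar>z\<bar> * C * (1 / (1 + v\<^sup>2))"
    using Re_stabF_bound[OF assms(1,2), where B="\<bar>b\<bar>+1" and k=k and j=j and l="Suc l" and Z="\<bar>z\<bar>"] by metis
  have "((\<lambda>b. \<integral>v. Re (stabF k j l z a b v) \<partial>lborel) has_real_derivative
      (\<integral>v. Re (stabF k j (Suc l) z a b v) \<partial>lborel)) (at b)"
  proof (rule DERIV_integral_dominated[where r=1 and F'="\<lambda>b v. Re (stabF k j (Suc l) z a b v)"])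
    show "\<bar>Re (stabF k j (Suc l) z a y x)\<bar> \<le> exp \<bar>z\<bar> * C * (1 / (1 + x\<^sup>2))"
      if "\<bar>y - b\<bar> < 1" for y x
      by (rule C) (use that in auto)
  qed (use stabF_integrable[OF assms(1,2)] Re_stabF_measurable[OF assms(1,2)] stabF_deriv_b[OF assms(3)]
      integrable_exp_bound in auto)
  then show ?thesis unfolding stabG_def by (rule DERIV_cdivide)
qed

lemma stabG_deriv_a:
  assumes "0 < a" "a < 2" "j + l < 2"
  shows "((\<lambda>a. stabG k j l z a b) has_real_derivative stabG k (Suc j) l z a b) (at a)"
proof -
  \<comment> \<open>Half the distance to the nearer endpoint keeps [a - r, a + r] inside (0, 2),
    where the bounds are uniform.\<close>
  define r where "r = min (a / 2) ((2 - a) / 2)"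
  have r: "r > 0" "0 < a - r" "a + r < 2" using assms by (auto simp: r_def min_def field_simps)
  obtain C where C: "\<And>z' a' b' v. \<bar>z'\<bar> \<le> \<bar>z\<bar> \<Longrightarrow> a' \<in> {a-r..a+r} \<Longrightarrow> b' \<in> {-\<bar>b\<bar>..\<bar>b\<bar>} \<Longrightarrow>
      \<bar>Re (stabF k (Suc j) l z' a' b' v)\<bar> \<le> exp \<bar>z\<bar> * C * (1 / (1 + v\<^sup>2))"
    using Re_stabF_bound[OF r(2,3), where B="\<bar>b\<bar>" and k=k and j="Suc j" and l=l and Z="\<bar>z\<bar>"] by metis
  have "((\<lambda>a. \<integral>v. Re (stabF k j l z a b v) \<partial>lborel) has_real_derivative
      (\<integral>v. Re (stabF k (Suc j) l z a b v) \<partial>lborel)) (at a)"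
  proof (rule DERIV_integral_dominated[where r=r and F'="\<lambda>a v. Re (stabF k (Suc j) l z a b v)"])
    fix y x assume y: "\<bar>y - a\<bar> < r"
    then have y': "0 < y" "y < 2" using r by linarith+
    show "\<bar>Re (stabF k (Suc j) l z y b x)\<bar> \<le> exp \<bar>z\<bar> * C * (1 / (1 + x\<^sup>2))"
      by (rule C) (use y in auto)
    show "((\<lambda>a. Re (stabF k j l z a b x)) has_real_derivative Re (stabF k (Suc j) l z y b x)) (at y)"
      by (rule stabF_deriv_a[OF assms(3) y'])
  next
    fix y assume "\<bar>y - a\<bar> < r"
    then have y': "0 < y" "y < 2" using r by linarith+
    show "integrable lborel (\<lambda>v. Re (stabF k j l z y b v))"
      using stabF_integrable[OF y'] by auto
  qed (use r Re_stabF_measurable[OF assms(1,2)] integrable_exp_bound in auto)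
  then show ?thesis unfolding stabG_def by (rule DERIV_cdivide)
qed

lemma continuous_on_stabG:
  "continuous_on (UNIV \<times> {0<..<2} \<times> UNIV) (\<lambda>(z, a, b). stabG k j l z a b)"
proof -
  have "continuous_on (UNIV \<times> {0<..<2} \<times> UNIV)
      (\<lambda>p. \<integral>v. Re (stabF k j l (fst p) (fst (snd p)) (snd (snd p)) v) \<partial>lborel)"
  proof (rule continuous_on_integral_dominated)
    fix p :: "real \<times> real \<times> real" assume "p \<in> UNIV \<times> {0<..<2} \<times> UNIV"
    then obtain z a b where p: "p = (z, a, b)" "0 < a" "a < 2" by auto
    show "(\<lambda>v. Re (stabF k j l (fst p) (fst (snd p)) (snd (snd p)) v)) \<in> borel_measurable lborel"
      using Re_stabF_measurable p by simp
    define r where "r = min (a / 2) ((2 - a) / 2)"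
    have r: "r > 0" "0 < a - r" "a + r < 2" using p by (auto simp: r_def min_def field_simps)
    obtain C where C: "\<And>z' a' b' v. \<bar>z'\<bar> \<le> \<bar>z\<bar>+1 \<Longrightarrow> a' \<in> {a-r..a+r} \<Longrightarrow> b' \<in> {-(\<bar>b\<bar>+1)..\<bar>b\<bar>+1} \<Longrightarrow>
      \<bar>Re (stabF k j l z' a' b' v)\<bar> \<le> exp (\<bar>z\<bar>+1) * C * (1 / (1 + v\<^sup>2))"
      using Re_stabF_bound[OF r(2,3), where B="\<bar>b\<bar>+1" and k=k and j=j and l=l and Z="\<bar>z\<bar>+1"] by metis
    let ?U = "{z-1<..<z+1} \<times> {a-r<..<a+r} \<times> {b-1<..<b+1}"
    show "\<exists>U w. open U \<and> p \<in> U \<and> integrable lborel w \<and>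
        (\<forall>q\<in>U \<inter> UNIV \<times> {0<..<2} \<times> UNIV. \<forall>v\<in>space lborel.
          norm (Re (stabF k j l (fst q) (fst (snd q)) (snd (snd q)) v)) \<le> w v)"
    proof (intro exI[of _ ?U] exI[of _ "\<lambda>v. exp (\<bar>z\<bar>+1) * C * (1 / (1 + v\<^sup>2))"] conjI ballI)
      fix q v assume q: "q \<in> ?U \<inter> UNIV \<times> {0<..<2} \<times> UNIV"
      show "norm (Re (stabF k j l (fst q) (fst (snd q)) (snd (snd q)) v))
          \<le> exp (\<bar>z\<bar>+1) * C * (1 / (1 + v\<^sup>2))"
        unfolding real_norm_def by (rule C) (use q in auto)
    qed (use p r integrable_exp_bound in \<open>auto intro!: open_Times\<close>)
  next
    fix v :: real
    show "continuous_on (UNIV \<times> {0<..<2} \<times> UNIV)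
       (\<lambda>p. Re (stabF k j l (fst p) (fst (snd p)) (snd (snd p)) v))"
    proof (cases "v > 0")
      case True
      then show ?thesis unfolding stabF_def
        using contour_notin_nonpos[OF True] stabT_dom_real by (auto intro!: continuous_intros)
    qed (simp add: stabF_nonpos)
  qed
  then show ?thesis
    unfolding stabG_def split_beta by (intro continuous_intros) auto
qed

section \<open>Tail asymptotics\<close>

lemma DERIV_Im_of_real:
  assumes "(f has_field_derivative f') (at (of_real x))"
  shows "((\<lambda>x. Im (f (complex_of_real x))) has_real_derivative Im f') (at x)"
  using bounded_linear.has_vector_derivative[OF bounded_linear_Im has_vector_derivative_real_field[OF assms]]
  by (simp add: has_real_derivative_iff_has_vector_derivative)

lemma Ln_neg_imag: "v > 0 \<Longrightarrow> Ln (Complex 0 (- v)) = Complex (ln v) (- pi / 2)"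
proof -
  assume v: "v > 0"
  have eq: "Complex 0 (- v) = of_real v * (- \<i>)" by (simp add: complex_eq_iff)
  have "Ln (Complex 0 (- v)) = ln v + Ln (- \<i>)"
    unfolding eq using v by (subst Ln_times_of_real) (auto simp: Ln_of_real)
  then show ?thesis by (simp add: complex_eq_iff)
qed

text \<open>At s = - i v the linear part of the skewness term (for a = 1 its part v ln v) is real.
  Only a multiple of v^a survives in the imaginary part, and this decides the order of the
  tail.\<close>

lemma Im_stabA_0:
  assumes "0 < a" "a < 2" "v > 0"
  shows "Im (stabA 0 (of_real a) (of_real b) (Complex 0 (- v))) = - (1 + b) * (sin (pi * a / 2) * v powr a)"
proof -
  have L: "exp (complex_of_real a * Ln (Complex 0 (- v))) =
      Complex (v powr a * cos (pi * a / 2)) (- (v powr a * sin (pi * a / 2)))"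
    unfolding Ln_neg_imag[OF assms(3)] using assms
    by (simp add: complex_eq_iff Re_exp Im_exp powr_def algebra_simps)
  show ?thesis
  proof (cases "a = 1")
    case True
    have "stabA 0 (of_real a) (of_real b) (Complex 0 (- v)) = Complex 0 (- v) +
      \<i> * b * (2 / pi * Complex 0 (- v) * Complex (ln v) (- pi / 2))"
    proof -
      have "stabeta 0 (of_real a) (Complex 0 (- v)) = of_real (2 / pi) * Complex 0 (- v) * Complex (ln v) (- pi / 2)"
        unfolding True of_real_1 stabeta_1 Ln_neg_imag[OF assms(3)] by simp
      then show ?thesis using L True assms by (simp add: stabA_def)
    qed
    then show ?thesis using True assms by (simp add: algebra_simps)
  next
    case False
    have "cos (pi * a / 2) \<noteq> 0"
    proof
      assume "cos (pi * a / 2) = 0"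
      moreover have "0 \<le> pi * a / 2" "pi * a / 2 \<le> pi" using assms by auto
      ultimately have "pi * a / 2 = pi / 2"
        using cos_inj_pi[of "pi * a / 2" "pi / 2"] by auto
      then show False using False by simp
    qed
    then have t: "tan (pi * a / 2) * cos (pi * a / 2) = sin (pi * a / 2)" by (simp add: tan_def)
    have "stabA 0 (of_real a) (of_real b) (Complex 0 (- v)) =
      Complex (v powr a * cos (pi * a / 2)) (- (v powr a * sin (pi * a / 2))) +
      \<i> * b * (tan (pi * a / 2) *
        (Complex 0 (- v) - Complex (v powr a * cos (pi * a / 2)) (- (v powr a * sin (pi * a / 2)))))"
      using L False assms by (simp add: stabA_def stabeta_tan complex_eq_iff)
    then have "Im (stabA 0 (of_real a) (of_real b) (Complex 0 (- v))) =
      - (v powr a * sin (pi * a / 2)) - b * v powr a * (tan (pi * a / 2) * cos (pi * a / 2))"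
      by simp
    then show ?thesis unfolding t by (simp add: algebra_simps)
  qed
qed

text \<open>Differentiates the closed form of \<open>Im_stabA_0\<close> in \<open>a\<close> instead
  of expanding \<open>stabA 1\<close>, which contains the derivative of \<open>stabT\<close>. Each
  derivative costs one factor ln v.\<close>

lemma Im_stabA_1:
  assumes "0 < a" "a < 2" "v > 0"
  shows "Im (stabA 1 (of_real a) (of_real b) (Complex 0 (- v))) =
    - (1 + b) * (pi / 2 * cos (pi * a / 2) * v powr a + sin (pi * a / 2) * v powr a * ln v)"
proof (rule DERIV_unique)
  show "((\<lambda>a. Im (stabA 0 (complex_of_real a) (of_real b) (Complex 0 (- v)))) has_real_derivative
      Im (stabA 1 (of_real a) (of_real b) (Complex 0 (- v)))) (at a)"
    using DERIV_Im_of_real[OF stabA_deriv_a[OF _ stabT_dom_real[OF assms(1,2)], of 0]] by simp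
  have "((\<lambda>a. - (1 + b) * (sin (pi * a / 2) * v powr a)) has_real_derivative
    - (1 + b) * (pi / 2 * cos (pi * a / 2) * v powr a + sin (pi * a / 2) * v powr a * ln v)) (at a)"
    using assms by (auto intro!: derivative_eq_intros simp: algebra_simps)
  then show "((\<lambda>a. Im (stabA 0 (complex_of_real a) (of_real b) (Complex 0 (- v)))) has_real_derivative
    - (1 + b) * (pi / 2 * cos (pi * a / 2) * v powr a + sin (pi * a / 2) * v powr a * ln v)) (at a)"
    by (rule has_field_derivative_transform_within_open[where S="{0<..<2}"])
      (use assms Im_stabA_0 in auto)
qed

lemma Im_stabA_2:
  assumes "0 < a" "a < 2" "v > 0"
  shows "Im (stabA 2 (of_real a) (of_real b) (Complex 0 (- v))) =
    - (1 + b) * (- (pi / 2)\<^sup>2 * sin (pi * a / 2) * v powr a + pi * cos (pi * a / 2) * v powr a * ln v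
      + sin (pi * a / 2) * v powr a * (ln v)\<^sup>2)"
proof (rule DERIV_unique)
  show "((\<lambda>a. Im (stabA 1 (complex_of_real a) (of_real b) (Complex 0 (- v)))) has_real_derivative
      Im (stabA 2 (of_real a) (of_real b) (Complex 0 (- v)))) (at a)"
    using DERIV_Im_of_real[OF stabA_deriv_a[OF _ stabT_dom_real[OF assms(1,2)], of 1]]
    by (simp add: numeral_2_eq_2)
  have "((\<lambda>a. - (1 + b) * (pi / 2 * cos (pi * a / 2) * v powr a + sin (pi * a / 2) * v powr a * ln v))
    has_real_derivative
    - (1 + b) * (- (pi / 2)\<^sup>2 * sin (pi * a / 2) * v powr a + pi * cos (pi * a / 2) * v powr a * ln v
      + sin (pi * a / 2) * v powr a * (ln v)\<^sup>2)) (at a)"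
    using assms by (auto intro!: derivative_eq_intros simp: field_simps power2_eq_square)
  then show "((\<lambda>a. Im (stabA 1 (complex_of_real a) (of_real b) (Complex 0 (- v)))) has_real_derivative
    - (1 + b) * (- (pi / 2)\<^sup>2 * sin (pi * a / 2) * v powr a + pi * cos (pi * a / 2) * v powr a * ln v
      + sin (pi * a / 2) * v powr a * (ln v)\<^sup>2)) (at a)"
    by (rule has_field_derivative_transform_within_open[where S="{0<..<2}"])
      (use assms Im_stabA_1 in auto)
qed

text \<open>On the segment from 0 to \<open>-\<i>\<close> only imaginary parts contribute to the density.\<close>
definition im_small :: "real \<Rightarrow> nat \<Rightarrow> (real \<Rightarrow> complex) \<Rightarrow> bool" where
  "im_small a j X \<longleftrightarrow> (\<exists>C\<ge>0. \<forall>v\<in>{0<..1}. norm (X v) \<le> C \<and>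
     \<bar>Im (X v)\<bar> \<le> C * (v powr a * (1 + \<bar>ln v\<bar>) ^ j))"

lemma im_smallI:
  assumes "\<And>v. 0 < v \<Longrightarrow> v \<le> 1 \<Longrightarrow> norm (X v) \<le> C"
    "\<And>v. 0 < v \<Longrightarrow> v \<le> 1 \<Longrightarrow> \<bar>Im (X v)\<bar> \<le> D * (v powr a * (1 + \<bar>ln v\<bar>) ^ j)"
  shows "im_small a j X"
  unfolding im_small_def
proof (intro exI[of _ "max 0 (max C D)"] conjI ballI)
  fix v :: real assume v: "v \<in> {0<..1}"
  show "norm (X v) \<le> max 0 (max C D)" using assms(1)[of v] v by auto
  have "\<bar>Im (X v)\<bar> \<le> D * (v powr a * (1 + \<bar>ln v\<bar>) ^ j)" using assms(2)[of v] v by auto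
  also have "\<dots> \<le> max 0 (max C D) * (v powr a * (1 + \<bar>ln v\<bar>) ^ j)"
    by (intro mult_right_mono) auto
  finally show "\<bar>Im (X v)\<bar> \<le> max 0 (max C D) * (v powr a * (1 + \<bar>ln v\<bar>) ^ j)" .
qed simp

text \<open>Im(X Y) = Re X Im Y + Im X Re Y: every summand keeps one small factor, and the other is
  bounded.\<close>

lemma im_small_mult:
  assumes "im_small a i X" "im_small a j Y"
  shows "im_small a (i + j) (\<lambda>v. X v * Y v)"
proof -
  from assms(1) obtain C where C: "C \<ge> 0" "\<And>v. v \<in> {0<..1} \<Longrightarrow> norm (X v) \<le> C"
     "\<And>v. v \<in> {0<..1} \<Longrightarrow> \<bar>Im (X v)\<bar> \<le> C * (v powr a * (1 + \<bar>ln v\<bar>) ^ i)"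
    unfolding im_small_def by blast
  from assms(2) obtain D where D: "D \<ge> 0" "\<And>v. v \<in> {0<..1} \<Longrightarrow> norm (Y v) \<le> D"
     "\<And>v. v \<in> {0<..1} \<Longrightarrow> \<bar>Im (Y v)\<bar> \<le> D * (v powr a * (1 + \<bar>ln v\<bar>) ^ j)"
    unfolding im_small_def by blast
  show ?thesis
  proof (rule im_smallI[where C="C * D" and D="2 * C * D"])
    fix v :: real assume v: "0 < v" "v \<le> 1"
    show "norm (X v * Y v) \<le> C * D"
      unfolding norm_mult using C D v by (intro mult_mono) auto
    have le: "(1 + \<bar>ln v\<bar>) ^ i \<le> (1 + \<bar>ln v\<bar>) ^ (i + j)" "(1 + \<bar>ln v\<bar>) ^ j \<le> (1 + \<bar>ln v\<bar>) ^ (i + j)"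
      by (auto intro!: power_increasing)
    have "\<bar>Im (X v)\<bar> \<le> C * (v powr a * (1 + \<bar>ln v\<bar>) ^ i)" using C v by auto
    also have "\<dots> \<le> C * (v powr a * (1 + \<bar>ln v\<bar>) ^ (i + j))"
      using C le by (intro mult_left_mono) auto
    finally have 1: "\<bar>Im (X v)\<bar> \<le> C * (v powr a * (1 + \<bar>ln v\<bar>) ^ (i + j))" .
    have "\<bar>Im (Y v)\<bar> \<le> D * (v powr a * (1 + \<bar>ln v\<bar>) ^ j)" using D v by auto
    also have "\<dots> \<le> D * (v powr a * (1 + \<bar>ln v\<bar>) ^ (i + j))"
      using D le by (intro mult_left_mono) auto
    finally have 2: "\<bar>Im (Y v)\<bar> \<le> D * (v powr a * (1 + \<bar>ln v\<bar>) ^ (i + j))" .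
    have "\<bar>Im (X v * Y v)\<bar> \<le> \<bar>Re (X v) * Im (Y v)\<bar> + \<bar>Im (X v) * Re (Y v)\<bar>"
      by (simp add: abs_triangle_ineq)
    also have "\<dots> \<le> C * (D * (v powr a * (1 + \<bar>ln v\<bar>) ^ (i + j)))
        + (C * (v powr a * (1 + \<bar>ln v\<bar>) ^ (i + j))) * D"
      unfolding abs_mult
    proof (intro add_mono mult_mono 1 2)
      show "\<bar>Re (X v)\<bar> \<le> C" using abs_Re_le_cmod[of "X v"] C(2)[of v] v by simp
      show "\<bar>Re (Y v)\<bar> \<le> D" using abs_Re_le_cmod[of "Y v"] D(2)[of v] v by simp
    qed (use C D in auto)
    also have "\<dots> = 2 * C * D * (v powr a * (1 + \<bar>ln v\<bar>) ^ (i + j))" by simp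
    finally show "\<bar>Im (X v * Y v)\<bar> \<le> 2 * C * D * (v powr a * (1 + \<bar>ln v\<bar>) ^ (i + j))" .
  qed
qed

lemma im_small_uminus: "im_small a j X \<Longrightarrow> im_small a j (\<lambda>v. - X v)"
  by (simp add: im_small_def)

lemma im_small_diff:
  assumes "im_small a j X" "im_small a j Y"
  shows "im_small a j (\<lambda>v. X v - Y v)"
proof -
  from assms(1) obtain C where C: "C \<ge> 0" "\<And>v. v \<in> {0<..1} \<Longrightarrow> norm (X v) \<le> C"
     "\<And>v. v \<in> {0<..1} \<Longrightarrow> \<bar>Im (X v)\<bar> \<le> C * (v powr a * (1 + \<bar>ln v\<bar>) ^ j)"
    unfolding im_small_def by blast
  from assms(2) obtain D where D: "D \<ge> 0" "\<And>v. v \<in> {0<..1} \<Longrightarrow> norm (Y v) \<le> D"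
     "\<And>v. v \<in> {0<..1} \<Longrightarrow> \<bar>Im (Y v)\<bar> \<le> D * (v powr a * (1 + \<bar>ln v\<bar>) ^ j)"
    unfolding im_small_def by blast
  show ?thesis
  proof (rule im_smallI[where C="C + D" and D="C + D"])
    fix v :: real assume v: "0 < v" "v \<le> 1"
    show "norm (X v - Y v) \<le> C + D"
      using C(2)[of v] D(2)[of v] v norm_triangle_ineq4[of "X v" "Y v"] by auto
    have "\<bar>Im (X v - Y v)\<bar> \<le> \<bar>Im (X v)\<bar> + \<bar>Im (Y v)\<bar>" by (simp add: abs_triangle_ineq4)
    also have "\<dots> \<le> C * (v powr a * (1 + \<bar>ln v\<bar>) ^ j) + D * (v powr a * (1 + \<bar>ln v\<bar>) ^ j)"
      using C(3)[of v] D(3)[of v] v by (intro add_mono) auto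
    finally show "\<bar>Im (X v - Y v)\<bar> \<le> (C + D) * (v powr a * (1 + \<bar>ln v\<bar>) ^ j)"
      by (simp only: distrib_right)
  qed
qed

lemma im_small_1: "im_small a 0 (\<lambda>v. 1)"
  by (rule im_smallI[where C=1 and D=0]) auto

lemma im_small_0: "im_small a j (\<lambda>v. 0)"
  by (rule im_smallI[where C=1 and D=0]) auto

lemma im_small_exp:
  assumes "im_small a 0 X"
  shows "im_small a 0 (\<lambda>v. exp (X v))"
proof -
  from assms obtain C where C: "C \<ge> 0" "\<And>v. v \<in> {0<..1} \<Longrightarrow> norm (X v) \<le> C"
     "\<And>v. v \<in> {0<..1} \<Longrightarrow> \<bar>Im (X v)\<bar> \<le> C * (v powr a)"
    unfolding im_small_def by auto
  show ?thesis
  proof (rule im_smallI[where C="exp C" and D="exp C * C"])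
    fix v :: real assume v: "0 < v" "v \<le> 1"
    have "Re (X v) \<le> C" using complex_Re_le_cmod[of "X v"] C(2)[of v] v by simp
    then show 1: "norm (exp (X v)) \<le> exp C" by simp
    have "\<bar>Im (exp (X v))\<bar> = exp (Re (X v)) * \<bar>sin (Im (X v))\<bar>" by (simp add: Im_exp abs_mult)
    also have "\<dots> \<le> exp C * \<bar>Im (X v)\<bar>"
      using 1 abs_sin_x_le_abs_x by (intro mult_mono) auto
    also have "\<dots> \<le> exp C * (C * v powr a)" using C(3)[of v] v by (intro mult_left_mono) auto
    finally show "\<bar>Im (exp (X v))\<bar> \<le> exp C * C * (v powr a * (1 + \<bar>ln v\<bar>) ^ 0)" by simp
  qed
qed

lemma im_small_stabA:
  assumes "0 < a" "a < 2" "j \<le> 2"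
  shows "im_small a j (\<lambda>v. stabA j (of_real a) (of_real b) (Complex 0 (- v)))"
proof -
  obtain C N where C: "C \<ge> 0" "\<And>a' b' s. a' \<in> {a..a} \<Longrightarrow> b' \<in> {-\<bar>b\<bar>..\<bar>b\<bar>} \<Longrightarrow> s \<noteq> 0 \<Longrightarrow>
     norm (stabA j (complex_of_real a') (complex_of_real b') s) \<le> C * (1 + norm s) ^ N"
    using poly_bdd_stabA[OF assms(1,2), of "\<bar>b\<bar>" j] by (rule poly_bddE) blast
  show ?thesis
  proof (rule im_smallI[where C="C * 2 ^ N" and D="\<bar>1 + b\<bar> * 16"])
    fix v :: real assume v: "0 < v" "v \<le> 1"
    have "norm (Complex 0 (- v)) = v" using v by (simp add: cmod_def)
    then have "norm (stabA j (of_real a) (of_real b) (Complex 0 (- v))) \<le> C * (1 + v) ^ N"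
      using C(2)[of a b "Complex 0 (- v)"] v abs_ge_self[of b] abs_ge_minus_self[of b]
      by (auto simp: complex_eq_iff minus_le_iff)
    also have "\<dots> \<le> C * 2 ^ N" using C(1) v by (intro mult_left_mono power_mono) auto
    finally show "norm (stabA j (of_real a) (of_real b) (Complex 0 (- v))) \<le> C * 2 ^ N" .
    define l where "l = \<bar>ln v\<bar>"
    have l: "l \<ge> 0" "\<bar>ln v\<bar> = l" "(ln v)\<^sup>2 = l\<^sup>2" by (auto simp: l_def)
    have sc: "\<bar>sin (pi * a / 2)\<bar> \<le> 1" "\<bar>cos (pi * a / 2)\<bar> \<le> 1" by auto
    have p: "pi \<le> 4" using pi_less_4 by simp
    consider "j = 0" | "j = 1" | "j = 2" using assms by linarith
    then show "\<bar>Im (stabA j (of_real a) (of_real b) (Complex 0 (- v)))\<bar> \<le>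
        \<bar>1 + b\<bar> * 16 * (v powr a * (1 + \<bar>ln v\<bar>) ^ j)"
    proof cases
      case 1
      have "\<bar>sin (pi * a / 2) * v powr a\<bar> \<le> 1 * v powr a"
        unfolding abs_mult using sc by (intro mult_mono) auto
      then have "\<bar>- (1 + b)\<bar> * \<bar>sin (pi * a / 2) * v powr a\<bar> \<le> \<bar>1 + b\<bar> * (16 * v powr a)"
        by (intro mult_mono) auto
      then show ?thesis using 1 Im_stabA_0[OF assms(1,2) v(1), of b] by (simp add: abs_mult)
    next
      case 2
      have "\<bar>pi / 2 * cos (pi * a / 2) * v powr a + sin (pi * a / 2) * v powr a * ln v\<bar>
         \<le> \<bar>pi / 2 * cos (pi * a / 2) * v powr a\<bar> + \<bar>sin (pi * a / 2) * v powr a * ln v\<bar>"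
        by (rule abs_triangle_ineq)
      also have "\<dots> \<le> 2 * 1 * v powr a + 1 * v powr a * l"
        unfolding abs_mult l using sc p l by (intro add_mono mult_mono) auto
      also have "\<dots> \<le> 16 * (v powr a * (1 + l))" using l by (simp add: algebra_simps)
      finally have "\<bar>- (1 + b)\<bar> * \<bar>pi / 2 * cos (pi * a / 2) * v powr a + sin (pi * a / 2) * v powr a * ln v\<bar>
         \<le> \<bar>1 + b\<bar> * (16 * (v powr a * (1 + l)))"
        by (intro mult_mono) auto
      then show ?thesis unfolding 2 Im_stabA_1[OF assms(1,2) v(1), of b]
        by (simp add: abs_mult l mult.assoc)
    next
      case 3
      have pp: "pi * pi \<le> 16" using mult_mono[OF p p] by simp
      have "\<bar>- (pi / 2)\<^sup>2 * sin (pi * a / 2) * v powr a + pi * cos (pi * a / 2) * v powr a * ln v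
      + sin (pi * a / 2) * v powr a * (ln v)\<^sup>2\<bar>
         \<le> \<bar>- (pi / 2)\<^sup>2 * sin (pi * a / 2) * v powr a\<bar> + \<bar>pi * cos (pi * a / 2) * v powr a * ln v\<bar>
           + \<bar>sin (pi * a / 2) * v powr a * (ln v)\<^sup>2\<bar>"
        by linarith
      also have "\<dots> \<le> 2\<^sup>2 * 1 * v powr a + 4 * 1 * v powr a * l + 1 * v powr a * l\<^sup>2"
        unfolding abs_mult abs_minus l abs_power2 abs_divide power2_abs using sc p pp l
        by (intro add_mono mult_mono) (auto simp: power2_eq_square intro!: mult_mono)
      also have "\<dots> \<le> 16 * (v powr a * (1 + l)\<^sup>2)" using l by (simp add: algebra_simps power2_eq_square)
      finally have "\<bar>- (1 + b)\<bar> * \<bar>- (pi / 2)\<^sup>2 * sin (pi * a / 2) * v powr a + pi * cos (pi * a / 2) * v powr a * ln v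
      + sin (pi * a / 2) * v powr a * (ln v)\<^sup>2\<bar>
         \<le> \<bar>1 + b\<bar> * (16 * (v powr a * (1 + l)\<^sup>2))"
        by (intro mult_mono) auto
      then show ?thesis unfolding 3 Im_stabA_2[OF assms(1,2) v(1), of b]
        by (simp add: abs_mult l mult.assoc)
    qed
  qed
qed

lemma im_small_stabeta:
  assumes "0 < a" "a < 2" "j \<le> 2"
  shows "im_small a j (\<lambda>v. \<i> * stabeta j (of_real a) (Complex 0 (- v)))"
proof -
  \<comment> \<open>\<open>\<i> * stabeta j\<close> is the coefficient of \<open>b\<close> in
    \<open>stabA j\<close>, hence the difference of the values at b = 1 and b = 0.\<close>
  have "im_small a j (\<lambda>v. stabA j (of_real a) (of_real 1) (Complex 0 (- v)) -
      stabA j (of_real a) (of_real 0) (Complex 0 (- v)))"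
    by (intro im_small_diff im_small_stabA assms)
  then show ?thesis by (simp add: stabA_def)
qed

text \<open>Only derivatives in \<alpha> bring logarithms: in every summand of
  \<open>jetP j l\<close> the logarithmic orders of the factors add up to \<open>j\<close>, and the
  exponential has order 0.\<close>

lemma im_small_jetD:
  assumes "0 < a" "a < 2"
  shows "im_small a j (\<lambda>v. jetD j l (of_real a) (of_real b) (Complex 0 (- v)))"
proof -
  note A = im_small_stabA[OF assms, of _ b] and E = im_small_stabeta[OF assms]
  have A11: "im_small a 2 (\<lambda>v. (stabA 1 (of_real a) (of_real b) (Complex 0 (- v)))\<^sup>2)"
    using im_small_mult[OF A A, of 1 1] by (simp add: power2_eq_square numeral_2_eq_2)
  have E00: "im_small a 0 (\<lambda>v. (\<i> * stabeta 0 (of_real a) (Complex 0 (- v)))\<^sup>2)"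
    using im_small_mult[OF E E, of 0 0] by (simp add: power2_eq_square)
  have EA: "im_small a 1 (\<lambda>v. \<i> * stabeta 0 (of_real a) (Complex 0 (- v)) *
      stabA 1 (of_real a) (of_real b) (Complex 0 (- v)))"
    using im_small_mult[OF E A, of 0 1] by simp
  have P: "im_small a j (\<lambda>v. jetP j l (of_real a) (of_real b) (Complex 0 (- v)))"
  proof (cases "(j, l, 0::complex, 0::complex, 0::complex)" rule: jetP.cases)
    case 4
    then show ?thesis using im_small_diff[OF A11 A[of 2]] by (simp add: numeral_2_eq_2)
  next
    case 5
    then show ?thesis using im_small_diff[OF EA E[of 1]] by simp
  qed (use A[of 1] E[of 0] E00 in \<open>auto intro!: im_small_1 im_small_0 im_small_uminus\<close>)
  have "im_small a (j + 0) (\<lambda>v. jetP j l (of_real a) (of_real b) (Complex 0 (- v)) *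
      exp (- stabA 0 (of_real a) (of_real b) (Complex 0 (- v))))"
    by (intro im_small_mult P im_small_exp im_small_uminus A) simp
  then show ?thesis by (simp add: jetD_def)
qed

text \<open>On the segment - i s = - v is real and \<open>contour_deriv\<close> is - i. Since Re(- i
  X) = Im X, only the imaginary part of the jet is seen.\<close>

lemma stabF_segment:
  assumes "0 < v" "v \<le> 1"
  shows "Re (stabF k j l z a b v) =
    (- v) ^ k * exp (- (v * z)) * Im (jetD j l (of_real a) (of_real b) (Complex 0 (- v)))"
proof -
  have g: "contour v = Complex 0 (- v)" "contour_deriv v = - \<i>" using assms by (auto simp: contour_def contour_deriv_def)
  have "- \<i> * Complex 0 (- v) = of_real (- v)" by (simp add: complex_eq_iff)
  then have "stabF k j l z a b v = of_real ((- v) ^ k * exp (- (v * z))) *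
      (- \<i> * jetD j l (of_real a) (of_real b) (Complex 0 (- v)))"
    unfolding stabF_def g by (simp flip: exp_of_real)
  then show ?thesis by simp
qed

lemma stabF_ray_bound:
  assumes "0 < a" "a < 2"
  obtains C where "C \<ge> 0"
    "\<And>z v. v > 1 \<Longrightarrow> \<bar>Re (stabF k j l z a b v)\<bar> \<le> exp (- z) * C * (1 / (1 + v\<^sup>2))"
proof -
  obtain C where C: "C \<ge> 0" "\<And>a' b' s. a' \<in> {a..a} \<Longrightarrow> b' \<in> {-\<bar>b\<bar>..\<bar>b\<bar>} \<Longrightarrow> s \<in> strip \<Longrightarrow>
      norm (s ^ k * jetD j l (complex_of_real a') (complex_of_real b') s) \<le> C / (1 + (1 + Re s)\<^sup>2)"
    using jetD_strip_bound[OF assms, where B="\<bar>b\<bar>" and k=k and j=j and l=l] by metis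
  show ?thesis
  proof (rule that[OF C(1)])
    fix z v :: real assume v: "v > 1"
    have "\<bar>Re (stabF k j l z a b v)\<bar> \<le> norm (stabF k j l z a b v)" by (rule abs_Re_le_cmod)
    also have "\<dots> = norm (contour_deriv v) * norm (exp (- \<i> * contour v * of_real z)) *
          norm (contour v ^ k * jetD j l (of_real a) (of_real b) (contour v))"
      by (simp add: stabF_def norm_mult norm_power)
    also have "\<dots> \<le> 1 * exp (- z) * (C / (1 + (1 + Re (contour v))\<^sup>2))"
      using v norm_contour_deriv_le norm_exp_contour[of v z] C(2)[of a b "contour v"] contour_strip[of v]
        abs_ge_self[of b] abs_ge_minus_self[of b]
      by (intro mult_mono) (auto simp: minus_le_iff)
    also have "1 + Re (contour v) = v" using v by (simp add: contour_def)
    finally show "\<bar>Re (stabF k j l z a b v)\<bar> \<le> exp (- z) * C * (1 / (1 + v\<^sup>2))" by simp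
  qed
qed

lemma power_le_fact_exp: "u \<ge> 0 \<Longrightarrow> u ^ n \<le> fact n * exp (u::real)"
proof -
  assume u: "u \<ge> 0"
  have "u ^ n / fact n \<le> (\<Sum>k. u ^ k / fact k)"
    using sum_le_suminf[of "\<lambda>k. u ^ k / fact k" "{n}"] u summable_exp[of u]
    by (auto simp: divide_inverse mult.commute)
  also have "\<dots> = exp u" by (simp add: exp_def divide_inverse mult.commute scaleR_conv_of_real)
  finally show ?thesis by (simp add: field_simps)
qed

text \<open>The majorant after the substitution u = z v. The kernel 1 / (1 + u^2) is chosen because
  its integral stays explicit after rescaling (\<open>integrable_scaled_kernel\<close>).\<close>

lemma powr_log_exp_bound:
  fixes a :: real
  assumes "0 < a" "a < 2"
  obtains C where "C \<ge> 0"
    "\<And>u. u > 0 \<Longrightarrow> u ^ k * (u powr a * (1 + \<bar>ln u\<bar>) ^ j) * exp (- u) \<le> C / (1 + u\<^sup>2)"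
proof -
  define K where "K = (real (Suc j) / a + pi) ^ j + 4 ^ j"
  \<comment> \<open>\<open>k\<close> powers from u^k, 2 + j from \<open>powr_log_le\<close>, and 2
    for the kernel; all are dominated by a multiple of exp(1 + u), which leaves the factor exp
    1.\<close>
  define n where "n = k + (2 + j) + 2"
  have K: "K \<ge> 0" using assms by (simp add: K_def)
  show ?thesis
  proof (rule that[of "K * (fact n * exp 1)"])
    show "K * (fact n * exp 1) \<ge> 0" using K by simp
    fix u :: real assume u: "u > 0"
    have "u powr a * (1 + \<bar>ln u\<bar>) ^ j \<le> u powr a * (\<bar>ln u\<bar> + pi) ^ j"
      using pi_gt3 by (intro mult_left_mono power_mono) auto
    also have "\<dots> \<le> K * (1 + u) ^ (2 + j)"
      unfolding K_def using assms u by (intro powr_log_le) auto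
    finally have X: "u powr a * (1 + \<bar>ln u\<bar>) ^ j \<le> K * (1 + u) ^ (2 + j)" .
    have "u ^ k \<le> (1 + u) ^ k" using u by (intro power_mono) auto
    from mult_mono[OF this X] have
      "u ^ k * (u powr a * (1 + \<bar>ln u\<bar>) ^ j) \<le> (1 + u) ^ k * (K * (1 + u) ^ (2 + j))"
      using u by simp
    from mult_right_mono[OF this, of "exp (- u)"] have
      "u ^ k * (u powr a * (1 + \<bar>ln u\<bar>) ^ j) * exp (- u) \<le>
        (1 + u) ^ k * (K * (1 + u) ^ (2 + j)) * exp (- u)" by simp
    moreover have "1 + u\<^sup>2 \<le> (1 + u)\<^sup>2" using u by (simp add: power2_eq_square algebra_simps)
    ultimately have "u ^ k * (u powr a * (1 + \<bar>ln u\<bar>) ^ j) * exp (- u) * (1 + u\<^sup>2) \<le>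
        (1 + u) ^ k * (K * (1 + u) ^ (2 + j)) * exp (- u) * (1 + u)\<^sup>2"
      by (rule mult_mono) (use u K in auto)
    also have "\<dots> = K * ((1 + u) ^ n * exp (- u))"
      by (simp only: n_def power_add mult_ac)
    also have "\<dots> \<le> K * (fact n * exp (1 + u) * exp (- u))"
      using u K power_le_fact_exp[of "1 + u" n] by (intro mult_left_mono mult_right_mono) auto
    also have "\<dots> = K * (fact n * exp 1)" by (simp add: exp_add exp_minus)
    finally show "u ^ k * (u powr a * (1 + \<bar>ln u\<bar>) ^ j) * exp (- u) \<le> K * (fact n * exp 1) / (1 + u\<^sup>2)"
      using u by (simp add: field_simps add_pos_nonneg)
  qed
qed

lemma integrable_scaled_kernel:
  assumes "z > 0"
  shows "integrable lborel (\<lambda>v. 1 / (1 + (z * v)\<^sup>2) :: real)"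
    "(\<integral>v. 1 / (1 + (z * v)\<^sup>2) \<partial>lborel) = pi / z"
proof -
  show "integrable lborel (\<lambda>v. 1 / (1 + (z * v)\<^sup>2) :: real)"
    using lborel_integrable_real_affine[OF integrable_inverse_1_plus_square_lborel, of z 0] assms by simp
  show "(\<integral>v. 1 / (1 + (z * v)\<^sup>2) \<partial>lborel) = pi / z"
    using lborel_integral_real_affine[of z "\<lambda>x. 1 / (1 + x\<^sup>2) :: real" 0] assms
      integral_inverse_1_plus_square_lborel by (simp add: field_simps)
qed

text \<open>A Laplace integral over the segment: with u = z v, the factor v^(a + k) gives z^(- a -
  k) and dv one further 1 / z, while each logarithm of v costs at most 1 + ln z. The substitution is
  made pointwise in the majorant.\<close>

lemma stabG_tail_upper:
  assumes "0 < a" "a < 2"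
  obtains C where "C \<ge> 0"
    "\<And>z. z \<ge> 1 \<Longrightarrow> \<bar>stabG k j l z a b\<bar> \<le> C * (z powr (- (a + 1)) / z ^ k * (1 + ln z) ^ j)"
proof -
  obtain C1 where C1: "C1 \<ge> 0"
    "\<And>z v. v > 1 \<Longrightarrow> \<bar>Re (stabF k j l z a b v)\<bar> \<le> exp (- z) * C1 * (1 / (1 + v\<^sup>2))"
    using stabF_ray_bound[OF assms, of k j l b] by metis
  obtain C2 where C2: "C2 \<ge> 0" "\<And>v. v \<in> {0<..1} \<Longrightarrow>
      \<bar>Im (jetD j l (of_real a) (of_real b) (Complex 0 (- v)))\<bar> \<le> C2 * (v powr a * (1 + \<bar>ln v\<bar>) ^ j)"
    using im_small_jetD[OF assms, of j l b] unfolding im_small_def by blast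
  obtain C3 where C3: "C3 \<ge> 0"
    "\<And>u. u > 0 \<Longrightarrow> u ^ k * (u powr a * (1 + \<bar>ln u\<bar>) ^ j) * exp (- u) \<le> C3 / (1 + u\<^sup>2)"
    using powr_log_exp_bound[OF assms, of k j] by metis
  \<comment> \<open>The factorial turns the ray into a power: exp(- z) <= (k + 3)! / z^(k + 3), and
    z^(- k - 3) <= z^(- a - 1 - k) because a < 2.\<close>
  define C where "C = C2 * C3 + fact (k + 3) * C1"
  show ?thesis
  proof (rule that[of C])
    show "C \<ge> 0" using C1 C2 C3 by (simp add: C_def)
    fix z :: real assume z: "z \<ge> 1"
    define m where "m = (1 + ln z) ^ j"
    define w where "w = z powr (- a) / z ^ k"
    have m: "m \<ge> 1" using z by (simp add: m_def)
    have w: "w \<ge> 0" using z by (simp add: w_def)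
    define bd where "bd = (\<lambda>v. w * m * C2 * C3 * (1 / (1 + (z * v)\<^sup>2)) + exp (- z) * C1 * (1 / (1 + v\<^sup>2)))"
    have "\<bar>Re (stabF k j l z a b v)\<bar> \<le> bd v" for v
    proof -
      have nn: "w * m * C2 * C3 * (1 / (1 + (z * v)\<^sup>2)) \<ge> 0" "exp (- z) * C1 * (1 / (1 + v\<^sup>2)) \<ge> 0"
        using w m C1 C2 C3 by auto
      consider "v \<le> 0" | "0 < v" "v \<le> 1" | "v > 1" by linarith
      then show ?thesis
      proof cases
        case 1
        then show ?thesis using nn by (simp add: stabF_nonpos bd_def)
      next
        case 3
        then show ?thesis using nn C1(2)[of v z] by (simp add: bd_def)
      next
        case 2
        define u where "u = z * v"
        have u: "u > 0" using 2 z by (simp add: u_def)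
        have v: "v = u / z" using z by (simp add: u_def)
        \<comment> \<open>Separates z from u: ln v = ln u - ln z, and the sum of the two logarithms
          is majorized by a product.\<close>
        have "1 + \<bar>ln v\<bar> \<le> (1 + ln z) * (1 + \<bar>ln u\<bar>)"
        proof -
          have "ln v = ln u - ln z" using u z by (simp add: v ln_div)
          then have "\<bar>ln v\<bar> \<le> \<bar>ln u\<bar> + ln z" using ln_ge_zero[OF z] by linarith
          also have "1 + \<dots> \<le> (1 + ln z) * (1 + \<bar>ln u\<bar>)" using z by (simp add: algebra_simps)
          finally show ?thesis by simp
        qed
        then have l: "(1 + \<bar>ln v\<bar>) ^ j \<le> m * (1 + \<bar>ln u\<bar>) ^ j"
          unfolding m_def power_mult_distrib[symmetric] by (intro power_mono) auto
        have "\<bar>Re (stabF k j l z a b v)\<bar> = v ^ k * exp (- u) *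
            \<bar>Im (jetD j l (of_real a) (of_real b) (Complex 0 (- v)))\<bar>"
          unfolding stabF_segment[OF 2] using 2 by (simp add: abs_mult power_abs u_def mult.commute)
        also have "\<dots> \<le> v ^ k * exp (- u) * (C2 * (v powr a * (m * (1 + \<bar>ln u\<bar>) ^ j)))"
        proof (intro mult_left_mono)
          have "\<bar>Im (jetD j l (of_real a) (of_real b) (Complex 0 (- v)))\<bar> \<le> C2 * (v powr a * (1 + \<bar>ln v\<bar>) ^ j)"
            using C2 2 by auto
          also have "\<dots> \<le> C2 * (v powr a * (m * (1 + \<bar>ln u\<bar>) ^ j))"
            using C2(1) l by (intro mult_left_mono) auto
          finally show "\<bar>Im (jetD j l (of_real a) (of_real b) (Complex 0 (- v)))\<bar>
            \<le> C2 * (v powr a * (m * (1 + \<bar>ln u\<bar>) ^ j))" .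
        qed (use 2 in auto)
        also have "\<dots> = w * m * C2 * (u ^ k * (u powr a * (1 + \<bar>ln u\<bar>) ^ j) * exp (- u))"
          using u z by (simp add: v w_def power_divide powr_divide powr_minus field_simps)
        also have "\<dots> \<le> w * m * C2 * (C3 / (1 + u\<^sup>2))"
          using C3(2)[OF u] w m C2(1) by (intro mult_left_mono) auto
        also have "\<dots> \<le> bd v" using nn by (simp add: bd_def u_def)
        finally show ?thesis .
      qed
    qed
    moreover have bdi: "integrable lborel bd"
      unfolding bd_def using z
      by (intro Bochner_Integration.integrable_add integrable_mult_right
          integrable_scaled_kernel integrable_inverse_1_plus_square_lborel) auto
    moreover have "integrable lborel (\<lambda>v. Re (stabF k j l z a b v))"
      using stabF_integrable[OF assms] by auto
    ultimately have "\<bar>\<integral>v. Re (stabF k j l z a b v) \<partial>lborel\<bar> \<le> (\<integral>v. bd v \<partial>lborel)"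
      by (intro order_trans[OF integral_abs_bound] integral_mono) auto
    also have "(\<integral>v. bd v \<partial>lborel) = w * m * C2 * C3 * (pi / z) + exp (- z) * C1 * pi"
    proof -
      have z0: "z > 0" using z by simp
      show ?thesis
        unfolding bd_def
        by (simp only: Bochner_Integration.integral_add[OF integrable_mult_right[OF integrable_scaled_kernel(1)[OF z0]]
              integrable_mult_right[OF integrable_inverse_1_plus_square_lborel]]
            integral_mult_right_zero integrable_scaled_kernel(2)[OF z0] integral_inverse_1_plus_square_lborel)
    qed
    also have "\<dots> \<le> pi * (C * (w / z * m))"
    proof -
      have "exp (- z) \<le> fact (k + 3) * (w / z * m)"
      proof -
        have "z ^ (k + 3) * exp (- z) \<le> fact (k + 3) * exp z * exp (- z)"
          using power_le_fact_exp[of z "k + 3"] z by (intro mult_right_mono) auto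
        also have "\<dots> = fact (k + 3)" by (simp add: exp_minus)
        finally have "exp (- z) \<le> fact (k + 3) * (1 / z ^ (k + 3))" using z by (simp add: field_simps)
        also have "1 / z ^ (k + 3) = z powr (- 2) / z ^ k / z"
          using z by (simp add: powr_minus power_add numeral_3_eq_3 field_simps power2_eq_square)
        also have "\<dots> \<le> w / z"
          unfolding w_def using z assms by (intro divide_right_mono powr_mono) auto
        also have "\<dots> \<le> w / z * m" using m w z mult_left_mono[of 1 m "w / z"] by simp
        finally show ?thesis by simp
      qed
      then have "exp (- z) * C1 * pi \<le> (fact (k + 3) * (w / z * m)) * C1 * pi"
        using C1 by (intro mult_right_mono) auto
      then show ?thesis by (simp add: C_def algebra_simps)
    qed
    finally have "\<bar>stabG k j l z a b\<bar> \<le> C * (w / z * m)"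
      by (simp add: stabG_def field_simps)
    also have "w / z = z powr (- (a + 1)) / z ^ k"
      using z by (simp add: w_def powr_diff field_simps powr_minus powr_add)
    finally show "\<bar>stabG k j l z a b\<bar> \<le> C * (z powr (- (a + 1)) / z ^ k * (1 + ln z) ^ j)"
      by (simp add: m_def)
  qed
qed

lemma sin_ge_mult_cos_1: "0 \<le> w \<Longrightarrow> w \<le> 1 \<Longrightarrow> w * cos 1 \<le> sin (w::real)"
proof (cases "w = 0")
  case False
  assume w: "0 \<le> w" "w \<le> 1"
  then have "0 < w" using False by simp
  then obtain x where x: "0 < x" "x < w" "sin w - sin 0 = (w - 0) * cos x"
    using MVT2[of 0 w sin cos] by auto
  have "cos 1 \<le> cos x" using x w pi_gt3 by (intro cos_monotone_0_pi_le) auto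
  then show ?thesis using x w by (simp add: mult_left_mono)
qed simp

text \<open>On the segment the integrand is exp(- v z) exp(- \<rho> v) sin(\<kappa> v^a) with
  \<kappa> v^a <= 2 < pi, hence nonnegative. The part 1 / (2 z) <= v <= 1 / z already contributes
  z^(- a) times its length 1 / (2 z), and the ray can subtract only O(exp(- z)). Here 1 + b > 0 is
  what makes \<kappa> positive.\<close>

lemma stabG_tail_lower:
  assumes a: "0 < a" "a < 2" and b: "\<bar>b\<bar> < 1"
  obtains c z0 where "c > 0" "z0 \<ge> 1" "\<And>z. z \<ge> z0 \<Longrightarrow> stabG 0 0 0 z a b \<ge> c * z powr (- (a + 1))"
proof -
  obtain C1 where C1: "C1 \<ge> 0"
    "\<And>z v. v > 1 \<Longrightarrow> \<bar>Re (stabF 0 0 0 z a b v)\<bar> \<le> exp (- z) * C1 * (1 / (1 + v\<^sup>2))"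
    using stabF_ray_bound[OF a, of 0 0 0 b] by metis
  obtain R where R: "R \<ge> 0" "\<And>v. v \<in> {0<..1} \<Longrightarrow>
      norm (stabA 0 (of_real a) (of_real b) (Complex 0 (- v))) \<le> R"
    using im_small_stabA[OF a, of 0 b] unfolding im_small_def by auto
  define \<kappa> where "\<kappa> = (1 + b) * sin (pi * a / 2)"
  have "sin (pi * a / 2) > 0" using a by (intro sin_gt_zero) auto
  then have kpos: "\<kappa> > 0" using b by (simp add: \<kappa>_def)
  have "\<kappa> \<le> 2 * 1"
    unfolding \<kappa>_def using b \<open>sin (pi * a / 2) > 0\<close> by (intro mult_mono) auto
  then have k2: "\<kappa> \<le> 2" by simp
  define \<rho> where "\<rho> = (\<lambda>v. Re (stabA 0 (of_real a) (of_real b) (Complex 0 (- v))))"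
  have seg: "Re (stabF 0 0 0 z a b v) = exp (- (v * z)) * (exp (- \<rho> v) * sin (\<kappa> * v powr a))"
    if "0 < v" "v \<le> 1" for z v
  proof -
    have "Im (exp (- stabA 0 (of_real a) (of_real b) (Complex 0 (- v)))) =
        exp (- \<rho> v) * sin (- (Im (stabA 0 (of_real a) (of_real b) (Complex 0 (- v)))))"
      by (simp add: Im_exp \<rho>_def)
    also have "- (Im (stabA 0 (of_real a) (of_real b) (Complex 0 (- v)))) = \<kappa> * v powr a"
      unfolding Im_stabA_0[OF a that(1)] by (simp add: \<kappa>_def algebra_simps)
    finally show ?thesis unfolding stabF_segment[OF that] by (simp add: jetD_def)
  qed
  \<comment> \<open>The factors bound from below, in this order, exp(- v z), exp(- \<rho> v), the
    slope of the sine on [0, 1], and z^a \<kappa> v^a. The final 1 / 2 cancels the 2 in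
    \<open>q\<close>, so that the length 1 / (2 z) of \<open>I\<close> yields c z^(- a - 1); the ray
    may consume half of that.\<close>
  define c where "c = exp (- 1) * exp (- R) * cos 1 * \<kappa> * (1 / 2) powr a / 2"
  have c: "c > 0" unfolding c_def using kpos cos_gt_zero_pi[of 1] pi_gt3 by simp
  have "((\<lambda>z. exp (- z) * C1 * pi * z powr (a + 1)) \<longlongrightarrow> 0) at_top"
    using a by real_asymp
  then have "\<forall>\<^sub>F z in at_top. exp (- z) * C1 * pi * z powr (a + 1) < c / 2"
    by (rule order_tendstoD) (use c in simp)
  then obtain z1 where z1: "\<And>z. z \<ge> z1 \<Longrightarrow> exp (- z) * C1 * pi * z powr (a + 1) < c / 2"
    by (auto simp: eventually_at_top_linorder)
  \<comment> \<open>From 2^(1 / a) on, z^a >= 2 and hence \<kappa> v^a <= 1 on \<open>I\<close>,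
    which is the range of \<open>sin_ge_mult_cos_1\<close>.\<close>
  define z0 where "z0 = max (max 1 z1) (2 powr (1 / a))"
  show ?thesis
  proof (rule that[of "c / 2 / pi" z0])
    show "c / 2 / pi > 0" using c by simp
    show "z0 \<ge> 1" by (simp add: z0_def)
    fix z assume "z \<ge> z0"
    then have z: "z \<ge> 1" "z \<ge> z1" "z \<ge> 2 powr (1 / a)" by (auto simp: z0_def)
    define I where "I = {1 / (2 * z)..1 / z}"
    define q where "q = 2 * c * z powr (- a)"
    define bd where "bd = (\<lambda>v. indicator I v * q - exp (- z) * C1 * (1 / (1 + v\<^sup>2)))"
    have "bd v \<le> Re (stabF 0 0 0 z a b v)" for v
    proof -
      have nn: "exp (- z) * C1 * (1 / (1 + v\<^sup>2)) \<ge> 0" using C1 by simp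
      have I01: "v \<in> I \<Longrightarrow> 0 < v \<and> v \<le> 1"
      proof -
        assume "v \<in> I"
        then have "1 / (2 * z) \<le> v" "v \<le> 1 / z" by (auto simp: I_def)
        moreover have "0 < 1 / (2 * z)" "1 / z \<le> 1" using z by auto
        ultimately show ?thesis by linarith
      qed
      consider "v \<in> I" | "v \<notin> I" "v \<le> 0" | "v \<notin> I" "0 < v" "v \<le> 1" | "v \<notin> I" "v > 1" by linarith
      then show ?thesis
      proof cases
        case 1
        then have v: "0 < v" "v \<le> 1" using I01 by auto
        have vz: "1 / (2 * z) \<le> v" "v \<le> 1 / z" using 1 by (auto simp: I_def)
        have "v powr a \<le> (1 / z) powr a" using v vz a by (intro powr_mono2) auto
        also have "\<dots> = 1 / z powr a" using z by (simp add: powr_divide)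
        also have "z powr a \<ge> (2 powr (1 / a)) powr a" using z a by (intro powr_mono2) auto
        then have "2 \<le> z powr a" using a by (simp add: powr_powr)
        then have "1 / z powr a \<le> 1 / 2" by (intro frac_le) auto
        finally have w1: "\<kappa> * v powr a \<le> 1"
          using mult_mono[OF k2, of "v powr a" "1 / 2"] by simp
        have "(1 / 2) powr a * z powr (- a) = (1 / (2 * z)) powr a"
          using z by (simp add: powr_divide powr_mult powr_minus field_simps)
        also have "\<dots> \<le> v powr a" using z vz a by (intro powr_mono2) auto
        finally have va: "(1 / 2) powr a * z powr (- a) \<le> v powr a" .
        have "q = exp (- 1) * (exp (- R) * (\<kappa> * ((1 / 2) powr a * z powr (- a)) * cos 1))"
          by (simp add: q_def c_def)
        also have "\<dots> \<le> exp (- (v * z)) * (exp (- \<rho> v) * (\<kappa> * v powr a * cos 1))"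
        proof (intro mult_mono)
          have "v * z \<le> 1" using vz z by (simp add: field_simps)
          then show "exp (- 1) \<le> exp (- (v * z))" by simp
          have "\<rho> v \<le> R" unfolding \<rho>_def
            using complex_Re_le_cmod[of "stabA 0 (of_real a) (of_real b) (Complex 0 (- v))"] R(2)[of v] v by simp
          then show "exp (- R) \<le> exp (- \<rho> v)" by simp
        qed (use va kpos cos_gt_zero_pi[of 1] pi_gt3 in auto)
        also have "\<dots> \<le> exp (- (v * z)) * (exp (- \<rho> v) * sin (\<kappa> * v powr a))"
          using w1 kpos by (intro mult_left_mono sin_ge_mult_cos_1) auto
        also have "\<dots> = Re (stabF 0 0 0 z a b v)" using seg[OF v] by simp
        finally show ?thesis using 1 nn by (simp add: bd_def)
      next
        case 2
        then show ?thesis using nn by (simp add: bd_def stabF_nonpos)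
      next
        case 3
        have "\<kappa> * v powr a \<le> 2 * 1" using k2 kpos 3 a by (intro mult_mono powr_le1) auto
        then have "sin (\<kappa> * v powr a) \<ge> 0" using kpos pi_gt3 by (intro sin_ge_zero) auto
        then have "Re (stabF 0 0 0 z a b v) \<ge> 0" using seg[OF 3(2,3)] by simp
        then show ?thesis using 3 nn by (simp add: bd_def)
      next
        case 4
        then show ?thesis using C1(2)[OF 4(2), of z] by (simp add: bd_def abs_le_iff)
      qed
    qed
    moreover have Iint: "integrable lborel (\<lambda>v. indicator I v * q)"
      unfolding I_def by (intro integrable_mult_left integrable_real_indicator) (auto simp: emeasure_lborel_Icc_eq)
    moreover note Kint = integrable_mult_right[OF integrable_inverse_1_plus_square_lborel, of "exp (- z) * C1"]
    moreover have "integrable lborel (\<lambda>v. Re (stabF 0 0 0 z a b v))"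
      using stabF_integrable[OF a] by auto
    ultimately have "(\<integral>v. bd v \<partial>lborel) \<le> (\<integral>v. Re (stabF 0 0 0 z a b v) \<partial>lborel)"
      unfolding bd_def by (intro integral_mono Bochner_Integration.integrable_diff) auto
    moreover have "(\<integral>v. indicator I v * q \<partial>lborel) = q / (2 * z)"
    proof -
      have "1 / (2 * z) \<le> 1 / z" using z by (simp add: field_simps)
      then have "measure lborel I = 1 / z - 1 / (2 * z)"
        unfolding I_def by simp
      also have "\<dots> = 1 / (2 * z)" using z by (simp add: field_simps)
      finally have "measure lborel I = 1 / (2 * z)" .
      then show ?thesis by simp
    qed
    then have "(\<integral>v. bd v \<partial>lborel) = q / (2 * z) - exp (- z) * C1 * pi"
      unfolding bd_def
      by (simp only: Bochner_Integration.integral_diff[OF Iint Kint]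
          integral_mult_right_zero integral_inverse_1_plus_square_lborel)
    moreover have "exp (- z) * C1 * pi \<le> c / 2 * z powr (- (a + 1))"
    proof -
      have "z powr (a + 1) > 0" using z by simp
      then have "exp (- z) * C1 * pi \<le> c / 2 / z powr (a + 1)"
        using less_imp_le[OF z1[OF z(2)]] by (subst pos_le_divide_eq) auto
      then show ?thesis unfolding powr_minus_divide by simp
    qed
    moreover have "q / (2 * z) = c * z powr (- (a + 1))"
    proof -
      have "- (a + 1) = - a - 1" by simp
      then have "z powr (- (a + 1)) = z powr (- a) / z" using z by (simp only: powr_diff powr_one)
      then show ?thesis by (simp add: q_def)
    qed
    ultimately have "(\<integral>v. Re (stabF 0 0 0 z a b v) \<partial>lborel) \<ge> c / 2 * z powr (- (a + 1))"
      by simp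
    then show "stabG 0 0 0 z a b \<ge> c / 2 / pi * z powr (- (a + 1))"
      unfolding stabG_def by (simp add: field_simps)
  qed
qed

section \<open>Shifting the contour\<close>

lemma filterlim_norm_at_right_0: "filterlim norm (at_right 0) (at (0::'a::real_normed_vector))"
  by (auto simp: filterlim_at eventually_at_filter intro!: tendsto_norm_zero tendsto_ident_at)

lemma stabA_tendsto_0:
  assumes a: "0 < a" "a < 2"
  shows "(stabA 0 (of_real a) (of_real b) \<longlongrightarrow> 0) (at 0)"
proof (rule Lim_null_comparison)
  define K where "K = \<bar>b\<bar> * norm (stabT (of_real a))"
  define g where "g = (\<lambda>r. r powr a + K * ((r + r powr a) * (- ln r + pi)))"
  have "(g \<longlongrightarrow> 0) (at_right 0)"
  proof -
    have 1: "((\<lambda>r::real. r powr a) \<longlongrightarrow> 0) (at_right 0)" using a by real_asymp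
    have 2: "((\<lambda>r::real. r * (- ln r + pi)) \<longlongrightarrow> 0) (at_right 0)" by real_asymp
    have 3: "((\<lambda>r::real. r powr a * (- ln r + pi)) \<longlongrightarrow> 0) (at_right 0)" using a by real_asymp
    have "((\<lambda>r. r powr a + K * (r * (- ln r + pi) + r powr a * (- ln r + pi))) \<longlongrightarrow> 0 + K * (0 + 0))
        (at_right 0)"
      by (intro tendsto_add tendsto_mult tendsto_const 1 2 3)
    then show ?thesis by (simp add: g_def algebra_simps)
  qed
  then show "((\<lambda>s::complex. g (norm s)) \<longlongrightarrow> 0) (at 0)"
    by (rule filterlim_compose[OF _ filterlim_norm_at_right_0])
  have "\<forall>\<^sub>F s in at (0::complex). s \<in> ball 0 1 - {0}"
    using eventually_at_ball'[of 1 "0::complex" UNIV] by simp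
  then show "\<forall>\<^sub>F s in at 0. norm (stabA 0 (of_real a) (of_real b) s) \<le> g (norm s)"
  proof eventually_elim
    case (elim s)
    then have s: "s \<noteq> 0" "norm s < 1" by auto
    have "norm (stabA 0 (of_real a) (of_real b) s) \<le>
        norm (exp (of_real a * Ln s)) + norm (\<i> * of_real b * stabeta 0 (of_real a) s)"
      unfolding stabA_def
      using norm_triangle_ineq[of "exp (of_real a * Ln s)" "\<i> * of_real b * stabeta 0 (of_real a) s"]
      by (simp del: norm_exp_eq_Re)
    also have "norm (exp (of_real a * Ln s)) = norm s powr a" by (rule norm_exp_Ln[OF s(1)])
    also have "norm (\<i> * of_real b * stabeta 0 (of_real a) s) = K * norm (stabQ 0 (of_real a) s)"
      by (simp add: stabeta_0 norm_mult K_def)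
    also have "\<dots> \<le> K * ((norm s + norm s powr a) * (\<bar>ln (norm s)\<bar> + pi))"
      using norm_stabQ_le[OF s(1), of 0 a] by (intro mult_left_mono) (auto simp: K_def)
    also have "\<bar>ln (norm s)\<bar> = - ln (norm s)" using s by simp
    finally show ?case by (simp add: g_def)
  qed
qed

text \<open>The value at 0 is set by hand to the limit found in \<open>stabA_tendsto_0\<close>:
  \<open>Ln\<close> has only a default value there, and 0 is a corner of the rectangle used
  below.\<close>

definition stabf :: "real \<Rightarrow> real \<Rightarrow> real \<Rightarrow> complex \<Rightarrow> complex" where
  "stabf z a b s = (if s = 0 then 1 else exp (- \<i> * s * of_real z) * exp (- stabA 0 (of_real a) (of_real b) s))"

lemma stabf_continuous:
  assumes a: "0 < a" "a < 2"
  shows "continuous_on (insert 0 strip) (stabf z a b)"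
proof (subst continuous_on_eq_continuous_within, rule ballI)
  fix s assume "s \<in> insert 0 strip"
  then consider "s = 0" | "s \<in> strip" by auto
  then show "continuous (at s within insert 0 strip) (stabf z a b)"
  proof cases
    case 1
    have "((\<lambda>s. exp (- \<i> * s * of_real z) * exp (- stabA 0 (of_real a) (of_real b) s)) \<longlongrightarrow>
        exp (- \<i> * 0 * of_real z) * exp (- 0)) (at 0)"
      by (intro tendsto_intros stabA_tendsto_0 a)
    then have "(stabf z a b \<longlongrightarrow> exp (- \<i> * 0 * of_real z) * exp (- 0)) (at 0)"
      by (rule Lim_transform_eventually) (auto simp: stabf_def eventually_at_filter)
    then have "isCont (stabf z a b) 0" by (simp add: isCont_def stabf_def)
    then show ?thesis using 1 continuous_at_imp_continuous_within by blast
  next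
    case 2
    then have s: "s \<notin> \<real>\<^sub>\<le>\<^sub>0" by (rule strip_notin_nonpos)
    have "open (- \<real>\<^sub>\<le>\<^sub>0 :: complex set)" by (simp add: closed_nonpos_Reals_complex open_Compl)
    moreover have "continuous_on (- \<real>\<^sub>\<le>\<^sub>0) (stabf z a b)"
    proof -
      have "continuous_on (- \<real>\<^sub>\<le>\<^sub>0)
          (\<lambda>s. exp (- \<i> * s * of_real z) * exp (- stabA 0 (of_real a) (of_real b) s))"
        using stabT_dom_real[OF a] by (intro continuous_intros) auto
      then show ?thesis by (rule continuous_on_eq) (auto simp: stabf_def)
    qed
    ultimately have "isCont (stabf z a b) s"
      using s by (simp add: continuous_on_eq_continuous_at)
    then show ?thesis using continuous_at_imp_continuous_within by blast
  qed
qed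

lemma stabf_differentiable:
  assumes "s \<notin> \<real>\<^sub>\<le>\<^sub>0"
  shows "stabf z a b field_differentiable (at s)"
proof -
  have "\<exists>D. ((\<lambda>s. exp (- \<i> * s * of_real z) * exp (- stabA 0 (of_real a) (of_real b) s))
      has_field_derivative D) (at s)"
    by (rule exI) (rule derivative_eq_intros stabA_deriv_s assms refl)+
  then obtain D where D: "((\<lambda>s. exp (- \<i> * s * of_real z) * exp (- stabA 0 (of_real a) (of_real b) s))
      has_field_derivative D) (at s)" by blast
  have "open (- \<real>\<^sub>\<le>\<^sub>0 :: complex set)" by (simp add: closed_nonpos_Reals_complex open_Compl)
  with D have "(stabf z a b has_field_derivative D) (at s)"
    by (rule has_field_derivative_transform_within_open) (use assms in \<open>auto simp: stabf_def\<close>)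
  then show ?thesis by (auto simp: field_differentiable_def)
qed

lemma stabf_bound:
  assumes a: "0 < a" "a < 2"
  obtains C where "C \<ge> 0" "\<And>s. s \<in> strip \<Longrightarrow> norm (stabf z a b s) \<le> C / (1 + (1 + Re s)\<^sup>2)"
proof -
  obtain C where C: "C \<ge> 0" "\<And>a' b' s. a' \<in> {a..a} \<Longrightarrow> b' \<in> {-\<bar>b\<bar>..\<bar>b\<bar>} \<Longrightarrow> s \<in> strip \<Longrightarrow>
      norm (s ^ 0 * jetD 0 0 (complex_of_real a') (complex_of_real b') s) \<le> C / (1 + (1 + Re s)\<^sup>2)"
    using jetD_strip_bound[OF a, where B="\<bar>b\<bar>" and k=0 and j=0 and l=0] by metis
  show ?thesis
  proof (rule that[of "exp \<bar>z\<bar> * C"])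
    fix s assume s: "s \<in> strip"
    have "norm (stabf z a b s) = exp (Im s * z) * norm (jetD 0 0 (of_real a) (of_real b) s)"
      using s by (auto simp: stabf_def strip_def norm_mult jetD_def)
    also have "\<dots> \<le> exp \<bar>z\<bar> * (C / (1 + (1 + Re s)\<^sup>2))"
    proof (intro mult_mono)
      have "Im s * z \<le> \<bar>Im s * z\<bar>" by simp
      also have "\<dots> \<le> 1 * \<bar>z\<bar>" unfolding abs_mult using s by (intro mult_right_mono) (auto simp: strip_def)
      finally show "exp (Im s * z) \<le> exp \<bar>z\<bar>" by simp
      show "norm (jetD 0 0 (of_real a) (of_real b) s) \<le> C / (1 + (1 + Re s)\<^sup>2)"
        using C(2)[of a b s] s abs_ge_self[of b] abs_ge_minus_self[of b] by (auto simp: minus_le_iff)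
    qed auto
    finally show "norm (stabf z a b s) \<le> exp \<bar>z\<bar> * C / (1 + (1 + Re s)\<^sup>2)" by simp
  qed (use C in simp)
qed

text \<open>Cauchy's theorem for the rectangle with corners 0, - i, R - i and R. The branch point 0
  is a corner, which is harmless: holomorphy is used in the interior and mere continuity up to the
  boundary.\<close>

lemma stabf_cauchy:
  assumes a: "0 < a" "a < 2" and R: "R > 0"
  shows "integral {0..R} (\<lambda>t. stabf z a b (of_real t)) =
     - \<i> * integral {0..1} (\<lambda>v. stabf z a b (Complex 0 (- v)))
     + integral {0..R} (\<lambda>t. stabf z a b (Complex t (- 1)))
     + contour_integral (linepath (Complex R (- 1)) (of_real R)) (stabf z a b)"
proof -
  let ?f = "stabf z a b"
  define S where "S = cbox (Complex 0 (- 1)) (Complex R 0)"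
  have Ss: "S \<subseteq> insert 0 strip" by (auto simp: S_def strip_def in_cbox_complex_iff)
  have cont: "continuous_on S ?f" by (rule continuous_on_subset[OF stabf_continuous[OF a] Ss])
  have conv: "convex S" by (simp add: S_def convex_box)
  have pts: "0 \<in> S" "- \<i> \<in> S" "Complex R (- 1) \<in> S" "complex_of_real R \<in> S"
    using R by (auto simp: S_def in_cbox_complex_iff)
  have seg: "closed_segment x y \<subseteq> S" if "x \<in> S" "y \<in> S" for x y
    using that conv by (rule closed_segment_subset)
  have ci: "?f contour_integrable_on linepath x y" if "x \<in> S" "y \<in> S" for x y
    by (rule contour_integrable_continuous_linepath[OF continuous_on_subset[OF cont seg[OF that]]])
  let ?g = "linepath 0 (- \<i>) +++ (linepath (- \<i>) (Complex R (- 1)) +++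
      (linepath (Complex R (- 1)) (of_real R) +++ linepath (of_real R) 0))"
  have "(?f has_contour_integral 0) ?g"
  proof (rule Cauchy_theorem_convex[OF cont conv, of "{}"])
    fix x assume "x \<in> interior S - {}"
    then have "x \<in> box (Complex 0 (- 1)) (Complex R 0)" by (simp add: S_def)
    then have "x \<notin> \<real>\<^sub>\<le>\<^sub>0" by (auto simp: in_box_complex_iff complex_nonpos_Reals_iff)
    then show "?f field_differentiable at x" by (rule stabf_differentiable)
  qed (use seg pts in \<open>auto simp: path_image_join\<close>)
  then have 0: "contour_integral ?g ?f = 0" by (rule contour_integral_unique)
  have "contour_integral ?g ?f = contour_integral (linepath 0 (- \<i>)) ?f +
     (contour_integral (linepath (- \<i>) (Complex R (- 1))) ?f +
     (contour_integral (linepath (Complex R (- 1)) (of_real R)) ?f + contour_integral (linepath (of_real R) 0) ?f))"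
    using ci pts by simp
  moreover have "contour_integral (linepath (of_real R) 0) ?f = - contour_integral (linepath 0 (of_real R)) ?f"
    using continuous_on_subset[OF cont seg[OF pts(1,4)]] by (simp add: contour_integral_reverse_linepath)
  moreover have "contour_integral (linepath 0 (of_real R)) ?f = integral {0..R} (\<lambda>t. ?f (of_real t))"
    using contour_integral_linepath_Reals_eq[of 0 "of_real R" ?f] R by simp
  moreover have "contour_integral (linepath 0 (- \<i>)) ?f = - \<i> * integral {0..1} (\<lambda>v. ?f (Complex 0 (- v)))"
  proof -
    have "linepath 0 (- \<i>) v = Complex 0 (- v)" for v by (simp add: linepath_def complex_eq_iff)
    then show ?thesis by (simp add: contour_integral_integral)
  qed
  moreover have "contour_integral (linepath (- \<i>) (Complex R (- 1))) ?f = integral {0..R} (\<lambda>t. ?f (Complex t (- 1)))"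
  proof -
    have "linepath (- \<i>) (Complex R (- 1)) v = linepath 0 (of_real R) v - \<i>" for v
      by (simp add: linepath_def complex_eq_iff algebra_simps)
    moreover have "Complex R (- 1) + \<i> = of_real R" by (simp add: complex_eq_iff)
    ultimately have "contour_integral (linepath (- \<i>) (Complex R (- 1))) ?f =
        contour_integral (linepath 0 (of_real R)) (\<lambda>s. ?f (s - \<i>))"
      by (simp add: contour_integral_integral)
    also have "\<dots> = integral {0..R} (\<lambda>t. ?f (of_real t - \<i>))"
      using contour_integral_linepath_Reals_eq[of 0 "of_real R" "\<lambda>s. ?f (s - \<i>)"] R by simp
    also have "(\<lambda>t. ?f (of_real t - \<i>)) = (\<lambda>t. ?f (Complex t (- 1)))"
      by (intro ext arg_cong[of _ _ ?f]) (simp add: complex_eq_iff)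
    finally show ?thesis .
  qed
  ultimately show ?thesis using 0 by (simp add: algebra_simps)
qed

lemma stabf_line_integrable:
  assumes a: "0 < a" "a < 2" and y: "0 \<le> y" "y \<le> 1"
  shows "set_integrable lborel {0..} (\<lambda>t. stabf z a b (Complex t (- y)))"
proof -
  obtain C where C: "C \<ge> 0" "\<And>s. s \<in> strip \<Longrightarrow> norm (stabf z a b s) \<le> C / (1 + (1 + Re s)\<^sup>2)"
    using stabf_bound[OF a] by metis
  have "continuous_on {0..} (\<lambda>t. stabf z a b (Complex t (- y)))"
  proof (rule continuous_on_compose2[OF stabf_continuous[OF a]])
    show "continuous_on {0..} (\<lambda>t. Complex t (- y))" unfolding Complex_eq by (intro continuous_intros)
  qed (use y in \<open>auto simp: strip_def complex_eq_iff\<close>)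
  then have "(\<lambda>t. indicator {0..} t *\<^sub>R stabf z a b (Complex t (- y))) \<in> borel_measurable borel"
    by (intro borel_measurable_continuous_on_indicator) auto
  then have m: "(\<lambda>t. indicator {0..} t *\<^sub>R stabf z a b (Complex t (- y))) \<in> borel_measurable lborel"
    by simp
  show ?thesis
    unfolding set_integrable_def
  proof (rule Bochner_Integration.integrable_bound[OF _ m])
    show "integrable lborel (\<lambda>t. (C + 1) * (1 / (1 + t\<^sup>2)) :: real)"
      by (intro integrable_mult_right integrable_inverse_1_plus_square_lborel)
    show "AE t in lborel. norm (indicator {0..} t *\<^sub>R stabf z a b (Complex t (- y)))
        \<le> norm ((C + 1) * (1 / (1 + t\<^sup>2)))"
      using AE_lborel_singleton[of 0]
    proof eventually_elim
      case (elim t)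
      show ?case
      proof (cases "t > 0")
        case True
        then have "Complex t (- y) \<in> strip" using y by (auto simp: strip_def complex_eq_iff)
        from C(2)[OF this] have "norm (stabf z a b (Complex t (- y))) \<le> C / (1 + (1 + t)\<^sup>2)" by simp
        also have "\<dots> \<le> (C + 1) / (1 + t\<^sup>2)"
          using C(1) True by (intro frac_le add_left_mono power_mono add_pos_nonneg) auto
        finally show ?thesis using True C(1) by simp
      qed (use elim C(1) in auto)
    qed
  qed
qed

text \<open>Lets R tend to infinity: the right edge has length 1 and its integrand is O(1 / R^2).
  The two remaining sides are glued into one integral over the parameter \<open>v\<close>; they
  match \<open>stabF\<close> except at the single points 0 and 1.\<close>

lemma integral_stabf_eq:
  assumes a: "0 < a" "a < 2"
  shows "(LINT t:{0..}|lborel. stabf z a b (of_real t)) = (\<integral>v. stabF 0 0 0 z a b v \<partial>lborel)"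
proof -
  let ?f = "stabf z a b"
  have i0: "set_integrable lborel {0..} (\<lambda>t. ?f (of_real t))"
    using stabf_line_integrable[OF a, of 0 z b] by (simp add: complex_of_real_def)
  have i1: "set_integrable lborel {0..} (\<lambda>t. ?f (Complex t (- 1)))"
    using stabf_line_integrable[OF a, of 1 z b] by simp
  obtain C where C: "C \<ge> 0" "\<And>s. s \<in> strip \<Longrightarrow> norm (?f s) \<le> C / (1 + (1 + Re s)\<^sup>2)"
    using stabf_bound[OF a] by metis
  have lim: "((\<lambda>R. integral {0..R} g) \<longlongrightarrow> (LINT t:{0..}|lborel. g t)) at_top"
    if g: "set_integrable lborel {0..} g" for g :: "real \<Rightarrow> complex"
  proof -
    have "((\<lambda>R. LINT t:{0..R}|lborel. g t) \<longlongrightarrow> (LINT t:{0..}|lborel. g t)) at_top"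
      by (rule tendsto_set_lebesgue_integral_at_top[OF _ g]) auto
    moreover have "(LINT t:{0..R}|lborel. g t) = integral {0..R} g" for R
      by (rule set_borel_integral_eq_integral(2)[OF set_integrable_subset[OF g]]) auto
    ultimately show ?thesis by simp
  qed
  have edge: "((\<lambda>R. contour_integral (linepath (Complex R (- 1)) (of_real R)) ?f) \<longlongrightarrow> 0) at_top"
  proof (rule Lim_null_comparison)
    show "((\<lambda>R. C / (1 + (1 + R)\<^sup>2)) \<longlongrightarrow> 0) at_top" by real_asymp
    show "\<forall>\<^sub>F R in at_top. norm (contour_integral (linepath (Complex R (- 1)) (of_real R)) ?f)
        \<le> C / (1 + (1 + R)\<^sup>2)"
      using eventually_gt_at_top[of 0]
    proof eventually_elim
      case (elim R)
      have seg: "s \<in> strip \<and> Re s = R" if "s \<in> closed_segment (Complex R (- 1)) (of_real R)" for s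
        using that elim by (auto simp: closed_segment_same_Re closed_segment_eq_real_ivl strip_def)
      have "?f contour_integrable_on linepath (Complex R (- 1)) (of_real R)"
        by (rule contour_integrable_continuous_linepath[OF continuous_on_subset[OF stabf_continuous[OF a]]])
          (use seg in auto)
      then have "norm (contour_integral (linepath (Complex R (- 1)) (of_real R)) ?f) \<le>
          C / (1 + (1 + R)\<^sup>2) * norm (complex_of_real R - Complex R (- 1))"
        by (rule contour_integral_bound_linepath) (use C seg in \<open>force+\<close>)
      moreover have "complex_of_real R - Complex R (- 1) = \<i>" by (simp add: complex_eq_iff)
      ultimately show ?case by simp
    qed
  qed
  have "((\<lambda>R. - \<i> * integral {0..1} (\<lambda>v. ?f (Complex 0 (- v)))
     + integral {0..R} (\<lambda>t. ?f (Complex t (- 1)))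
     + contour_integral (linepath (Complex R (- 1)) (of_real R)) ?f) \<longlongrightarrow>
     - \<i> * integral {0..1} (\<lambda>v. ?f (Complex 0 (- v))) + (LINT t:{0..}|lborel. ?f (Complex t (- 1))) + 0) at_top"
    by (intro tendsto_intros lim i1 edge)
  moreover have "\<forall>\<^sub>F R in at_top. - \<i> * integral {0..1} (\<lambda>v. ?f (Complex 0 (- v)))
     + integral {0..R} (\<lambda>t. ?f (Complex t (- 1)))
     + contour_integral (linepath (Complex R (- 1)) (of_real R)) ?f = integral {0..R} (\<lambda>t. ?f (of_real t))"
    using eventually_gt_at_top[of 0] by eventually_elim (use stabf_cauchy[OF a] in simp)
  ultimately have "((\<lambda>R. integral {0..R} (\<lambda>t. ?f (of_real t))) \<longlongrightarrow>
     - \<i> * integral {0..1} (\<lambda>v. ?f (Complex 0 (- v))) + (LINT t:{0..}|lborel. ?f (Complex t (- 1))) + 0) at_top"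
    by (rule Lim_transform_eventually)
  from tendsto_unique[OF _ lim[OF i0] this]
  have 1: "(LINT t:{0..}|lborel. ?f (of_real t)) =
     - \<i> * integral {0..1} (\<lambda>v. ?f (Complex 0 (- v))) + (LINT t:{0..}|lborel. ?f (Complex t (- 1)))"
    by simp
  have "continuous_on {0..1} (\<lambda>v. ?f (Complex 0 (- v)))"
  proof (rule continuous_on_compose2[OF stabf_continuous[OF a]])
    show "continuous_on {0..1} (\<lambda>v. Complex 0 (- v))" unfolding Complex_eq by (intro continuous_intros)
  qed (auto simp: strip_def complex_eq_iff)
  then have iseg: "set_integrable lborel {0..1} (\<lambda>v. ?f (Complex 0 (- v)))"
    by (rule borel_integrable_atLeastAtMost')
  have 2: "- \<i> * integral {0..1} (\<lambda>v. ?f (Complex 0 (- v))) = (\<integral>v. indicator {0..1} v *\<^sub>R stabF 0 0 0 z a b v \<partial>lborel)"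
  proof -
    have "- \<i> * integral {0..1} (\<lambda>v. ?f (Complex 0 (- v))) =
       - \<i> * (\<integral>v. indicator {0..1} v *\<^sub>R ?f (Complex 0 (- v)) \<partial>lborel)"
      using set_borel_integral_eq_integral(2)[OF iseg] by (simp add: set_lebesgue_integral_def)
    also have "\<dots> = (\<integral>v. - \<i> * (indicator {0..1} v *\<^sub>R ?f (Complex 0 (- v))) \<partial>lborel)"
      by (rule integral_mult_right_zero[symmetric])
    also have "\<dots> = (\<integral>v. indicator {0..1} v *\<^sub>R stabF 0 0 0 z a b v \<partial>lborel)"
    proof (rule integral_cong_AE)
      show "(\<lambda>v. - \<i> * (indicator {0..1} v *\<^sub>R ?f (Complex 0 (- v)))) \<in> borel_measurable lborel"
        using iseg unfolding set_integrable_def by (intro borel_measurable_times) auto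
      show "(\<lambda>v. indicator {0..1} v *\<^sub>R stabF 0 0 0 z a b v) \<in> borel_measurable lborel"
        using stabF_measurable[OF a] by simp
      show "AE v in lborel. - \<i> * (indicator {0..1} v *\<^sub>R ?f (Complex 0 (- v))) =
          indicator {0..1} v *\<^sub>R stabF 0 0 0 z a b v"
        using AE_lborel_singleton[of 0]
      proof eventually_elim
        case (elim v)
        show ?case
        proof (cases "v \<in> {0..1}")
          case True
          then have "contour v = Complex 0 (- v)" "contour_deriv v = - \<i>" "Complex 0 (- v) \<noteq> 0"
            using elim by (auto simp: contour_def contour_deriv_def complex_eq_iff)
          then show ?thesis using True by (simp add: stabF_def stabf_def jetD_def)
        qed simp
      qed
    qed
    finally show ?thesis .
  qed
  have 3: "(LINT t:{0..}|lborel. ?f (Complex t (- 1))) = (\<integral>v. indicator {1<..} v *\<^sub>R stabF 0 0 0 z a b v \<partial>lborel)"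
  proof -
    have "(LINT t:{0..}|lborel. ?f (Complex t (- 1))) =
       (\<integral>v. indicator {0..} (- 1 + 1 * v) *\<^sub>R ?f (Complex (- 1 + 1 * v) (- 1)) \<partial>lborel)"
      unfolding set_lebesgue_integral_def by (subst lborel_integral_real_affine[where c=1 and t="- 1"]) auto
    also have "\<dots> = (\<integral>v. indicator {1<..} v *\<^sub>R stabF 0 0 0 z a b v \<partial>lborel)"
    proof (rule integral_cong_AE)
      have "integrable lborel (\<lambda>v. indicator {0..} (- 1 + 1 * v) *\<^sub>R ?f (Complex (- 1 + 1 * v) (- 1)))"
        using lborel_integrable_real_affine[of "\<lambda>t. indicator {0..} t *\<^sub>R ?f (Complex t (- 1))" 1 "-1"] i1
        by (simp add: set_integrable_def)
      then show "(\<lambda>v. indicator {0..} (- 1 + 1 * v) *\<^sub>R ?f (Complex (- 1 + 1 * v) (- 1)))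
          \<in> borel_measurable lborel" by auto
      show "(\<lambda>v. indicator {1<..} v *\<^sub>R stabF 0 0 0 z a b v) \<in> borel_measurable lborel"
        using stabF_measurable[OF a] by simp
      show "AE v in lborel. indicator {0..} (- 1 + 1 * v) *\<^sub>R ?f (Complex (- 1 + 1 * v) (- 1)) =
          indicator {1<..} v *\<^sub>R stabF 0 0 0 z a b v"
        using AE_lborel_singleton[of 1]
      proof eventually_elim
        case (elim v)
        show ?case
        proof (cases "v > 1")
          case True
          then have "contour v = Complex (v - 1) (- 1)" "contour_deriv v = 1" "Complex (v - 1) (- 1) \<noteq> 0"
            by (auto simp: contour_def contour_deriv_def complex_eq_iff)
          then show ?thesis using True by (simp add: stabF_def stabf_def jetD_def)
        qed (use elim in auto)
      qed
    qed
    finally show ?thesis .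
  qed
  have "integrable lborel (\<lambda>v. indicator {0..1} v *\<^sub>R stabF 0 0 0 z a b v)"
    "integrable lborel (\<lambda>v. indicator {1<..} v *\<^sub>R stabF 0 0 0 z a b v)"
    using integrable_mult_indicator[OF _ stabF_integrable[OF a]] by auto
  then have "(\<integral>v. indicator {0..1} v *\<^sub>R stabF 0 0 0 z a b v \<partial>lborel) +
      (\<integral>v. indicator {1<..} v *\<^sub>R stabF 0 0 0 z a b v \<partial>lborel) =
      (\<integral>v. indicator {0..1} v *\<^sub>R stabF 0 0 0 z a b v + indicator {1<..} v *\<^sub>R stabF 0 0 0 z a b v \<partial>lborel)"
    by simp
  also have "\<dots> = (\<integral>v. stabF 0 0 0 z a b v \<partial>lborel)"
    by (rule Bochner_Integration.integral_cong) (auto simp: indicator_def stabF_nonpos)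
  finally show ?thesis unfolding 1 2 3 .
qed

section \<open>The characteristic function on the whole real line\<close>

lemma integral_hermitian:
  fixes g :: "real \<Rightarrow> complex"
  assumes herm: "\<And>t. g (- t) = cnj (g t)" and int: "set_integrable lborel {0..} g"
  shows "integrable lborel g"
    "(\<integral>t. g t \<partial>lborel) = of_real (2 * Re (LINT t:{0..}|lborel. g t))"
proof -
  define H where "H = (\<lambda>t. indicator {0..} t *\<^sub>R g t)"
  have H: "integrable lborel H" using int by (simp add: set_integrable_def H_def)
  have H': "integrable lborel (\<lambda>t. cnj (H (0 + (- 1) * t)))"
    using lborel_integrable_real_affine[OF H, of "- 1" 0] by (intro Bochner_Integration.integrable_cnj) simp
  have ae: "AE t in lborel. g t = H t + cnj (H (0 + (- 1) * t))"
    using AE_lborel_singleton[of 0]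
  proof eventually_elim
    case (elim t)
    then consider "t > 0" | "t < 0" by linarith
    then show ?case using herm[of "- t"] by cases (auto simp: H_def)
  qed
  have sum: "integrable lborel (\<lambda>t. H t + cnj (H (0 + (- 1) * t)))"
    by (intro Bochner_Integration.integrable_add H H')
  \<comment> \<open>Only the half line is known to be measurable. Symmetry expresses
    \<open>g\<close> through \<open>H\<close> everywhere but at 0, where both summands contribute
    and the value would be doubled.\<close>
  have "g = (\<lambda>t. if t \<in> {0} then g 0 else H t + cnj (H (0 + (- 1) * t)))"
  proof
    fix t :: real
    consider "t = 0" | "t > 0" | "t < 0" by linarith
    then show "g t = (if t \<in> {0} then g 0 else H t + cnj (H (0 + (- 1) * t)))"
      using herm[of "- t"] by cases (auto simp: H_def)
  qed
  moreover have "(\<lambda>t. if t \<in> {0} then g 0 else H t + cnj (H (0 + (- 1) * t))) \<in> borel_measurable lborel"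
    using borel_measurable_integrable[OF sum] by (intro measurable_If_set) auto
  ultimately have m: "g \<in> borel_measurable lborel" by simp
  show "integrable lborel g"
    using integrable_cong_AE[OF m borel_measurable_integrable[OF sum] ae] sum by simp
  have "(\<integral>t. g t \<partial>lborel) = (\<integral>t. H t + cnj (H (0 + (- 1) * t)) \<partial>lborel)"
    by (rule integral_cong_AE[OF m borel_measurable_integrable[OF sum] ae])
  also have "\<dots> = (\<integral>t. H t \<partial>lborel) + (\<integral>t. cnj (H (0 + (- 1) * t)) \<partial>lborel)"
    by (rule Bochner_Integration.integral_add[OF H H'])
  also have "(\<integral>t. cnj (H (0 + (- 1) * t)) \<partial>lborel) = cnj (\<integral>t. H (0 + (- 1) * t) \<partial>lborel)"
    by (rule Bochner_Integration.integral_cnj)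
  also have "(\<integral>t. H (0 + (- 1) * t) \<partial>lborel) = (\<integral>t. H t \<partial>lborel)"
    using lborel_integral_real_affine[of "- 1" H 0] by simp
  also have "(\<integral>t. H t \<partial>lborel) + cnj (\<integral>t. H t \<partial>lborel) = of_real (2 * Re (\<integral>t. H t \<partial>lborel))"
    by (simp add: complex_eq_iff)
  finally show "(\<integral>t. g t \<partial>lborel) = of_real (2 * Re (LINT t:{0..}|lborel. g t))"
    by (simp add: H_def set_lebesgue_integral_def)
qed

text \<open>The standardized characteristic function, \<mu> = 0 and \<sigma> = 1 (see
  \<open>stable_cf_eq\<close>). Negative arguments are reached by conjugation because
  \<open>Ln\<close> has its cut there.\<close>

definition stabch :: "real \<Rightarrow> real \<Rightarrow> real \<Rightarrow> complex" where
  "stabch a b t = (if t \<ge> 0 then stabf 0 a b (of_real t) else cnj (stabf 0 a b (of_real (- t))))"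

lemma stabch_0 [simp]: "stabch a b 0 = 1"
  by (simp add: stabch_def stabf_def)

lemma stabch_uminus: "stabch a b (- t) = cnj (stabch a b t)"
proof -
  consider "t = 0" | "t > 0" | "t < 0" by linarith
  then show ?thesis by cases (auto simp: stabch_def stabf_def)
qed

lemma stabch_pos: "t > 0 \<Longrightarrow> stabch a b t = exp (- stabA 0 (of_real a) (of_real b) (of_real t))"
  by (simp add: stabch_def stabf_def)

lemma stabf_of_real: "t \<ge> 0 \<Longrightarrow> stabf z a b (of_real t) = exp (- \<i> * of_real (t * z)) * stabch a b t"
  by (auto simp: stabch_def stabf_def mult.assoc)

lemma norm_stabch:
  assumes "0 < a" "a < 2"
  shows "norm (stabch a b t) = exp (- (\<bar>t\<bar> powr a))"
proof -
  have *: "norm (stabch a b t) = exp (- (t powr a))" if "t > 0" for t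
    using that Re_stabA_real[OF assms that] by (simp add: stabch_pos)
  consider "t = 0" | "t > 0" | "t < 0" by linarith
  then show ?thesis
  proof cases
    case 3
    then show ?thesis using *[of "- t"] stabch_uminus[of a b t] by simp
  qed (use * assms in auto)
qed

lemma stabch_integral:
  assumes a: "0 < a" "a < 2"
  shows "integrable lborel (\<lambda>t. exp (- \<i> * of_real (t * z)) * stabch a b t)"
    "(\<integral>t. exp (- \<i> * of_real (t * z)) * stabch a b t \<partial>lborel) = of_real (2 * pi * stabG 0 0 0 z a b)"
proof -
  let ?g = "\<lambda>t. exp (- \<i> * of_real (t * z)) * stabch a b t"
  have eq: "?g t = stabf z a b (of_real t)" if "t \<in> {0..}" for t
    using that by (simp add: stabf_of_real)
  have herm: "?g (- t) = cnj (?g t)" for t by (simp add: stabch_uminus exp_cnj)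
  have "set_integrable lborel {0..} (\<lambda>t. stabf z a b (Complex t (- 0)))"
    by (rule stabf_line_integrable[OF a]) auto
  then have "set_integrable lborel {0..} (\<lambda>t. stabf z a b (of_real t))"
    by (simp add: complex_of_real_def)
  moreover have ind: "(\<lambda>t. indicator {0..} t *\<^sub>R ?g t) = (\<lambda>t. indicator {0..} t *\<^sub>R stabf z a b (of_real t))"
    using eq by (auto simp: fun_eq_iff indicator_def)
  ultimately have int: "set_integrable lborel {0..} ?g"
    unfolding set_integrable_def by simp
  show "integrable lborel ?g" by (rule integral_hermitian(1)[OF herm int])
  have "(\<integral>t. ?g t \<partial>lborel) = of_real (2 * Re (LINT t:{0..}|lborel. ?g t))"
    by (rule integral_hermitian(2)[OF herm int])
  also have "(LINT t:{0..}|lborel. ?g t) = (LINT t:{0..}|lborel. stabf z a b (of_real t))"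
    unfolding set_lebesgue_integral_def ind ..
  also have "\<dots> = (\<integral>v. stabF 0 0 0 z a b v \<partial>lborel)" by (rule integral_stabf_eq[OF a])
  also have "Re \<dots> = (\<integral>v. Re (stabF 0 0 0 z a b v) \<partial>lborel)"
    by (rule integral_Re[symmetric]) (rule stabF_integrable[OF a])
  also have "2 * \<dots> = 2 * pi * stabG 0 0 0 z a b" by (simp add: stabG_def)
  finally show "(\<integral>t. ?g t \<partial>lborel) = of_real (2 * pi * stabG 0 0 0 z a b)" .
qed

lemma stabch_integrable: "0 < a \<Longrightarrow> a < 2 \<Longrightarrow> integrable lborel (stabch a b)"
  using stabch_integral(1)[of a 0 b] by simp

lemma stabch_cnj:
  assumes a: "0 < a" "a < 2"
  shows "stabch a (- b) t = cnj (stabch a b t)"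
proof -
  have pos: "stabch a (- b) t = cnj (stabch a b t)" if t: "t > 0" for t
  proof -
    obtain e where e: "stabeta 0 (of_real a) (of_real t) = of_real e"
      using stabeta_real[OF a t] by (auto elim: Reals_cases)
    have "exp (complex_of_real a * Ln (of_real t)) = of_real (exp (a * ln t))"
      using t by (simp add: Ln_of_real flip: exp_of_real)
    then show ?thesis using t by (simp add: stabch_pos stabA_def e exp_cnj)
  qed
  consider "t = 0" | "t > 0" | "t < 0" by linarith
  then show ?thesis
  proof cases
    case 3
    then have "cnj (stabch a (- b) t) = stabch a b t"
      using pos[of "- t"] stabch_uminus[of a _ "t"] by simp
    then show ?thesis by (metis complex_cnj_cnj)
  qed (use pos in auto)
qed

text \<open>Changing the sign of \<beta> conjugates the characteristic function, and the inversion
  integral is real.\<close>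

lemma stabG_reflect_0:
  assumes a: "0 < a" "a < 2"
  shows "stabG 0 0 0 z a b = stabG 0 0 0 (- z) a (- b)"
proof -
  let ?g = "\<lambda>z b t. exp (- \<i> * of_real (t * z)) * stabch a b t"
  have "(\<integral>t. ?g (- z) (- b) t \<partial>lborel) = (\<integral>t. cnj (?g z b t) \<partial>lborel)"
    by (simp add: stabch_cnj[OF a] exp_cnj)
  also have "\<dots> = cnj (\<integral>t. ?g z b t \<partial>lborel)" by (rule Bochner_Integration.integral_cnj)
  finally have "complex_of_real (2 * pi * stabG 0 0 0 (- z) a (- b)) = cnj (of_real (2 * pi * stabG 0 0 0 z a b))"
    unfolding stabch_integral(2)[OF a] .
  also have "\<dots> = of_real (2 * pi * stabG 0 0 0 z a b)" by simp
  finally show ?thesis unfolding of_real_eq_iff by simp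
qed

lemma stable_cf_eq:
  assumes "\<theta> \<in> Theta_int"
  shows "stable_cf \<theta> t = stabch (\<theta> $ par_alpha) (\<theta> $ par_beta) (\<theta> $ par_sigma * t) * exp (\<i> * of_real (\<theta> $ par_mu * t))"
proof -
  define \<mu> \<sigma> a b where d: "\<mu> = \<theta> $ par_mu" "\<sigma> = \<theta> $ par_sigma" "a = \<theta> $ par_alpha" "b = \<theta> $ par_beta"
  have a: "0 < a" "a < 2" "\<sigma> > 0" using assms by (auto simp: Theta_int_def d)
  have pos: "stable_cf \<theta> t = stabch a b (\<sigma> * t) * exp (\<i> * of_real (\<mu> * t))" if t: "t > 0" for t
  proof -
    define u where "u = \<sigma> * t"
    have u: "u > 0" using a t by (simp add: u_def)
    have E: "exp (complex_of_real a * Ln (of_real u)) = of_real (u powr a)"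
      using u by (simp add: Ln_of_real powr_def flip: exp_of_real)
    have "stable_cf \<theta> t = exp (- stabA 0 (of_real a) (of_real b) (of_real u) + \<i> * of_real (\<mu> * t))"
    proof (cases "a = 1")
      case True
      have "stabA 0 (of_real a) (of_real b) (of_real u) = of_real u + \<i> * of_real (u * (2 * b / pi) * ln u)"
        using True u E by (simp add: stabA_def stabeta_1 Ln_of_real)
      then show ?thesis using True u
        unfolding stable_cf_def Let_def d[symmetric] u_def[symmetric] by simp
    next
      case False
      have "stabA 0 (of_real a) (of_real b) (of_real u) =
          of_real (u powr a) + \<i> * of_real (b * tan (pi * a / 2) * (u - u powr a))"
        using False u E a by (simp add: stabA_def stabeta_tan)
      also have "u = u powr a * u powr (1 - a)" using u by (simp flip: powr_add)
      then have "u - u powr a = u powr a * (u powr (1 - a) - 1)" by (simp add: algebra_simps)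
      finally have "stabA 0 (of_real a) (of_real b) (of_real u) =
          of_real (u powr a) + \<i> * of_real (b * tan (pi * a / 2) * (u powr a * (u powr (1 - a) - 1)))" .
      then have "- stabA 0 (of_real a) (of_real b) (of_real u) =
         - of_real (u powr a) * (1 + \<i> * of_real (b * 1 * tan (pi * a / 2) * (u powr (1 - a) - 1)))"
        by (simp add: algebra_simps)
      then show ?thesis using False u t a
        unfolding stable_cf_def Let_def d[symmetric] u_def[symmetric] by simp
    qed
    then show ?thesis using u unfolding exp_add by (simp add: stabch_pos flip: u_def)
  qed
  have "stable_cf \<theta> t = stabch a b (\<sigma> * t) * exp (\<i> * of_real (\<mu> * t))"
  proof -
    consider "t = 0" | "t > 0" | "t < 0" by linarith
    then show ?thesis
    proof cases
      case 3
      have "stable_cf \<theta> t = cnj (stable_cf \<theta> (- t))" by (simp add: cnj_stable_cf)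
      then show ?thesis using pos[of "- t"] 3 stabch_uminus[of a b "\<sigma> * t"] by (simp add: exp_cnj)
    qed (use pos in \<open>auto simp: stable_cf_def Let_def\<close>)
  qed
  then show ?thesis by (simp add: d)
qed

lemma stable_density_eq:
  assumes "\<theta> \<in> Theta_int"
  shows "stable_density x \<theta> =
    stabG 0 0 0 ((x - \<theta> $ par_mu) / \<theta> $ par_sigma) (\<theta> $ par_alpha) (\<theta> $ par_beta) / \<theta> $ par_sigma"
proof -
  define \<mu> \<sigma> a b where d: "\<mu> = \<theta> $ par_mu" "\<sigma> = \<theta> $ par_sigma" "a = \<theta> $ par_alpha" "b = \<theta> $ par_beta"
  have a: "0 < a" "a < 2" "\<sigma> > 0" using assms by (auto simp: Theta_int_def d)
  define z where "z = (x - \<mu>) / \<sigma>"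
  let ?g = "\<lambda>t. exp (- \<i> * of_real (t * z)) * stabch a b t"
  have "exp (- \<i> * of_real (t * x)) * stable_cf \<theta> t = ?g (0 + \<sigma> * t)" for t
  proof -
    have "- (t * x) + \<mu> * t = - (\<sigma> * t * z)" using a by (simp add: z_def field_simps)
    then have "- \<i> * complex_of_real (t * x) + \<i> * of_real (\<mu> * t) = - \<i> * of_real (\<sigma> * t * z)"
      by (metis (no_types, lifting) distrib_left mult_minus_left mult_minus_right of_real_add of_real_minus)
    then have "exp (- \<i> * complex_of_real (t * x)) * exp (\<i> * of_real (\<mu> * t)) = exp (- \<i> * of_real (\<sigma> * t * z))"
      by (simp only: exp_add[symmetric])
    then show ?thesis unfolding stable_cf_eq[OF assms] d[symmetric] by (simp add: mult_ac)
  qed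
  then have "(\<integral>t. exp (- \<i> * of_real (t * x)) * stable_cf \<theta> t \<partial>lborel) = (\<integral>t. ?g (0 + \<sigma> * t) \<partial>lborel)"
    by simp
  also have "\<dots> = (\<integral>t. ?g t \<partial>lborel) /\<^sub>R \<sigma>"
    using lborel_integral_real_affine[of \<sigma> ?g 0] a by simp
  also have "\<dots> = of_real (2 * pi * stabG 0 0 0 z a b / \<sigma>)"
    unfolding stabch_integral(2)[OF a(1,2)] by (simp add: scaleR_conv_of_real field_simps)
  finally have "stable_density x \<theta> = Re (1 / (2 * of_real pi) * of_real (2 * pi * stabG 0 0 0 z a b / \<sigma>))"
    by (simp only: stable_density_def)
  then show ?thesis using a by (simp add: z_def d)
qed

section \<open>Reflection of the derivatives\<close>

lemma DERIV_reflect_z: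
  assumes "\<And>z::real. F z = s * H (- z)" "(F has_real_derivative D) (at z)"
    "(H has_real_derivative D1) (at (- z))"
  shows "D = (- s) * D1"
proof -
  have "((\<lambda>z. s * H (- z)) has_real_derivative s * (D1 * (- 1))) (at z)"
    by (rule DERIV_cmult DERIV_chain2[where f=H] assms(3) derivative_eq_intros refl | simp)+
  moreover have "F = (\<lambda>z. s * H (- z))" using assms(1) by auto
  ultimately show ?thesis using DERIV_unique[OF assms(2)] by force
qed

text \<open>Differentiates \<open>stabG_reflect_0\<close>: each derivative in z or in \<beta>
  reverses the sign. The identity is packed into \<open>R\<close> for all arguments at once, because
  every differentiation needs it in a neighbourhood.\<close>

lemma stabG_reflect:
  assumes "j + l \<le> 2" and a: "0 < a" "a < 2"
  shows "stabG k j l z a b = (- 1) ^ (k + l) * stabG k j l (- z) a (- b)"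
proof -
  define R where "R = (\<lambda>k j l. \<forall>z a b. 0 < a \<longrightarrow> a < 2 \<longrightarrow>
     stabG k j l z a b = (- 1) ^ (k + l) * stabG k j l (- z) a (- b))"
  have R0: "R 0 0 0" unfolding R_def by (intro allI impI, subst stabG_reflect_0, assumption+, simp)
  have RD: "stabG k j l z a b = (- 1) ^ (k + l) * stabG k j l (- z) a (- b)"
    if "R k j l" "0 < a" "a < 2" for k j l z a b
    using that unfolding R_def by blast
  have Ra: "R k (Suc j) l" if R: "R k j l" "j + l < 2" for k j l
    unfolding R_def
  proof (intro allI impI)
    fix z a b :: real assume a: "0 < a" "a < 2"
    have "((\<lambda>a. (- 1) ^ (k + l) * stabG k j l (- z) a (- b)) has_real_derivative
        (- 1) ^ (k + l) * stabG k (Suc j) l (- z) a (- b)) (at a)"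
      by (intro DERIV_cmult stabG_deriv_a a that)
    then have "((\<lambda>a. stabG k j l z a b) has_real_derivative
        (- 1) ^ (k + l) * stabG k (Suc j) l (- z) a (- b)) (at a)"
      by (rule has_field_derivative_transform_within_open[where S="{0<..<2}"])
        (use a in \<open>auto intro!: RD[OF R(1), symmetric]\<close>)
    with stabG_deriv_a[OF a that(2)]
    show "stabG k (Suc j) l z a b = (- 1) ^ (k + l) * stabG k (Suc j) l (- z) a (- b)"
      by (rule DERIV_unique)
  qed
  have Rb: "R k j (Suc l)" if R: "R k j l" "j + l < 2" for k j l
    unfolding R_def
  proof (intro allI impI)
    fix z a b :: real assume a: "0 < a" "a < 2"
    have "stabG k j (Suc l) z a b = - ((- 1) ^ (k + l)) * stabG k j (Suc l) (- z) a (- b)"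
      by (rule DERIV_reflect_z[where F="\<lambda>b. stabG k j l z a b" and H="\<lambda>b. stabG k j l (- z) a b",
            OF RD[OF R(1) a] stabG_deriv_b[OF a that(2)] stabG_deriv_b[OF a that(2)]])
    then show "stabG k j (Suc l) z a b = (- 1) ^ (k + Suc l) * stabG k j (Suc l) (- z) a (- b)" by simp
  qed
  have Rz: "R (Suc k) j l" if R: "R k j l" for k j l
    unfolding R_def
  proof (intro allI impI)
    fix z a b :: real assume a: "0 < a" "a < 2"
    have "stabG (Suc k) j l z a b = - ((- 1) ^ (k + l)) * stabG (Suc k) j l (- z) a (- b)"
      by (rule DERIV_reflect_z[where F="\<lambda>z. stabG k j l z a b" and H="\<lambda>z. stabG k j l z a (- b)",
            OF RD[OF R a] stabG_deriv_z[OF a] stabG_deriv_z[OF a]])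
    then show "stabG (Suc k) j l z a b = (- 1) ^ (Suc k + l) * stabG (Suc k) j l (- z) a (- b)" by simp
  qed
  have "R 0 j l"
  proof -
    from assms(1) consider "j = 0" "l = 0" | "j = 1" "l = 0" | "j = 0" "l = 1" | "j = 2" "l = 0"
      | "j = 1" "l = 1" | "j = 0" "l = 2" by linarith
    then show ?thesis
      using R0 Ra[OF R0] Rb[OF R0] Ra[OF Ra[OF R0]] Ra[OF Rb[OF R0]] Rb[OF Rb[OF R0]]
      by cases (simp_all add: numeral_2_eq_2)
  qed
  then have "R k j l" by (induction k) (auto intro: Rz)
  then show ?thesis using a unfolding R_def by blast
qed

section \<open>Nonnegativity of the density\<close>

definition fourier_nonneg :: "(real \<Rightarrow> complex) \<Rightarrow> bool" where
  "fourier_nonneg h \<longleftrightarrow> integrable lborel h \<and>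
    (\<forall>x. (\<integral>t. exp (- \<i> * of_real (t * x)) * h t \<partial>lborel) \<in> \<real>\<^sub>\<ge>\<^sub>0)"

text \<open>
  These multipliers take the place of characteristic functions: they are closed under sums, products
  and limits, so no measure has to be constructed.
\<close>
definition pos_mult :: "(real \<Rightarrow> complex) \<Rightarrow> bool" where
  "pos_mult K \<longleftrightarrow> (\<forall>h. fourier_nonneg h \<longrightarrow> fourier_nonneg (\<lambda>t. K t * h t))"

lemma pos_multD: "pos_mult K \<Longrightarrow> fourier_nonneg h \<Longrightarrow> fourier_nonneg (\<lambda>t. K t * h t)"
  by (simp add: pos_mult_def)

lemma norm_exp_i: "norm (exp (- \<i> * of_real (t * x))) = 1" "norm (exp (\<i> * of_real y)) = 1"
  by simp_all

lemma integrable_fourier: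
  fixes h :: "real \<Rightarrow> complex"
  assumes "integrable lborel h"
  shows "integrable lborel (\<lambda>t. exp (- \<i> * of_real (t * x)) * h t)"
proof (rule Bochner_Integration.integrable_bound[OF assms])
  have "(\<lambda>t. exp (- \<i> * complex_of_real (t * x))) \<in> borel_measurable borel"
    by (intro borel_measurable_continuous_onI continuous_intros)
  then show "(\<lambda>t. exp (- \<i> * of_real (t * x)) * h t) \<in> borel_measurable lborel"
    using borel_measurable_integrable[OF assms] by (intro borel_measurable_times) auto
qed (simp add: norm_mult)

lemma fourier_nonneg_limit:
  assumes h: "\<And>n. fourier_nonneg (h n)" and m: "g \<in> borel_measurable lborel"
    and lim: "AE t in lborel. (\<lambda>n. h n t) \<longlonglongrightarrow> g t"
    and b: "\<And>n. AE t in lborel. norm (h n t) \<le> w t" and w: "integrable lborel w"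
  shows "fourier_nonneg g"
  unfolding fourier_nonneg_def
proof (intro conjI allI)
  have hi: "integrable lborel (h n)" for n using h by (simp add: fourier_nonneg_def)
  show "integrable lborel g"
    by (rule integrable_dominated_convergence[where w=w and s=h]) (use m hi lim b w in auto)
  fix x
  have l: "(\<lambda>n. \<integral>t. exp (- \<i> * of_real (t * x)) * h n t \<partial>lborel) \<longlonglongrightarrow>
     (\<integral>t. exp (- \<i> * of_real (t * x)) * g t \<partial>lborel)"
  proof (rule integral_dominated_convergence[where w=w])
    show "(\<lambda>t. exp (- \<i> * of_real (t * x)) * g t) \<in> borel_measurable lborel"
      using borel_measurable_integrable[OF integrable_fourier[OF \<open>integrable lborel g\<close>]] .
    show "(\<lambda>t. exp (- \<i> * of_real (t * x)) * h n t) \<in> borel_measurable lborel" for n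
      using borel_measurable_integrable[OF integrable_fourier[OF hi]] .
    show "AE t in lborel. (\<lambda>n. exp (- \<i> * of_real (t * x)) * h n t) \<longlonglongrightarrow> exp (- \<i> * of_real (t * x)) * g t"
      using lim by eventually_elim (intro tendsto_intros)
    show "AE t in lborel. norm (exp (- \<i> * of_real (t * x)) * h n t) \<le> w t" for n
      using b[of n] by eventually_elim (simp add: norm_mult)
  qed fact
  have n: "(\<integral>t. exp (- \<i> * of_real (t * x)) * h n t \<partial>lborel) \<in> \<real>\<^sub>\<ge>\<^sub>0" for n
    using h unfolding fourier_nonneg_def by blast
  show "(\<integral>t. exp (- \<i> * of_real (t * x)) * g t \<partial>lborel) \<in> \<real>\<^sub>\<ge>\<^sub>0"
    by (rule closed_sequentially[OF closed_nonneg_Reals_complex n l])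
qed

text \<open>The characteristic function of a unit mass at \<open>y\<close>: multiplying by it
  translates the transform.\<close>

lemma pos_mult_shift: "pos_mult (\<lambda>t. exp (\<i> * of_real (t * y)))"
  unfolding pos_mult_def
proof (intro allI impI)
  fix h assume h: "fourier_nonneg h"
  have eq: "exp (- \<i> * of_real (t * x)) * (exp (\<i> * of_real (t * y)) * h t) =
      exp (- \<i> * of_real (t * (x - y))) * h t" for t x
  proof -
    have "- \<i> * complex_of_real (t * x) + \<i> * of_real (t * y) = - \<i> * of_real (t * (x - y))"
      by (simp add: algebra_simps)
    then show ?thesis unfolding mult.assoc[symmetric] exp_add[symmetric] by simp
  qed
  moreover have "integrable lborel (\<lambda>t. exp (\<i> * of_real (t * y)) * h t)"
    using integrable_fourier[of h "- y"] h by (simp add: fourier_nonneg_def)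
  ultimately show "fourier_nonneg (\<lambda>t. exp (\<i> * of_real (t * y)) * h t)"
    using h unfolding fourier_nonneg_def eq by blast
qed

lemma pos_mult_const:
  assumes "c \<ge> 0" shows "pos_mult (\<lambda>t. of_real c)"
  unfolding pos_mult_def fourier_nonneg_def
proof (intro allI impI conjI; elim conjE)
  fix h x assume "\<forall>x. (\<integral>t. exp (- \<i> * of_real (t * x)) * h t \<partial>lborel) \<in> \<real>\<^sub>\<ge>\<^sub>0"
  then have "of_real c * (\<integral>t. exp (- \<i> * of_real (t * x)) * h t \<partial>lborel) \<in> \<real>\<^sub>\<ge>\<^sub>0"
    using assms by (intro nonneg_Reals_mult_I) auto
  also have "of_real c * (\<integral>t. exp (- \<i> * of_real (t * x)) * h t \<partial>lborel) =
      (\<integral>t. exp (- \<i> * of_real (t * x)) * (of_real c * h t) \<partial>lborel)"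
    by (simp add: mult.left_commute flip: integral_mult_right_zero)
  finally show "(\<integral>t. exp (- \<i> * of_real (t * x)) * (of_real c * h t) \<partial>lborel) \<in> \<real>\<^sub>\<ge>\<^sub>0" .
qed auto

lemma pos_mult_mult: "pos_mult K \<Longrightarrow> pos_mult L \<Longrightarrow> pos_mult (\<lambda>t. K t * L t)"
  by (auto simp: pos_mult_def mult.assoc)

lemma pos_mult_power: "pos_mult K \<Longrightarrow> pos_mult (\<lambda>t. K t ^ n)"
  by (induction n) (use pos_mult_const[of 1] in \<open>auto intro: pos_mult_mult\<close>)

lemma pos_mult_add:
  assumes "pos_mult K" "pos_mult L"
  shows "pos_mult (\<lambda>t. K t + L t)"
  unfolding pos_mult_def
proof (intro allI impI)
  fix h assume h: "fourier_nonneg h"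
  note 1 = pos_multD[OF assms(1) h] pos_multD[OF assms(2) h]
  then have i: "integrable lborel (\<lambda>t. K t * h t)" "integrable lborel (\<lambda>t. L t * h t)"
    by (auto simp: fourier_nonneg_def)
  show "fourier_nonneg (\<lambda>t. (K t + L t) * h t)"
    unfolding fourier_nonneg_def
  proof (intro conjI allI)
    show "integrable lborel (\<lambda>t. (K t + L t) * h t)"
      using i by (simp add: distrib_right)
    fix x
    have "(\<integral>t. exp (- \<i> * of_real (t * x)) * ((K t + L t) * h t) \<partial>lborel) =
       (\<integral>t. exp (- \<i> * of_real (t * x)) * (K t * h t) + exp (- \<i> * of_real (t * x)) * (L t * h t) \<partial>lborel)"
      by (simp only: distrib_left distrib_right)
    also have "\<dots> = (\<integral>t. exp (- \<i> * of_real (t * x)) * (K t * h t) \<partial>lborel) +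
        (\<integral>t. exp (- \<i> * of_real (t * x)) * (L t * h t) \<partial>lborel)"
      by (intro Bochner_Integration.integral_add integrable_fourier i)
    also have "\<dots> \<in> \<real>\<^sub>\<ge>\<^sub>0"
      using 1 by (intro nonneg_Reals_add_I) (auto simp: fourier_nonneg_def)
    finally show "(\<integral>t. exp (- \<i> * of_real (t * x)) * ((K t + L t) * h t) \<partial>lborel) \<in> \<real>\<^sub>\<ge>\<^sub>0" .
  qed
qed

lemma pos_mult_sum: "finite I \<Longrightarrow> (\<And>i. i \<in> I \<Longrightarrow> pos_mult (K i)) \<Longrightarrow> pos_mult (\<lambda>t. \<Sum>i\<in>I. K i t)"
  by (induction I rule: finite_induct) (use pos_mult_const[of 0] in \<open>auto intro: pos_mult_add\<close>)

lemma pos_mult_limit: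
  assumes K: "\<And>n. pos_mult (K n)" and m: "L \<in> borel_measurable borel"
    and lim: "AE t in lborel. (\<lambda>n. K n t) \<longlonglongrightarrow> L t"
    and b: "\<And>n t. norm (K n t) \<le> C"
  shows "pos_mult L"
  unfolding pos_mult_def
proof (intro allI impI)
  fix h assume h: "fourier_nonneg h"
  then have hi: "integrable lborel h" by (simp add: fourier_nonneg_def)
  show "fourier_nonneg (\<lambda>t. L t * h t)"
  proof (rule fourier_nonneg_limit[where h="\<lambda>n t. K n t * h t" and w="\<lambda>t. C * norm (h t)"])
    show "fourier_nonneg (\<lambda>t. K n t * h t)" for n by (rule pos_multD[OF K h])
    show "(\<lambda>t. L t * h t) \<in> borel_measurable lborel"
      using m borel_measurable_integrable[OF hi] by (intro borel_measurable_times) auto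
    show "AE t in lborel. (\<lambda>n. K n t * h t) \<longlonglongrightarrow> L t * h t"
      using lim by eventually_elim (intro tendsto_intros)
    show "AE t in lborel. norm (K n t * h t) \<le> C * norm (h t)" for n
      by (intro AE_I2) (simp add: norm_mult b mult_right_mono)
    show "integrable lborel (\<lambda>t. C * norm (h t))" using hi by auto
  qed
qed

text \<open>\<open>K\<close> is the transform of the finite measure with masses \<open>c n\<close>
  at the points \<open>y n\<close>, and \<open>exp K\<close> is the characteristic function of a
  compound Poisson law times exp(\<open>suminf c\<close>). Both are reached by partial sums with a
  uniform bound.\<close>

lemma pos_mult_exp_series:
  fixes c y :: "nat \<Rightarrow> real"
  assumes c: "\<And>n. c n \<ge> 0" "summable c"
    and K: "\<And>t. (\<lambda>n. of_real (c n) * exp (\<i> * of_real (t * y n))) sums K t"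
  shows "pos_mult (\<lambda>t. exp (K t))" "norm (exp (K t)) \<le> exp (suminf c)"
proof -
  have part: "norm (\<Sum>n<N. of_real (c n) * exp (\<i> * of_real (t * y n))) \<le> suminf c" for N t
  proof -
    have "norm (\<Sum>n<N. of_real (c n) * exp (\<i> * of_real (t * y n))) \<le>
        (\<Sum>n<N. norm (of_real (c n) * exp (\<i> * of_real (t * y n))))" by (rule norm_sum)
    also have "\<dots> = (\<Sum>n<N. c n)" using c by (simp add: norm_mult)
    also have "\<dots> \<le> suminf c" using c by (intro sum_le_suminf) auto
    finally show ?thesis .
  qed
  have lim: "(\<lambda>N. \<Sum>n<N. of_real (c n) * exp (\<i> * of_real (t * y n))) \<longlonglongrightarrow> K t" for t
    using K by (simp add: sums_def)
  have Kb: "norm (K t) \<le> suminf c" for t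
    by (rule Lim_norm_ubound[OF _ lim]) (use part in auto)
  have m1: "K \<in> borel_measurable borel"
  proof (rule borel_measurable_LIMSEQ_metric[OF _ lim])
    show "(\<lambda>t. \<Sum>n<N. of_real (c n) * exp (\<i> * of_real (t * y n))) \<in> borel_measurable borel" for N
      by (intro borel_measurable_continuous_onI continuous_intros)
  qed
  have "pos_mult K"
  proof (rule pos_mult_limit[where K="\<lambda>N t. \<Sum>n<N. of_real (c n) * exp (\<i> * of_real (t * y n))",
        OF _ m1 _ part])
    show "pos_mult (\<lambda>t. \<Sum>n<N. of_real (c n) * exp (\<i> * of_real (t * y n)))" for N
      by (intro pos_mult_sum pos_mult_mult pos_mult_const pos_mult_shift c) auto
  qed (use lim in auto)
  show "pos_mult (\<lambda>t. exp (K t))"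
  proof (rule pos_mult_limit[where K="\<lambda>N t. \<Sum>n<N. of_real (1 / fact n) * K t ^ n" and C="exp (suminf c)"])
    show "pos_mult (\<lambda>t. \<Sum>n<N. of_real (1 / fact n) * K t ^ n)" for N
      by (rule pos_mult_sum, simp, rule pos_mult_mult[OF pos_mult_const pos_mult_power[OF \<open>pos_mult K\<close>]]) simp
    show "(\<lambda>t. exp (K t)) \<in> borel_measurable borel"
      by (rule borel_measurable_continuous_on[OF continuous_on_exp[OF continuous_on_id] m1])
    have "(\<lambda>N. \<Sum>n<N. of_real (1 / fact n) * K t ^ n) \<longlonglongrightarrow> exp (K t)" for t
      using exp_converges[of "K t"] by (simp add: sums_def scaleR_conv_of_real divide_inverse)
    then show "AE t in lborel. (\<lambda>N. \<Sum>n<N. of_real (1 / fact n) * K t ^ n) \<longlonglongrightarrow> exp (K t)" by simp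
    show "norm (\<Sum>n<N. of_real (1 / fact n) * K t ^ n) \<le> exp (suminf c)" for N t
    proof -
      have s: "(\<lambda>n. norm (K t) ^ n / fact n) sums exp (norm (K t))"
        using exp_converges[of "norm (K t)"] by (simp add: divide_inverse mult.commute)
      have "norm (\<Sum>n<N. of_real (1 / fact n) * K t ^ n) \<le> (\<Sum>n<N. norm (of_real (1 / fact n) * K t ^ n))"
        by (rule norm_sum)
      also have "\<dots> = (\<Sum>n<N. norm (K t) ^ n / fact n)" by (simp add: norm_mult norm_power norm_divide)
      also have "\<dots> \<le> exp (norm (K t))"
        using sum_le_suminf[OF sums_summable[OF s], of "{..<N}"] sums_unique[OF s] by simp
      also have "\<dots> \<le> exp (suminf c)" using Kb by simp
      finally show ?thesis .
    qed
  qed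
  have "Re (K t) \<le> suminf c" using complex_Re_le_cmod[of "K t"] Kb[of t] by linarith
  then show "norm (exp (K t)) \<le> exp (suminf c)" by simp
qed

section \<open>Binomial weights and the totally skewed laws\<close>

definition bcoef :: "real \<Rightarrow> nat \<Rightarrow> real" where
  "bcoef a n = (- 1) ^ n * (a gchoose n)"

lemma bcoef_0: "bcoef a 0 = 1"
  by (simp add: bcoef_def)

lemma bcoef_Suc: "bcoef a (Suc n) = bcoef a n * (real n - a) / (real n + 1)"
proof -
  have g: "(a gchoose Suc n) = (a gchoose n) * (a - real n) / (real n + 1)"
    by (simp add: gbinomial_prod_rev field_simps)
  show ?thesis unfolding bcoef_def g by (simp add: algebra_simps)
qed

text \<open>The signs decide which exponent can be approximated: in the series of (1 - w)^a all
  coefficients after the zeroth are at most 0 when 0 < a < 1, whereas for 1 < a < 2 the coefficient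
  of w alone is negative (\<open>bcoef_pos\<close>). Hence - (1 - w)^a is taken in the first case
  and + (1 - w)^a in the second.\<close>

lemma bcoef_neg:
  assumes "0 < a" "a < 1"
  shows "bcoef a (Suc n) \<le> 0"
proof (induction n)
  case 0
  then show ?case using assms by (simp add: bcoef_Suc bcoef_0)
next
  case (Suc n)
  have "bcoef a (Suc n) * (real (Suc n) - a) \<le> 0"
    using Suc assms by (intro mult_nonpos_nonneg) auto
  then show ?case unfolding bcoef_Suc[of a "Suc n"] by (simp add: divide_nonpos_pos)
qed

lemma bcoef_pos:
  assumes "1 < a" "a < 2"
  shows "bcoef a (Suc (Suc n)) \<ge> 0"
proof (induction n)
  case 0
  have "bcoef a (Suc (Suc 0)) = a * (a - 1) / 2"
    by (simp add: bcoef_Suc bcoef_0 algebra_simps)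
  moreover have "a * (a - 1) / 2 \<ge> 0" using assms by simp
  ultimately show ?case by simp
next
  case (Suc n)
  have "bcoef a (Suc (Suc n)) * (real (Suc (Suc n)) - a) \<ge> 0"
    using Suc assms by (intro mult_nonneg_nonneg) auto
  then show ?case unfolding bcoef_Suc[of a "Suc (Suc n)"] by simp
qed

lemma bcoef_sums:
  assumes "norm (w::complex) < 1"
  shows "(\<lambda>n. of_real (bcoef a n) * w ^ n) sums (1 - w) powr (of_real a)"
proof -
  have "(\<lambda>n. (of_real a gchoose n) * (- w) ^ n) sums (1 + - w) powr (of_real a)"
    using assms by (intro gen_binomial_complex) simp
  moreover have "(of_real a gchoose n :: complex) = of_real (a gchoose n)" for n
    by (simp add: gbinomial_prod_rev)
  moreover have "(- w) ^ n = (- 1) ^ n * w ^ n" for n by (simp flip: power_mult_distrib)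
  ultimately show ?thesis by (simp add: bcoef_def mult_ac)
qed

lemma bcoef_sums_real:
  assumes "0 \<le> (r::real)" "r < 1"
  shows "(\<lambda>n. bcoef a n * r ^ n) sums (1 - r) powr a"
proof -
  have "(\<lambda>n. of_real (bcoef a n) * complex_of_real r ^ n) sums (1 - complex_of_real r) powr (of_real a)"
    using assms by (intro bcoef_sums) simp
  also have "(1 - complex_of_real r) powr (of_real a) = of_real ((1 - r) powr a)"
    using assms powr_of_real[of "1 - r" a] by simp
  finally have "(\<lambda>n. complex_of_real (bcoef a n * r ^ n)) sums of_real ((1 - r) powr a)" by simp
  then show ?thesis by (simp only: sums_of_real_iff)
qed

lemma sums_tail: "f sums s \<Longrightarrow> (\<lambda>n. f (Suc n)) sums (s - f 0)"
  for f :: "nat \<Rightarrow> 'a::real_normed_vector"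
  using sums_Suc_iff[of f "s - f 0"] by simp

lemma sums_head: "(\<lambda>n. f (Suc n)) sums s \<Longrightarrow> f sums (s + f 0)"
  for f :: "nat \<Rightarrow> 'a::real_normed_vector"
  using sums_Suc_iff[of f s] by simp

text \<open>w^n = r^n exp(i t n e h), so the exponent is a series with masses at the points n e h.
  By \<open>bcoef_neg\<close> the masses for n >= 1 are nonnegative, and the constant term is split
  off as exp(- m). The damping exp(- h^2) puts w strictly inside the disc of convergence; the sign
  of \<open>e\<close> selects the half line that carries the masses.\<close>

lemma pos_mult_binomial_less1:
  fixes a c h e :: real
  assumes a: "0 < a" "a < 1" and c: "c \<ge> 0" and h: "h > 0"
  defines "w \<equiv> \<lambda>t. exp (\<i> * of_real (e * t) * of_real h - (of_real h)\<^sup>2)"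
  shows "pos_mult (\<lambda>t. exp (- of_real (c * h powr (- a)) * (1 - w t) powr (of_real a)))" (is ?A)
    "norm (exp (- of_real (c * h powr (- a)) * (1 - w t) powr (of_real a))) \<le> exp (3 * c)" (is ?B)
proof -
  define r where "r = exp (- (h\<^sup>2))"
  have r: "0 < r" "r < 1" using h by (auto simp: r_def)
  define m where "m = c * h powr (- a)"
  have m: "m \<ge> 0" using c by (simp add: m_def)
  have w: "w t = of_real r * exp (\<i> * of_real (t * (e * h)))" for t
    unfolding w_def r_def exp_of_real[symmetric] exp_add[symmetric] by (simp add: algebra_simps)
  have nw: "norm (w t) < 1" for t using r by (simp add: w norm_mult)
  have wn: "w t ^ n = of_real (r ^ n) * exp (\<i> * of_real (t * (real n * (e * h))))" for t n
    unfolding w power_mult_distrib exp_of_nat_mult[symmetric] by (simp add: algebra_simps)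
  define C where "C = (\<lambda>n. - m * bcoef a (Suc n) * r ^ Suc n)"
  define y where "y = (\<lambda>n. real (Suc n) * (e * h))"
  have C0: "C n \<ge> 0" for n
    using m r bcoef_neg[OF a, of n] by (auto simp: C_def mult_nonneg_nonpos mult_nonpos_nonneg intro!: mult_nonneg_nonpos)
  have "(\<lambda>n. bcoef a (Suc n) * r ^ Suc n) sums ((1 - r) powr a - 1)"
    using sums_tail[OF bcoef_sums_real[of r a]] r by (simp add: bcoef_0)
  from sums_mult[OF this, of "- m"] have Cs: "C sums (- m * ((1 - r) powr a - 1))"
    by (simp add: C_def mult.assoc)
  have K: "(\<lambda>n. of_real (C n) * exp (\<i> * of_real (t * y n))) sums (- of_real m * ((1 - w t) powr (of_real a) - 1))" for t
  proof -
    have "(\<lambda>n. of_real (bcoef a (Suc n)) * w t ^ Suc n) sums ((1 - w t) powr (of_real a) - 1)"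
      using sums_tail[OF bcoef_sums[OF nw[of t], of a]] by (simp add: bcoef_0)
    from sums_mult[OF this, of "- of_real m"] show ?thesis
      unfolding wn by (simp add: C_def y_def mult_ac)
  qed
  have eq: "exp (- of_real m * (1 - w t) powr (of_real a)) =
      of_real (exp (- m)) * exp (- of_real m * ((1 - w t) powr (of_real a) - 1))" for t
    unfolding exp_of_real[symmetric] exp_add[symmetric] by (simp add: algebra_simps)
  show ?A
    unfolding m_def[symmetric] eq
    by (intro pos_mult_mult pos_mult_const pos_mult_exp_series(1)[OF C0 sums_summable[OF Cs] K]) simp
  have "norm (exp (- of_real m * (1 - w t) powr (of_real a))) =
      exp (- m) * norm (exp (- of_real m * ((1 - w t) powr (of_real a) - 1)))"
    unfolding eq norm_mult by simp
  also have "\<dots> \<le> exp (- m) * exp (suminf C)"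
    by (intro mult_left_mono pos_mult_exp_series(2)[OF C0 sums_summable[OF Cs] K]) simp
  also have "\<dots> = exp (- (m * (1 - r) powr a))"
    unfolding sums_unique[OF Cs, symmetric] exp_add[symmetric] by (simp add: algebra_simps)
  \<comment> \<open>Already at most 1; exp(3 c) is the form that the bound takes for a > 1.\<close>
  also have "\<dots> \<le> exp (3 * c)"
  proof -
    have "m * (1 - r) powr a \<ge> 0" using m by simp
    then have "- (m * (1 - r) powr a) \<le> 3 * c" using c by linarith
    then show ?thesis by simp
  qed
  finally show ?B unfolding m_def .
qed

text \<open>Dividing by w shifts the exponents by one: the only negative coefficient, that of w,
  becomes the constant - m a and is split off as a factor, while the constant term becomes a mass at
  - e h. All remaining masses are nonnegative, and the division disappears in the limit because w
  tends to 1.\<close>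

lemma pos_mult_binomial_gt1:
  fixes a c h e :: real
  assumes a: "1 < a" "a < 2" and c: "c \<ge> 0" and h: "h > 0" "h \<le> 1"
  defines "w \<equiv> \<lambda>t. exp (\<i> * of_real (e * t) * of_real h - (of_real h)\<^sup>2)"
  shows "pos_mult (\<lambda>t. exp (of_real (c * h powr (- a)) * (1 - w t) powr (of_real a) / w t))" (is ?A)
    "norm (exp (of_real (c * h powr (- a)) * (1 - w t) powr (of_real a) / w t)) \<le> exp (3 * c)" (is ?B)
proof -
  define r where "r = exp (- (h\<^sup>2))"
  have r: "0 < r" "r < 1" using h by (auto simp: r_def)
  define m where "m = c * h powr (- a)"
  have m: "m \<ge> 0" using c by (simp add: m_def)
  have w: "w t = of_real r * exp (\<i> * of_real (t * (e * h)))" for t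
    unfolding w_def r_def exp_of_real[symmetric] exp_add[symmetric] by (simp add: algebra_simps)
  have w0: "w t \<noteq> 0" for t by (simp add: w_def)
  have nw: "norm (w t) < 1" for t using r by (simp add: w norm_mult)
  have wn: "w t ^ n = of_real (r ^ n) * exp (\<i> * of_real (t * (real n * (e * h))))" for t n
    unfolding w power_mult_distrib exp_of_nat_mult[symmetric] by (simp add: algebra_simps)
  have wi: "1 / w t = of_real (1 / r) * exp (\<i> * of_real (t * (- (e * h))))" for t
    unfolding w using r by (simp add: exp_minus field_simps)
  define C where "C = (\<lambda>n. case n of 0 \<Rightarrow> m / r | Suc n \<Rightarrow> m * bcoef a (Suc (Suc n)) * r ^ Suc n)"
  define y where "y = (\<lambda>n. case n of 0 \<Rightarrow> - (e * h) | Suc n \<Rightarrow> real (Suc n) * (e * h))"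
  have C0: "C n \<ge> 0" for n
    using m r bcoef_pos[OF a] by (auto simp: C_def split: nat.splits)
  have b1: "bcoef a (Suc 0) = - a" by (simp add: bcoef_Suc bcoef_0)
  have "(\<lambda>n. bcoef a (Suc (Suc n)) * r ^ Suc (Suc n)) sums ((1 - r) powr a - 1 + a * r)"
    using sums_tail[OF sums_tail[OF bcoef_sums_real[of r a]]] r by (simp add: bcoef_0 b1)
  from sums_mult[OF this, of "m / r"]
  have "(\<lambda>n. C (Suc n)) sums (m / r * ((1 - r) powr a - 1 + a * r))"
    using r by (simp add: C_def mult_ac)
  from sums_head[of C, OF this]
  have Cs: "C sums (m / r * ((1 - r) powr a - 1 + a * r) + m / r)"
    by (simp add: C_def)
  moreover have "m / r * ((1 - r) powr a - 1 + a * r) + m / r = m * ((1 - r) powr a / r) + m * a"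
    using r by (simp add: field_simps)
  ultimately have Cs': "C sums (m * ((1 - r) powr a / r) + m * a)" by simp
  have K: "(\<lambda>n. of_real (C n) * exp (\<i> * of_real (t * y n))) sums
      (of_real m * ((1 - w t) powr (of_real a) / w t) + of_real (m * a))" for t
  proof -
    have "(\<lambda>n. of_real (bcoef a (Suc (Suc n))) * w t ^ Suc (Suc n)) sums
        ((1 - w t) powr (of_real a) - 1 + of_real a * w t)"
      using sums_tail[OF sums_tail[OF bcoef_sums[OF nw[of t], of a]]] by (simp add: bcoef_0 b1)
    from sums_mult[OF this, of "of_real m / w t"]
    have "(\<lambda>n. of_real (m * bcoef a (Suc (Suc n))) * w t ^ Suc n) sums
        (of_real m / w t * ((1 - w t) powr (of_real a) - 1 + of_real a * w t))"
      using w0 by (simp add: mult_ac)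
    then have "(\<lambda>n. of_real (C (Suc n)) * exp (\<i> * of_real (t * y (Suc n)))) sums
        (of_real m / w t * ((1 - w t) powr (of_real a) - 1 + of_real a * w t))"
      unfolding wn by (simp add: C_def y_def mult_ac)
    from sums_head[of "\<lambda>n. of_real (C n) * exp (\<i> * of_real (t * y n))", OF this]
    have "(\<lambda>n. of_real (C n) * exp (\<i> * of_real (t * y n))) sums
        (of_real m / w t * ((1 - w t) powr (of_real a) - 1 + of_real a * w t) + of_real m * (1 / w t))"
      unfolding wi by (simp add: C_def y_def)
    moreover have "of_real m / w t * ((1 - w t) powr (of_real a) - 1 + of_real a * w t) + of_real m * (1 / w t) =
        of_real m * ((1 - w t) powr (of_real a) / w t) + of_real (m * a)"
      using w0[of t] by (simp add: field_simps)
    ultimately show ?thesis by simp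
  qed
  have eq: "exp (of_real m * (1 - w t) powr (of_real a) / w t) =
      of_real (exp (- (m * a))) * exp (of_real m * ((1 - w t) powr (of_real a) / w t) + of_real (m * a))" for t
    unfolding exp_of_real[symmetric] exp_add[symmetric] by (simp add: algebra_simps)
  show ?A
    unfolding m_def[symmetric] eq
    by (intro pos_mult_mult pos_mult_const pos_mult_exp_series(1)[OF C0 sums_summable[OF Cs] K]) simp
  have "norm (exp (of_real m * (1 - w t) powr (of_real a) / w t)) =
      exp (- (m * a)) * norm (exp (of_real m * ((1 - w t) powr (of_real a) / w t) + of_real (m * a)))"
    unfolding eq norm_mult by simp
  also have "\<dots> \<le> exp (- (m * a)) * exp (suminf C)"
    by (intro mult_left_mono pos_mult_exp_series(2)[OF C0 sums_summable[OF Cs] K]) simp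
  also have "\<dots> = exp (m * ((1 - r) powr a / r))"
    unfolding sums_unique[OF Cs', symmetric] exp_add[symmetric] by simp
  also have "\<dots> \<le> exp (3 * c)"
  proof -
    \<comment> \<open>1 - r is of order h^2, so h^(- a) (1 - r)^a <= h^a <= 1, and 1 / r <= exp 1 <=
      3. This is where the constant 3 c comes from, and it is uniform in h.\<close>
    have "1 - r \<le> h\<^sup>2" using exp_ge_add_one_self[of "- (h\<^sup>2)"] by (simp add: r_def)
    then have "(1 - r) powr a \<le> (h\<^sup>2) powr a" using r a by (intro powr_mono2) auto
    also have "(h\<^sup>2) powr a = h powr a * h powr a"
      using h by (simp add: powr_mult power2_eq_square)
    finally have "h powr (- a) * (1 - r) powr a \<le> h powr (- a) * (h powr a * h powr a)"
      by (intro mult_left_mono) auto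
    also have "\<dots> = h powr a" using h by (simp add: powr_minus)
    also have "\<dots> \<le> 1" using h a by (intro powr_le1) auto
    finally have 1: "h powr (- a) * (1 - r) powr a \<le> 1" .
    have "1 / r = exp (h\<^sup>2)" by (simp add: r_def exp_minus field_simps)
    also have "\<dots> \<le> exp 1" using h by (simp add: power_le_one)
    also have "\<dots> \<le> 3" by (rule exp_le)
    finally have 2: "1 / r \<le> 3" .
    have "m * ((1 - r) powr a / r) = c * ((h powr (- a) * (1 - r) powr a) * (1 / r))"
      by (simp add: m_def)
    also have "\<dots> \<le> c * (1 * 3)"
      using 1 2 c r by (intro mult_left_mono mult_mono) auto
    finally show ?thesis by simp
  qed
  finally show ?B unfolding m_def .
qed

lemma powr_imag:
  assumes "s \<noteq> 0"
  shows "(- \<i> * complex_of_real s) powr (of_real a) =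
    Complex (\<bar>s\<bar> powr a * cos (pi * a / 2)) (- (sgn s * (\<bar>s\<bar> powr a * sin (pi * a / 2))))"
proof -
  have pi': "- (pi / 2) \<le> pi" using pi_gt_zero by linarith
  have "Ln (- \<i> * complex_of_real s) = Complex (ln \<bar>s\<bar>) (- (sgn s * (pi / 2)))"
  proof (rule Ln_unique)
    show "exp (Complex (ln \<bar>s\<bar>) (- (sgn s * (pi / 2)))) = - \<i> * complex_of_real s"
      using assms by (cases "s > 0") (auto simp: complex_eq_iff Re_exp Im_exp)
  qed (use assms pi' in \<open>auto simp: sgn_if\<close>)
  then have "(- \<i> * complex_of_real s) powr (of_real a) = exp (of_real a * Complex (ln \<bar>s\<bar>) (- (sgn s * (pi / 2))))"
    using assms by (simp add: powr_def)
  then show ?thesis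
    using assms by (cases "s > 0") (auto simp: complex_eq_iff Re_exp Im_exp powr_def algebra_simps)
qed

text \<open>(1 - w) / h is a negative difference quotient at 0 with limit - i e t; the damping h^2
  is of second order and leaves no trace. The limit is imaginary and nonzero, hence off the branch
  cut, so the power is continuous there.\<close>

lemma binomial_quotient_limit:
  assumes "t \<noteq> 0" "e \<noteq> 0"
  defines "w \<equiv> \<lambda>n. exp (\<i> * of_real (e * t) * of_real (1 / (real n + 1)) - (of_real (1 / (real n + 1)))\<^sup>2)"
  shows "(\<lambda>n. of_real ((1 / (real n + 1)) powr (- a)) * (1 - w n) powr (of_real a)) \<longlonglongrightarrow>
     (- \<i> * complex_of_real (e * t)) powr (of_real a)" "w \<longlonglongrightarrow> 1"
proof -
  define h where "h = (\<lambda>n. complex_of_real (1 / (real n + 1)))"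
  define W where "W = (\<lambda>x::complex. exp (\<i> * of_real (e * t) * x - x\<^sup>2))"
  have wW: "w n = W (h n)" for n by (simp add: w_def W_def h_def)
  have "(\<lambda>n. 1 / (real n + 1)) \<longlonglongrightarrow> 0" by real_asymp
  then have "h \<longlonglongrightarrow> of_real 0" unfolding h_def by (rule tendsto_of_real)
  then have h0: "h \<longlonglongrightarrow> 0" by simp
  have hn: "h n \<noteq> 0" for n
  proof -
    have "1 / (real n + 1) \<noteq> 0" by simp
    then show ?thesis unfolding h_def by (simp only: of_real_eq_0_iff not_False_eq_True)
  qed
  have "(W has_field_derivative \<i> * of_real (e * t)) (at 0)"
    unfolding W_def by (auto intro!: derivative_eq_intros)
  then have "((\<lambda>x. (W (0 + x) - W 0) / x) \<longlongrightarrow> \<i> * of_real (e * t)) (at 0)"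
    by (simp add: DERIV_def)
  moreover have "filterlim h (at 0) sequentially"
    using h0 hn by (auto simp: filterlim_at)
  ultimately have "(\<lambda>n. (W (0 + h n) - W 0) / h n) \<longlonglongrightarrow> \<i> * of_real (e * t)"
    by (rule filterlim_compose)
  from tendsto_minus[OF this] have "(\<lambda>n. (1 - w n) / h n) \<longlonglongrightarrow> - \<i> * of_real (e * t)"
    by (simp add: wW W_def minus_divide_left)
  moreover have "- \<i> * complex_of_real (e * t) \<notin> \<real>\<^sub>\<le>\<^sub>0"
    using assms by (auto simp: complex_nonpos_Reals_iff)
  ultimately have "(\<lambda>n. ((1 - w n) / h n) powr (of_real a)) \<longlonglongrightarrow> (- \<i> * complex_of_real (e * t)) powr (of_real a)"
    by (intro tendsto_powr_complex) auto
  moreover have "((1 - w n) / h n) powr (of_real a) = of_real ((1 / (real n + 1)) powr (- a)) * (1 - w n) powr (of_real a)" for n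
  proof -
    have "(1 - w n) / h n = complex_of_real (real n + 1) * (1 - w n)"
      by (simp add: h_def)
    then have "((1 - w n) / h n) powr (of_real a) = complex_of_real (real n + 1) powr (of_real a) * (1 - w n) powr (of_real a)"
      by (simp only:) (rule powr_times_real_left, auto)
    also have "complex_of_real (real n + 1) powr (of_real a) = of_real ((real n + 1) powr a)"
      by (rule powr_of_real) simp
    also have "(real n + 1) powr a = (1 / (real n + 1)) powr (- a)"
      by (simp add: powr_minus powr_divide)
    finally show ?thesis .
  qed
  ultimately show "(\<lambda>n. of_real ((1 / (real n + 1)) powr (- a)) * (1 - w n) powr (of_real a)) \<longlonglongrightarrow>
     (- \<i> * complex_of_real (e * t)) powr (of_real a)" by simp
  have "isCont W 0" unfolding W_def by (intro continuous_intros)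
  then have "(\<lambda>n. W (h n)) \<longlonglongrightarrow> W 0" using h0 by (rule isCont_tendsto_compose)
  then show "w \<longlonglongrightarrow> 1" by (simp add: wW[abs_def] W_def)
qed

lemma powr_imag_measurable: "(\<lambda>t. (- \<i> * complex_of_real (e * t)) powr (of_real a)) \<in> borel_measurable borel"
proof (cases "e = 0")
  case False
  have "continuous_on (- {0}) (\<lambda>t. (- \<i> * complex_of_real (e * t)) powr (of_real a))"
    by (intro continuous_on_powr_complex continuous_intros)
      (use False in \<open>auto simp: complex_nonpos_Reals_iff\<close>)
  then show ?thesis by (rule borel_measurable_continuous_countable_exceptions[rotated]) simp
qed simp

text \<open>The totally skewed laws up to a shift. The sign in front keeps the real part of the
  exponent at most 0, since cos(pi a / 2) changes sign at a = 1.\<close>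

lemma pos_mult_one_sided:
  assumes a: "0 < a" "a < 2" "a \<noteq> 1" and e: "e \<noteq> 0" and c: "c \<ge> 0"
  shows "pos_mult (\<lambda>t. exp (of_real ((if a < 1 then - 1 else 1) * c) * (- \<i> * complex_of_real (e * t)) powr (of_real a)))"
proof -
  define h where "h = (\<lambda>n::nat. 1 / (real n + 1))"
  have h: "h n > 0" "h n \<le> 1" for n by (auto simp: h_def)
  define w where "w = (\<lambda>n t. exp (\<i> * of_real (e * t) * of_real (h n) - (of_real (h n))\<^sup>2))"
  have m: "(\<lambda>t. exp (of_real ((if a < 1 then - 1 else 1) * c) * (- \<i> * complex_of_real (e * t)) powr (of_real a)))
      \<in> borel_measurable borel"
    by (rule borel_measurable_continuous_on[OF continuous_on_exp[OF continuous_on_id]])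
      (intro borel_measurable_times powr_imag_measurable borel_measurable_const)
  have lim: "(\<lambda>n. of_real (h n powr (- a)) * (1 - w n t) powr (of_real a)) \<longlonglongrightarrow>
     (- \<i> * complex_of_real (e * t)) powr (of_real a)" "(\<lambda>n. w n t) \<longlonglongrightarrow> 1" if "t \<noteq> 0" for t
    using binomial_quotient_limit(1)[OF that e, of a] binomial_quotient_limit(2)[OF that e]
    by (simp_all add: h_def w_def)
  show ?thesis
  proof (cases "a < 1")
    case True
    show ?thesis
    proof (rule pos_mult_limit[OF _ m])
      show "pos_mult (\<lambda>t. exp (- of_real (c * h n powr (- a)) * (1 - w n t) powr (of_real a)))" for n
        unfolding w_def by (rule pos_mult_binomial_less1(1)[OF a(1) True c h(1)])
      show "norm (exp (- of_real (c * h n powr (- a)) * (1 - w n t) powr (of_real a))) \<le> exp (3 * c)" for n t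
        unfolding w_def by (rule pos_mult_binomial_less1(2)[OF a(1) True c h(1)])
      show "AE t in lborel. (\<lambda>n. exp (- of_real (c * h n powr (- a)) * (1 - w n t) powr (of_real a))) \<longlonglongrightarrow>
        exp (of_real ((if a < 1 then - 1 else 1) * c) * (- \<i> * complex_of_real (e * t)) powr (of_real a))"
        using AE_lborel_singleton[of 0]
      proof eventually_elim
        case (elim t)
        from tendsto_exp[OF tendsto_mult_left[OF lim(1)[OF elim], of "- of_real c"]]
        show ?case using True by (simp add: mult.assoc)
      qed
    qed
  next
    case False
    then have a1: "1 < a" using a by simp
    show ?thesis
    proof (rule pos_mult_limit[OF _ m])
      show "pos_mult (\<lambda>t. exp (of_real (c * h n powr (- a)) * (1 - w n t) powr (of_real a) / w n t))" for n
        unfolding w_def by (rule pos_mult_binomial_gt1(1)[OF a1 a(2) c h])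
      show "norm (exp (of_real (c * h n powr (- a)) * (1 - w n t) powr (of_real a) / w n t)) \<le> exp (3 * c)" for n t
        unfolding w_def by (rule pos_mult_binomial_gt1(2)[OF a1 a(2) c h])
      show "AE t in lborel. (\<lambda>n. exp (of_real (c * h n powr (- a)) * (1 - w n t) powr (of_real a) / w n t)) \<longlonglongrightarrow>
        exp (of_real ((if a < 1 then - 1 else 1) * c) * (- \<i> * complex_of_real (e * t)) powr (of_real a))"
        using AE_lborel_singleton[of 0]
      proof eventually_elim
        case (elim t)
        have "(\<lambda>n. exp (of_real c * (of_real (h n powr (- a)) * (1 - w n t) powr (of_real a)) / w n t)) \<longlonglongrightarrow>
          exp (of_real c * (- \<i> * complex_of_real (e * t)) powr (of_real a) / 1)"
          by (intro tendsto_intros lim elim) simp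
        then show ?case using False by (simp add: mult.assoc)
      qed
    qed
  qed
qed

text \<open>A stable law is the convolution of two totally skewed ones and a shift. Their weights
  are proportional to 1 + b and 1 - b, and |b| <= 1 makes both nonnegative. The quantity
  \<open>- sg * co\<close> is |cos(pi a / 2)|, and the shift by - b tan(pi a / 2) is the one built
  into the continuous parameterization.\<close>

lemma pos_mult_stabch:
  assumes a: "0 < a" "a < 2" "a \<noteq> 1" and b: "\<bar>b\<bar> \<le> 1"
  shows "pos_mult (stabch a b)"
proof -
  define co where "co = cos (pi * a / 2)"
  define si where "si = sin (pi * a / 2)"
  define sg :: real where "sg = (if a < 1 then - 1 else 1)"
  have co: "- sg * co > 0"
  proof (cases "a < 1")
    case True
    then have "pi * a / 2 < pi / 2" "- (pi / 2) < pi * a / 2" using a pi_gt_zero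
      by (auto simp: less_le_trans[of _ 0])
    then have "co > 0" unfolding co_def by (intro cos_gt_zero_pi) auto
    then show ?thesis using True by (simp add: sg_def)
  next
    case False
    then have "1 < a" using a by simp
    then have "cos (pi - pi * a / 2) > 0"
      using a by (intro cos_gt_zero_pi) (auto simp: field_simps)
    then show ?thesis using False by (simp add: sg_def co_def cos_diff)
  qed
  have tn: "tan (pi * a / 2) = si / co" by (simp add: tan_def si_def co_def)
  have sgq: "sg * sg = 1" by (simp add: sg_def)
  have co0: "co \<noteq> 0" using co by auto
  define p where "p = (1 + b) / (2 * (- sg * co))"
  define q where "q = (1 - b) / (2 * (- sg * co))"
  have dn: "2 * (- sg * co) > 0" using co by linarith
  have pq: "p \<ge> 0" "q \<ge> 0"
    unfolding p_def q_def by (rule divide_nonneg_pos[OF _ dn], use b in simp)+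
  have spq: "sg * p = - (1 + b) / (2 * co)" "sg * q = - (1 - b) / (2 * co)"
    using co0 by (cases "a < 1"; simp add: p_def q_def sg_def field_simps)+
  have "pos_mult (\<lambda>t. exp (of_real (sg * p) * (- \<i> * complex_of_real (1 * t)) powr (of_real a)) *
      (exp (of_real (sg * q) * (- \<i> * complex_of_real (- 1 * t)) powr (of_real a)) *
       exp (\<i> * of_real (t * (- (b * (si / co)))))))"
    unfolding sg_def by (intro pos_mult_mult pos_mult_one_sided a pq pos_mult_shift) auto
  also have "(\<lambda>t. exp (of_real (sg * p) * (- \<i> * complex_of_real (1 * t)) powr (of_real a)) *
      (exp (of_real (sg * q) * (- \<i> * complex_of_real (- 1 * t)) powr (of_real a)) *
       exp (\<i> * of_real (t * (- (b * (si / co))))))) = stabch a b"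
  proof
    fix t :: real
    have ev: "of_real (sg * p) * (- \<i> * complex_of_real (1 * t)) powr (of_real a) +
      (of_real (sg * q) * (- \<i> * complex_of_real (- 1 * t)) powr (of_real a) +
       \<i> * of_real (t * (- (b * (si / co))))) =
      Complex (- (\<bar>t\<bar> powr a)) (b * (si / co) * (sgn t * \<bar>t\<bar> powr a - t))" if "t \<noteq> 0"
    proof -
      have "(- \<i> * complex_of_real (1 * t)) powr (of_real a) = Complex (\<bar>t\<bar> powr a * co) (- (sgn t * (\<bar>t\<bar> powr a * si)))"
        "(- \<i> * complex_of_real (- 1 * t)) powr (of_real a) = Complex (\<bar>t\<bar> powr a * co) (sgn t * (\<bar>t\<bar> powr a * si))"
        using powr_imag[of "1 * t" a] powr_imag[of "- 1 * t" a] that by (simp_all add: co_def si_def sgn_minus)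
      then show ?thesis
        unfolding spq using co0 by (simp add: complex_eq_iff field_simps)
    qed
    have pos: "stabch a b t = exp (Complex (- (\<bar>t\<bar> powr a)) (b * (si / co) * (sgn t * \<bar>t\<bar> powr a - t)))" if t: "t > 0" for t
    proof -
      have "exp (complex_of_real a * Ln (of_real t)) = of_real (t powr a)"
        using t by (simp add: Ln_of_real powr_def flip: exp_of_real)
      then have "stabA 0 (of_real a) (of_real b) (of_real t) =
          of_real (t powr a) + \<i> * of_real (b * (si / co) * (t - t powr a))"
        using t a by (simp add: stabA_def stabeta_tan tn)
      then have "- stabA 0 (of_real a) (of_real b) (of_real t) =
          Complex (- (\<bar>t\<bar> powr a)) (b * (si / co) * (sgn t * \<bar>t\<bar> powr a - t))"
        using t co0 by (simp add: complex_eq_iff field_simps)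
      then show ?thesis using t by (simp add: stabch_pos)
    qed
    have all: "stabch a b t = exp (Complex (- (\<bar>t\<bar> powr a)) (b * (si / co) * (sgn t * \<bar>t\<bar> powr a - t)))" if "t \<noteq> 0"
    proof (cases "t > 0")
      case False
      then have "- t > 0" using that by simp
      from pos[OF this] have "cnj (stabch a b t) =
          exp (Complex (- (\<bar>t\<bar> powr a)) (b * (si / co) * (sgn (- t) * \<bar>t\<bar> powr a + t)))"
        using stabch_uminus[of a b t] by simp
      then have "stabch a b t =
          cnj (exp (Complex (- (\<bar>t\<bar> powr a)) (b * (si / co) * (sgn (- t) * \<bar>t\<bar> powr a + t))))"
        by (metis complex_cnj_cnj)
      also have "\<dots> = exp (cnj (Complex (- (\<bar>t\<bar> powr a)) (b * (si / co) * (sgn (- t) * \<bar>t\<bar> powr a + t))))"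
        by (rule exp_cnj)
      also have "cnj (Complex (- (\<bar>t\<bar> powr a)) (b * (si / co) * (sgn (- t) * \<bar>t\<bar> powr a + t))) =
         Complex (- (\<bar>t\<bar> powr a)) (b * (si / co) * (sgn t * \<bar>t\<bar> powr a - t))"
        using co0 by (simp add: complex_eq_iff sgn_minus field_simps)
      finally show ?thesis .
    qed (use pos in auto)
    show "exp (of_real (sg * p) * (- \<i> * complex_of_real (1 * t)) powr (of_real a)) *
      (exp (of_real (sg * q) * (- \<i> * complex_of_real (- 1 * t)) powr (of_real a)) *
       exp (\<i> * of_real (t * (- (b * (si / co)))))) = stabch a b t"
    proof (cases "t = 0")
      case False
      show ?thesis unfolding exp_add[symmetric] ev[OF False] all[OF False] ..
    qed simp
  qed
  finally show ?thesis .
qed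

section \<open>The Abel factor and its transform\<close>

lemma integral_exp_halfline:
  fixes l :: complex
  assumes "Re l > 0"
  shows "set_integrable lborel {0..} (\<lambda>t. exp (- l * of_real t))"
    "(LINT t:{0..}|lborel. exp (- l * of_real t)) = 1 / l"
proof -
  have l: "l \<noteq> 0" using assms by auto
  have "set_integrable lborel {0..} (\<lambda>t. exp (- (t * Re l)))"
    using integrable_I0i_exp_mscale[OF assms] AE_lborel_singleton[of 0]
    unfolding set_integrable_def
    by (subst integrable_cong_AE[where g="\<lambda>t. indicator {0<..} t *\<^sub>R exp (- (t * Re l))"])
       (auto split: split_indicator elim!: eventually_mono)
  then show i: "set_integrable lborel {0..} (\<lambda>t. exp (- l * of_real t))"
    unfolding set_integrable_def
  proof (rule Bochner_Integration.integrable_bound)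
    show "(\<lambda>t. indicat_real {0..} t *\<^sub>R exp (- l * complex_of_real t)) \<in> borel_measurable lborel"
      using borel_measurable_continuous_on_indicator[of "{0..}" "\<lambda>t. exp (- l * complex_of_real t)"]
      by (simp add: continuous_intros)
  qed (auto simp: indicator_def mult.commute)
  have "((\<lambda>R. LINT t:{0..R}|lborel. exp (- l * of_real t)) \<longlongrightarrow> (LINT t:{0..}|lborel. exp (- l * of_real t))) at_top"
    by (rule tendsto_set_lebesgue_integral_at_top[OF _ i]) auto
  moreover have "\<forall>\<^sub>F R in at_top. (LINT t:{0..R}|lborel. exp (- l * of_real t)) = 1 / l - exp (- l * of_real R) / l"
    using eventually_ge_at_top[of 0]
  proof eventually_elim
    case (elim R)
    have "(LINT t:{0..R}|lborel. exp (- l * of_real t)) = integral {0..R} (\<lambda>t. exp (- l * of_real t))"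
      by (rule set_borel_integral_eq_integral(2)[OF set_integrable_subset[OF i]]) auto
    also have "\<dots> = - exp (- l * of_real R) / l - (- exp (- l * of_real 0) / l)"
    proof (intro integral_unique fundamental_theorem_of_calculus elim)
      fix x assume "x \<in> {0..R}"
      have "((\<lambda>z. - exp (- l * z) / l) has_field_derivative exp (- l * of_real x)) (at (of_real x))"
        using l by (auto intro!: derivative_eq_intros)
      then show "((\<lambda>x. - exp (- l * of_real x) / l) has_vector_derivative exp (- l * of_real x))
          (at x within {0..R})"
        by (rule has_vector_derivative_at_within[OF has_vector_derivative_real_field])
    qed
    finally show ?case by simp
  qed
  ultimately have l1: "((\<lambda>R. 1 / l - exp (- l * of_real R) / l) \<longlongrightarrow> (LINT t:{0..}|lborel. exp (- l * of_real t))) at_top"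
    by (rule Lim_transform_eventually)
  have l2: "((\<lambda>R. 1 / l - exp (- l * of_real R) / l) \<longlongrightarrow> 1 / l - 0 / l) at_top"
  proof (intro tendsto_intros l)
    show "((\<lambda>R. exp (- l * complex_of_real R)) \<longlongrightarrow> 0) at_top"
    proof (rule tendsto_norm_zero_cancel)
      have "((\<lambda>R. exp (- (Re l * R))) \<longlongrightarrow> 0) at_top" using assms by real_asymp
      then show "((\<lambda>R. norm (exp (- l * complex_of_real R))) \<longlongrightarrow> 0) at_top" by simp
    qed
  qed
  show "(LINT t:{0..}|lborel. exp (- l * of_real t)) = 1 / l"
    using tendsto_unique[OF _ l1 l2] by simp
qed

text \<open>The transform of the Abel factor is the Cauchy kernel. Its positivity provides a first
  member of \<open>fourier_nonneg\<close>, and its concentration as d tends to 0 an approximate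
  identity in \<open>fourier_convolution_abel\<close>.\<close>

lemma integral_exp_abs:
  fixes x d :: real
  assumes "d > 0"
  shows "integrable lborel (\<lambda>t. exp (- \<i> * of_real (t * x)) * of_real (exp (- d * \<bar>t\<bar>)))"
    "(\<integral>t. exp (- \<i> * of_real (t * x)) * of_real (exp (- d * \<bar>t\<bar>)) \<partial>lborel) = of_real (2 * d / (d\<^sup>2 + x\<^sup>2))"
proof -
  let ?g = "\<lambda>t. exp (- \<i> * of_real (t * x)) * complex_of_real (exp (- d * \<bar>t\<bar>))"
  let ?l = "Complex d x"
  have herm: "?g (- t) = cnj (?g t)" for t by (simp add: exp_cnj)
  have g: "(\<lambda>t. indicator {0..} t *\<^sub>R ?g t) = (\<lambda>t. indicator {0..} t *\<^sub>R exp (- ?l * of_real t))"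
  proof
    fix t
    have "- \<i> * of_real (t * x) + complex_of_real (- d * t) = - ?l * of_real t"
      by (simp add: complex_eq_iff)
    then have "?g t = exp (- ?l * of_real t)" if "t \<ge> 0"
      using that unfolding exp_of_real[symmetric] exp_add[symmetric] by simp
    then show "indicator {0..} t *\<^sub>R ?g t = indicator {0..} t *\<^sub>R exp (- ?l * of_real t)"
      by (cases "t \<ge> 0") (simp_all only: indicator_simps(2) atLeast_iff not_False_eq_True scaleR_zero_left)
  qed
  have int: "set_integrable lborel {0..} ?g"
    unfolding set_integrable_def g using integral_exp_halfline(1)[of ?l] assms by (simp add: set_integrable_def)
  show "integrable lborel ?g" by (rule integral_hermitian(1)[OF herm int])
  have "(\<integral>t. ?g t \<partial>lborel) = of_real (2 * Re (LINT t:{0..}|lborel. ?g t))"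
    by (rule integral_hermitian(2)[OF herm int])
  also have "(LINT t:{0..}|lborel. ?g t) = 1 / ?l"
    unfolding set_lebesgue_integral_def g using integral_exp_halfline(2)[of ?l] assms
    by (simp add: set_lebesgue_integral_def)
  also have "2 * Re (1 / ?l) = 2 * d / (d\<^sup>2 + x\<^sup>2)" by (simp add: Re_divide)
  finally show "(\<integral>t. ?g t \<partial>lborel) = of_real (2 * d / (d\<^sup>2 + x\<^sup>2))" .
qed

lemma fourier_nonneg_exp_abs:
  assumes "d > 0" shows "fourier_nonneg (\<lambda>t. of_real (exp (- d * \<bar>t\<bar>)))"
  unfolding fourier_nonneg_def integral_exp_abs(2)[OF assms]
  using integral_exp_abs(1)[OF assms, of 0] assms
  by (auto simp only: nonneg_Reals_of_real_iff mult_zero_right of_real_0 exp_zero mult_1_left intro!: divide_nonneg_nonneg) auto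

text \<open>A multiplier says something about itself only once it is applied: here it acts on the
  Abel factor exp(- d |t|), and d tends to 0 under the integrable majorant
  |\<open>stabch\<close>|.\<close>

lemma fourier_nonneg_stabch:
  assumes a: "0 < a" "a < 2" "a \<noteq> 1" and b: "\<bar>b\<bar> \<le> 1"
  shows "fourier_nonneg (stabch a b)"
proof (rule fourier_nonneg_limit)
  show "fourier_nonneg (\<lambda>t. stabch a b t * of_real (exp (- (1 / (real n + 1)) * \<bar>t\<bar>)))" for n
    by (rule pos_multD[OF pos_mult_stabch[OF assms] fourier_nonneg_exp_abs]) simp
  note i = stabch_integrable[OF a(1,2), of b]
  show "stabch a b \<in> borel_measurable lborel" "integrable lborel (\<lambda>t. norm (stabch a b t))"
    using i by auto
  have "(\<lambda>n. stabch a b t * of_real (exp (- (1 / (real n + 1)) * \<bar>t\<bar>))) \<longlonglongrightarrow> stabch a b t" for t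
  proof -
    have "(\<lambda>n. 1 / (real n + 1)) \<longlonglongrightarrow> 0" by real_asymp
    then have "(\<lambda>n. stabch a b t * of_real (exp (- (1 / (real n + 1)) * \<bar>t\<bar>))) \<longlonglongrightarrow>
        stabch a b t * of_real (exp (- 0 * \<bar>t\<bar>))"
      by (intro tendsto_intros)
    then show ?thesis by simp
  qed
  then show "AE t in lborel. (\<lambda>n. stabch a b t * of_real (exp (- (1 / (real n + 1)) * \<bar>t\<bar>))) \<longlonglongrightarrow> stabch a b t"
    by simp
  show "AE t in lborel. norm (stabch a b t * of_real (exp (- (1 / (real n + 1)) * \<bar>t\<bar>))) \<le> norm (stabch a b t)" for n
    by (intro AE_I2) (simp add: norm_mult mult_left_le)
qed

lemma stabG_nonneg:
  assumes a: "0 < a" "a < 2" and b: "\<bar>b\<bar> \<le> 1"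
  shows "stabG 0 0 0 z a b \<ge> 0"
proof -
  have ne: "stabG 0 0 0 z a b \<ge> 0" if a: "0 < a" "a < 2" "a \<noteq> 1" for a
  proof -
    have "(\<integral>t. exp (- \<i> * of_real (t * z)) * stabch a b t \<partial>lborel) \<in> \<real>\<^sub>\<ge>\<^sub>0"
      using fourier_nonneg_stabch[OF a b] unfolding fourier_nonneg_def by blast
    then have "0 \<le> 2 * pi * stabG 0 0 0 z a b"
      unfolding stabch_integral(2)[OF a(1,2)] by (simp only: nonneg_Reals_of_real_iff)
    then show ?thesis using mult_le_cancel_left_pos[of "2 * pi" 0 "stabG 0 0 0 z a b"] by simp
  qed
  show ?thesis
  proof (cases "a = 1")
    case True
    have "(\<lambda>a. stabG 0 0 0 z a b) \<midarrow>1\<rightarrow> stabG 0 0 0 z 1 b"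
      using DERIV_isCont[OF stabG_deriv_a[of 1 0 0 0 z b]] by (simp add: isCont_def)
    moreover have "\<forall>\<^sub>F a in at 1. stabG 0 0 0 z a b \<ge> 0"
      unfolding eventually_at by (intro exI[of _ 1]) (auto simp: dist_real_def intro!: ne)
    ultimately show ?thesis using True tendsto_lowerbound[of _ _ "at (1::real)" 0] by simp
  qed (use ne a in auto)
qed

section \<open>Strict positivity of the density\<close>

definition fourier :: "(real \<Rightarrow> complex) \<Rightarrow> real \<Rightarrow> complex" where
  "fourier g y = (\<integral>t. exp (- \<i> * of_real (t * y)) * g t \<partial>lborel)"

lemma norm_fourier_le: "norm (fourier g y) \<le> (\<integral>t. norm (g t) \<partial>lborel)"
proof -
  have "norm (fourier g y) \<le> (\<integral>t. norm (exp (- \<i> * of_real (t * y)) * g t) \<partial>lborel)"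
    unfolding fourier_def by (rule integral_norm_bound)
  also have "\<dots> = (\<integral>t. norm (g t) \<partial>lborel)"
    unfolding norm_mult norm_exp_i by simp
  finally show ?thesis .
qed

lemma continuous_on_fourier:
  assumes g: "integrable lborel g"
  shows "continuous_on UNIV (fourier g)"
  unfolding fourier_def[abs_def]
proof (rule continuous_on_integral_dominated)
  show "(\<lambda>t. exp (- \<i> * of_real (t * y)) * g t) \<in> borel_measurable lborel" for y
    using integrable_fourier[OF g] by (rule borel_measurable_integrable)
  show "continuous_on UNIV (\<lambda>y. exp (- \<i> * of_real (t * y)) * g t)" for t
    by (intro continuous_intros)
  show "\<exists>U w. open U \<and> y \<in> U \<and> integrable lborel w \<and>
      (\<forall>q\<in>U \<inter> UNIV. \<forall>t\<in>space lborel. norm (exp (- \<i> * of_real (t * q)) * g t) \<le> w t)" for y :: real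
    using g by (intro exI[of _ UNIV] exI[of _ "\<lambda>t. norm (g t)"]) (auto simp: norm_mult)
qed

lemma fourier_measurable:
  "integrable lborel g \<Longrightarrow> fourier g \<in> borel_measurable borel"
  by (rule borel_measurable_continuous_onI[OF continuous_on_fourier])

lemma fourier_mult_integrable:
  assumes g: "integrable lborel g" and h: "integrable lborel h"
  shows "integrable lborel (\<lambda>y. fourier g y * h y)"
proof (rule Bochner_Integration.integrable_bound)
  show "integrable lborel (\<lambda>y. (\<integral>t. norm (g t) \<partial>lborel) * norm (h y))" using h by auto
  show "(\<lambda>y. fourier g y * h y) \<in> borel_measurable lborel"
    using fourier_measurable[OF g] borel_measurable_integrable[OF h] by (intro borel_measurable_times) auto
  show "AE y in lborel. norm (fourier g y * h y) \<le> norm ((\<integral>t. norm (g t) \<partial>lborel) * norm (h y))"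
    using norm_fourier_le by (intro AE_I2) (auto simp: norm_mult abs_mult intro!: mult_mono order_trans[OF norm_fourier_le])
qed

text \<open>Fubini: the exponential is symmetric in its two variables, so the transform can be moved
  from one factor to the other.\<close>

lemma fourier_multiplication:
  assumes g: "integrable lborel g" and h: "integrable lborel h"
  shows "(\<integral>y. fourier g y * h y \<partial>lborel) = (\<integral>t. g t * fourier h t \<partial>lborel)"
proof -
  define F where "F = (\<lambda>y t. exp (- \<i> * complex_of_real (t * y)) * g t * h y)"
  have gm [measurable]: "g \<in> borel_measurable borel" using borel_measurable_integrable[OF g] by simp
  have hm [measurable]: "h \<in> borel_measurable borel" using borel_measurable_integrable[OF h] by simp
  have "(\<lambda>p. exp (- \<i> * complex_of_real (snd p * fst p))) \<in> borel_measurable borel"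
    by (intro borel_measurable_continuous_onI continuous_intros)
  then have em: "(\<lambda>p. exp (- \<i> * complex_of_real (snd p * fst p))) \<in> borel_measurable (lborel \<Otimes>\<^sub>M lborel)"
    by (simp add: lborel_prod)
  have Fm: "case_prod F \<in> borel_measurable (lborel \<Otimes>\<^sub>M lborel)"
    unfolding F_def split_beta' by (intro borel_measurable_times em) measurable
  have nF: "norm (F y t) = norm (g t) * norm (h y)" for y t
    unfolding F_def norm_mult norm_exp_i by simp
  have int: "integrable (lborel \<Otimes>\<^sub>M lborel) (case_prod F)"
  proof (rule lborel_pair.Fubini_integrable[OF Fm])
    show "integrable lborel (\<lambda>y. \<integral>t. norm (case (y, t) of (y, t) \<Rightarrow> F y t) \<partial>lborel)"
      using h by (simp add: nF)
    show "AE y in lborel. integrable lborel (\<lambda>t. case (y, t) of (y, t) \<Rightarrow> F y t)"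
      using integrable_fourier[OF g] by (simp add: F_def)
  qed
  have "(\<integral>y. fourier g y * h y \<partial>lborel) = (\<integral>y. (\<integral>t. F y t \<partial>lborel) \<partial>lborel)"
    by (simp add: fourier_def F_def)
  also have "\<dots> = (\<integral>t. (\<integral>y. F y t \<partial>lborel) \<partial>lborel)"
    by (rule lborel_pair.Fubini_integral[OF int, symmetric])
  also have "\<dots> = (\<integral>t. g t * fourier h t \<partial>lborel)"
  proof (rule Bochner_Integration.integral_cong[OF refl])
    fix t
    have "(\<integral>y. F y t \<partial>lborel) = (\<integral>y. g t * (exp (- \<i> * complex_of_real (y * t)) * h y) \<partial>lborel)"
      by (simp add: F_def mult_ac)
    then show "(\<integral>y. F y t \<partial>lborel) = g t * fourier h t"
      by (simp add: fourier_def)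
  qed
  finally show ?thesis .
qed

text \<open>The transform of f^2 as the convolution of \<open>fourier f\<close> with itself. As
  \<open>fourier f\<close> is not known here to be integrable, the convolution carries an Abel
  factor. With it, \<open>fourier_multiplication\<close> moves the transform onto the remaining
  factor, where the Cauchy kernel acts as an approximate identity of width \<open>d n\<close>, and
  the limit is taken under a majorant proportional to |f|.\<close>

lemma fourier_convolution_abel:
  fixes f :: "real \<Rightarrow> complex"
  assumes f: "integrable lborel f" and fc: "continuous_on UNIV f" and f1: "\<And>t. norm (f t) \<le> 1"
  defines "d \<equiv> \<lambda>n. 1 / (real n + 1)"
  shows "(\<lambda>n. \<integral>y. fourier f y * (fourier f (x - y) * of_real (exp (- d n * \<bar>y\<bar>))) \<partial>lborel) \<longlonglongrightarrow>
    of_real (2 * pi) * (\<integral>t. exp (- \<i> * of_real (t * x)) * (f t)\<^sup>2 \<partial>lborel)"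
proof -
  have d: "d n > 0" for n by (simp add: d_def)
  \<comment> \<open>By t -> - t the function y -> \<open>fourier f (x - y)\<close> is itself a
    transform, that of \<open>g2\<close>, so \<open>fourier_multiplication\<close> can be used a
    second time to compute the transform of \<open>h n\<close>.\<close>
  define g2 where "g2 = (\<lambda>s. exp (\<i> * of_real (s * x)) * f (- s))"
  have g2: "integrable lborel g2"
    using integrable_fourier[of "\<lambda>s. f (- s)" "- x"] lborel_integrable_real_affine[OF f, of "- 1" 0]
    by (simp add: g2_def)
  have fx: "fourier f (x - y) = fourier g2 y" for y
  proof -
    have "fourier f (x - y) = (\<integral>t. exp (- \<i> * of_real ((0 + (- 1) * t) * (x - y))) * f (0 + (- 1) * t) \<partial>lborel)"
      unfolding fourier_def using lborel_integral_real_affine[of "- 1" "\<lambda>t. exp (- \<i> * of_real (t * (x - y))) * f t" 0]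
      by simp
    also have "\<dots> = fourier g2 y"
      unfolding fourier_def
    proof (rule Bochner_Integration.integral_cong[OF refl])
      fix t
      have "- \<i> * complex_of_real ((0 + (- 1) * t) * (x - y)) = - \<i> * of_real (t * y) + \<i> * of_real (t * x)"
        by (simp add: algebra_simps)
      then show "exp (- \<i> * complex_of_real ((0 + (- 1) * t) * (x - y))) * f (0 + (- 1) * t) =
          exp (- \<i> * of_real (t * y)) * g2 t"
        by (simp only: exp_add g2_def mult.assoc) simp
    qed
    finally show ?thesis .
  qed
  define h where "h = (\<lambda>n y. fourier f (x - y) * of_real (exp (- d n * \<bar>y\<bar>)))"
  have ei: "integrable lborel (\<lambda>y. exp (- \<i> * of_real (y * t)) * complex_of_real (exp (- d n * \<bar>y\<bar>)))" for n t
    by (rule integral_exp_abs(1)[OF d])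
  have h: "integrable lborel (h n)" for n
    unfolding h_def fx using fourier_mult_integrable[OF g2, of "\<lambda>y. of_real (exp (- d n * \<bar>y\<bar>))"] ei[of 0 n] by simp
  have hh: "fourier (h n) t = (\<integral>v. exp (\<i> * of_real ((- t + d n * v) * x)) * f (t - d n * v) * of_real (2 / (1 + v\<^sup>2)) \<partial>lborel)" for n t
  proof -
    have "fourier (h n) t = (\<integral>y. fourier g2 y * (exp (- \<i> * of_real (y * t)) * of_real (exp (- d n * \<bar>y\<bar>))) \<partial>lborel)"
      unfolding fourier_def[of "h n"] by (simp add: h_def fx mult_ac)
    also have "\<dots> = (\<integral>s. g2 s * fourier (\<lambda>y. exp (- \<i> * of_real (y * t)) * of_real (exp (- d n * \<bar>y\<bar>))) s \<partial>lborel)"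
      by (rule fourier_multiplication[OF g2 ei])
    also have "(\<lambda>s. fourier (\<lambda>y. exp (- \<i> * of_real (y * t)) * of_real (exp (- d n * \<bar>y\<bar>))) s) =
        (\<lambda>s. of_real (2 * d n / ((d n)\<^sup>2 + (s + t)\<^sup>2)))"
    proof
      fix s
      have "exp (- \<i> * complex_of_real (y * s)) * (exp (- \<i> * of_real (y * t)) * of_real (exp (- d n * \<bar>y\<bar>))) =
          exp (- \<i> * of_real (y * (s + t))) * of_real (exp (- d n * \<bar>y\<bar>))" for y
      proof -
        have "- \<i> * complex_of_real (y * s) + - \<i> * of_real (y * t) = - \<i> * of_real (y * (s + t))"
          by (simp add: algebra_simps)
        then show ?thesis by (simp only: mult.assoc[symmetric] exp_add[symmetric])
      qed
      then show "fourier (\<lambda>y. exp (- \<i> * of_real (y * t)) * of_real (exp (- d n * \<bar>y\<bar>))) s =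
          of_real (2 * d n / ((d n)\<^sup>2 + (s + t)\<^sup>2))"
        unfolding fourier_def by (simp only: integral_exp_abs(2)[OF d])
    qed
    \<comment> \<open>The substitution s = - t + d v rescales the Cauchy kernel to 2 / (1 + v^2),
      which no longer depends on n and serves as majorant.\<close>
    also have "(\<integral>s. g2 s * complex_of_real (2 * d n / ((d n)\<^sup>2 + (s + t)\<^sup>2)) \<partial>lborel) =
        \<bar>d n\<bar> *\<^sub>R (\<integral>v. g2 (- t + d n * v) * of_real (2 * d n / ((d n)\<^sup>2 + (- t + d n * v + t)\<^sup>2)) \<partial>lborel)"
      by (rule lborel_integral_real_affine) (use d[of n] in simp)
    also have "\<dots> = (\<integral>v. \<bar>d n\<bar> *\<^sub>R (g2 (- t + d n * v) * of_real (2 * d n / ((d n)\<^sup>2 + (- t + d n * v + t)\<^sup>2))) \<partial>lborel)"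
      by simp
    also have "\<dots> = (\<integral>v. exp (\<i> * of_real ((- t + d n * v) * x)) * f (t - d n * v) * of_real (2 / (1 + v\<^sup>2)) \<partial>lborel)"
    proof (rule Bochner_Integration.integral_cong[OF refl])
      fix v
      have "(d n)\<^sup>2 + (- t + d n * v + t)\<^sup>2 = (d n)\<^sup>2 * (1 + v\<^sup>2)" by (simp add: algebra_simps power_mult_distrib)
      then have "\<bar>d n\<bar> * (2 * d n / ((d n)\<^sup>2 + (- t + d n * v + t)\<^sup>2)) = 2 / (1 + v\<^sup>2)"
        using d[of n] by (simp add: power2_eq_square)
      then show "\<bar>d n\<bar> *\<^sub>R (g2 (- t + d n * v) * of_real (2 * d n / ((d n)\<^sup>2 + (- t + d n * v + t)\<^sup>2))) =
          exp (\<i> * of_real ((- t + d n * v) * x)) * f (t - d n * v) * of_real (2 / (1 + v\<^sup>2))"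
        unfolding scaleR_conv_of_real mult.left_commute[of "of_real \<bar>d n\<bar>"] of_real_mult[symmetric]
        by (simp add: g2_def)
    qed
    finally show ?thesis .
  qed
  have "(\<integral>v. 2 * (1 / (1 + v\<^sup>2)) \<partial>lborel) = 2 * pi"
    unfolding integral_mult_right_zero integral_inverse_1_plus_square_lborel ..
  then have k: "integrable lborel (\<lambda>v. 2 / (1 + v\<^sup>2) :: real)" "(\<integral>v. 2 / (1 + v\<^sup>2) \<partial>lborel) = 2 * pi"
    using integrable_mult_right[OF integrable_inverse_1_plus_square_lborel, of 2] by simp_all
  have nb: "norm (exp (\<i> * of_real ((- t + d n * v) * x)) * f (t - d n * v) * of_real (2 / (1 + v\<^sup>2))) \<le> 2 / (1 + v\<^sup>2)" for t n v
  proof -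
    have "norm (exp (\<i> * of_real ((- t + d n * v) * x)) * f (t - d n * v) * of_real (2 / (1 + v\<^sup>2))) =
       norm (f (t - d n * v)) * (2 / (1 + v\<^sup>2))"
      unfolding norm_mult norm_exp_i norm_of_real by simp
    also have "\<dots> \<le> 1 * (2 / (1 + v\<^sup>2))" using f1 by (intro mult_right_mono) auto
    finally show ?thesis by simp
  qed
  have cm: "(\<lambda>v. exp (\<i> * complex_of_real ((- t + c * v) * x)) * f (t - c * v) * of_real (2 / (1 + v\<^sup>2))) \<in> borel_measurable lborel" for t c
  proof -
    have "continuous_on UNIV (\<lambda>v. f (t - c * v))"
      by (rule continuous_on_compose2[OF fc]) (auto intro!: continuous_intros)
    then have "continuous_on UNIV (\<lambda>v. exp (\<i> * complex_of_real ((- t + c * v) * x)) * f (t - c * v) * of_real (2 / (1 + v\<^sup>2)))"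
      by (intro continuous_intros) (auto simp: add_nonneg_eq_0_iff)
    then show ?thesis using borel_measurable_continuous_onI by simp
  qed
  have dl: "d \<longlonglongrightarrow> 0" unfolding d_def by real_asymp
  have inner: "(\<lambda>n. fourier (h n) t) \<longlonglongrightarrow> of_real (2 * pi) * (exp (- \<i> * of_real (t * x)) * f t)" for t
  proof -
    have "(\<lambda>n. fourier (h n) t) \<longlonglongrightarrow> (\<integral>v. exp (\<i> * of_real ((- t + 0 * v) * x)) * f (t - 0 * v) * of_real (2 / (1 + v\<^sup>2)) \<partial>lborel)"
      unfolding hh
    proof (rule integral_dominated_convergence[OF cm cm k(1)])
      have "isCont f (t - 0 * v)" for v using fc by (simp add: continuous_on_eq_continuous_at)
      then have "(\<lambda>n. f (t - d n * v)) \<longlonglongrightarrow> f (t - 0 * v)" for v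
        by (rule isCont_tendsto_compose) (intro tendsto_intros dl)
      then have "(\<lambda>n. exp (\<i> * of_real ((- t + d n * v) * x)) * f (t - d n * v) * of_real (2 / (1 + v\<^sup>2))) \<longlonglongrightarrow>
         exp (\<i> * of_real ((- t + 0 * v) * x)) * f (t - 0 * v) * of_real (2 / (1 + v\<^sup>2))" for v
        by (intro tendsto_intros dl)
      then show "AE v in lborel. (\<lambda>n. exp (\<i> * of_real ((- t + d n * v) * x)) * f (t - d n * v) * of_real (2 / (1 + v\<^sup>2))) \<longlonglongrightarrow>
         exp (\<i> * of_real ((- t + 0 * v) * x)) * f (t - 0 * v) * of_real (2 / (1 + v\<^sup>2))" by (intro AE_I2)
      show "AE v in lborel. norm (exp (\<i> * of_real ((- t + d n * v) * x)) * f (t - d n * v) * of_real (2 / (1 + v\<^sup>2))) \<le> 2 / (1 + v\<^sup>2)" for n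
        using nb by (intro AE_I2)
    qed
    also have "(\<integral>v. exp (\<i> * of_real ((- t + 0 * v) * x)) * f (t - 0 * v) * of_real (2 / (1 + v\<^sup>2)) \<partial>lborel) =
       (\<integral>v. exp (- \<i> * of_real (t * x)) * f t * of_real (2 / (1 + v\<^sup>2)) \<partial>lborel)"
      by (rule Bochner_Integration.integral_cong) auto
    also have "\<dots> = exp (- \<i> * of_real (t * x)) * f t * (\<integral>v. complex_of_real (2 / (1 + v\<^sup>2)) \<partial>lborel)"
      by (rule integral_mult_right_zero)
    also have "(\<integral>v. complex_of_real (2 / (1 + v\<^sup>2)) \<partial>lborel) = of_real (2 * pi)"
      using k by (simp only: integral_complex_of_real)
    finally show ?thesis by (simp only: mult_ac)
  qed
  have fb: "norm (fourier (h n) t) \<le> 2 * pi" for n t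
  proof -
    have "norm (fourier (h n) t) \<le> (\<integral>v. norm (exp (\<i> * of_real ((- t + d n * v) * x)) * f (t - d n * v) * complex_of_real (2 / (1 + v\<^sup>2))) \<partial>lborel)"
      unfolding hh by (rule integral_norm_bound)
    also have "\<dots> \<le> (\<integral>v. 2 / (1 + v\<^sup>2) \<partial>lborel)"
      by (rule integral_mono'[OF k(1)]) (use nb in auto)
    finally show ?thesis using k by simp
  qed
  have "(\<lambda>n. \<integral>t. f t * fourier (h n) t \<partial>lborel) \<longlonglongrightarrow>
      (\<integral>t. f t * (of_real (2 * pi) * (exp (- \<i> * of_real (t * x)) * f t)) \<partial>lborel)"
  proof (rule integral_dominated_convergence[where w="\<lambda>t. norm (f t) * (2 * pi)"])
    have fm: "f \<in> borel_measurable lborel" using f by auto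
    then show "(\<lambda>t. f t * fourier (h n) t) \<in> borel_measurable lborel" for n
      using fourier_measurable[OF h] by (intro borel_measurable_times) auto
    have "(\<lambda>t. exp (- \<i> * of_real (t * x)) * f t) \<in> borel_measurable lborel"
      using integrable_fourier[OF f] by (rule borel_measurable_integrable)
    then show "(\<lambda>t. f t * (of_real (2 * pi) * (exp (- \<i> * of_real (t * x)) * f t))) \<in> borel_measurable lborel"
      using fm by (intro borel_measurable_times) auto
    show "integrable lborel (\<lambda>t. norm (f t) * (2 * pi))" using f by auto
    show "AE t in lborel. (\<lambda>n. f t * fourier (h n) t) \<longlonglongrightarrow> f t * (of_real (2 * pi) * (exp (- \<i> * of_real (t * x)) * f t))"
      by (intro AE_I2 tendsto_mult tendsto_const inner)
    show "AE t in lborel. norm (f t * fourier (h n) t) \<le> norm (f t) * (2 * pi)" for n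
      unfolding norm_mult using fb by (intro AE_I2 mult_left_mono) auto
  qed
  also have "(\<integral>t. f t * (of_real (2 * pi) * (exp (- \<i> * of_real (t * x)) * f t)) \<partial>lborel) =
      (\<integral>t. of_real (2 * pi) * (exp (- \<i> * of_real (t * x)) * (f t)\<^sup>2) \<partial>lborel)"
    by (simp only: power2_eq_square mult_ac)
  also have "\<dots> = of_real (2 * pi) * (\<integral>t. exp (- \<i> * of_real (t * x)) * (f t)\<^sup>2 \<partial>lborel)"
    by (rule integral_mult_right_zero)
  also have "(\<lambda>n. \<integral>t. f t * fourier (h n) t \<partial>lborel) = (\<lambda>n. \<integral>y. fourier f y * h n y \<partial>lborel)"
    using fourier_multiplication[OF f h] by simp
  finally show ?thesis unfolding h_def .
qed

text \<open>The skewness term is homogeneous of degree a up to a term linear in s, that is, up to a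
  translation of the law. This is stability at the level of the exponent.\<close>

lemma stabeta_scale:
  assumes a: "0 < a" "a < 2" and "k > 0" "s > 0"
  shows "stabeta 0 (of_real a) (of_real (k * s)) =
    of_real (k powr a) * stabeta 0 (of_real a) (of_real s) + stabeta 0 (of_real a) (of_real k) * of_real s"
proof -
  have E: "exp (complex_of_real a * Ln (of_real u)) = of_real (u powr a)" if "u > 0" for u
    using that by (simp add: Ln_of_real powr_def flip: exp_of_real)
  have ks: "k * s > 0" using assms by simp
  show ?thesis
  proof (cases "a = 1")
    case True
    have "Ln (complex_of_real (k * s)) = of_real (ln k) + of_real (ln s)"
    proof -
      have "ln (k * s) = ln k + ln s" using assms by (simp add: ln_mult)
      then show ?thesis using Ln_of_real[OF ks] by simp
    qed
    then show ?thesis unfolding True of_real_1 stabeta_1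
      using assms by (simp add: Ln_of_real algebra_simps add_divide_distrib)
  next
    case False
    have "(k * s) powr a = k powr a * s powr a" using assms by (simp add: powr_mult)
    moreover have t: "stabeta 0 (of_real a) (of_real u) = of_real (tan (pi * a / 2)) * (of_real u - of_real (u powr a))"
      if "u > 0" for u
      using stabeta_tan[OF a False, of "of_real u"] E[OF that] that by simp
    ultimately show ?thesis
      unfolding t[OF ks] t[OF assms(3)] t[OF assms(4)] by (simp add: algebra_simps)
  qed
qed

text \<open>\<open>k\<close> is chosen with 2 (k t)^a = t^a, so the law is a convolution of two
  copies scaled by \<open>k\<close>; the drift d = b e undoes the linear term of
  \<open>stabeta_scale\<close>.\<close>

lemma stabch_sqrt:
  assumes a: "0 < a" "a < 2"
  defines "k \<equiv> (1 / 2) powr (1 / a)"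
  obtains d where "\<And>t. stabch a b t = (stabch a b (k * t) * exp (\<i> * of_real (d * t)))\<^sup>2"
proof -
  have k: "k > 0" by (simp add: k_def)
  have ka: "k powr a = 1 / 2" using a by (simp add: k_def powr_powr)
  obtain e where e: "stabeta 0 (of_real a) (of_real k) = of_real e"
    using stabeta_real[OF a k] by (auto elim: Reals_cases)
  have pos: "stabch a b t = (stabch a b (k * t) * exp (\<i> * of_real (b * e * t)))\<^sup>2" if t: "t > 0" for t
  proof -
    have E: "exp (complex_of_real a * Ln (of_real u)) = of_real (u powr a)" if "u > 0" for u
      using that by (simp add: Ln_of_real powr_def flip: exp_of_real)
    have kt: "k * t > 0" using k t by simp
    have "2 * (- stabA 0 (of_real a) (of_real b) (of_real (k * t)) + \<i> * of_real (b * e * t)) =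
       - stabA 0 (of_real a) (of_real b) (of_real t)"
      unfolding stabA_def stabeta_scale[OF a k t] E[OF kt] E[OF t] e using k t
      by (simp add: powr_mult ka algebra_simps)
    then have "exp (- stabA 0 (of_real a) (of_real b) (of_real t)) =
        (exp (- stabA 0 (of_real a) (of_real b) (of_real (k * t)) + \<i> * of_real (b * e * t)))\<^sup>2"
      by (metis exp_double)
    then show ?thesis using t kt by (simp only: stabch_pos exp_add)
  qed
  show ?thesis
  proof (rule that[of "b * e"])
    fix t :: real
    consider "t = 0" | "t > 0" | "t < 0" by linarith
    then show "stabch a b t = (stabch a b (k * t) * exp (\<i> * of_real (b * e * t)))\<^sup>2"
    proof cases
      case 3
      then have "- t > 0" by simp
      from pos[OF this] have "cnj (stabch a b t) = (cnj (stabch a b (k * t)) * exp (\<i> * of_real (b * e * - t)))\<^sup>2"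
        using stabch_uminus[of a b t] stabch_uminus[of a b "k * t"] by simp
      then have "cnj (cnj (stabch a b t)) = cnj ((cnj (stabch a b (k * t)) * exp (\<i> * of_real (b * e * - t)))\<^sup>2)"
        by simp
      then show ?thesis by (simp add: exp_cnj)
    qed (use pos in auto)
  qed
qed

lemma continuous_on_stabch:
  assumes a: "0 < a" "a < 2"
  shows "continuous_on UNIV (stabch a b)"
proof -
  have c: "continuous_on {0..} (\<lambda>t. stabf 0 a b (of_real t))"
    by (rule continuous_on_compose2[OF stabf_continuous[OF a]])
      (auto intro!: continuous_intros simp: strip_def complex_eq_iff)
  have "continuous_on {..0} (\<lambda>t. stabf 0 a b (of_real (- t)))"
    by (rule continuous_on_compose2[OF c]) (auto intro!: continuous_intros)
  then have c': "continuous_on {..0} (\<lambda>t. cnj (stabf 0 a b (of_real (- t))))"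
    by (intro continuous_intros)
  have "continuous_on ({0..} \<union> {..0}) (\<lambda>t. if t \<ge> 0 then stabf 0 a b (of_real t) else cnj (stabf 0 a b (of_real (- t))))"
    by (rule continuous_on_If[OF _ _ c c']) (auto simp: stabf_def)
  moreover have "{0..} \<union> {..0} = (UNIV :: real set)" by auto
  ultimately show ?thesis by (simp add: stabch_def[abs_def])
qed

lemma stabG_pos:
  assumes a: "0 < a" "a < 2" and b: "\<bar>b\<bar> < 1"
  shows "stabG 0 0 0 x a b > 0"
proof -
  define k where "k = (1 / 2) powr (1 / a)"
  have k: "k > 0" by (simp add: k_def)
  obtain d where d: "\<And>t. stabch a b t = (stabch a b (k * t) * exp (\<i> * of_real (d * t)))\<^sup>2"
    using stabch_sqrt[OF a] unfolding k_def by metis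
  define f where "f = (\<lambda>t. stabch a b (k * t) * exp (\<i> * of_real (d * t)))"
  define G where "G = (\<lambda>y. 2 * pi * stabG 0 0 0 ((y - d) / k) a b / k)"
  have fint: "integrable lborel f"
    using integrable_fourier[of "\<lambda>t. stabch a b (k * t)" "- d"]
      lborel_integrable_real_affine[OF stabch_integrable[OF a, of b], of k 0] k
    by (simp add: f_def mult.commute)
  have fc: "continuous_on UNIV f"
  proof -
    have "continuous_on UNIV (\<lambda>t. stabch a b (k * t))"
      by (rule continuous_on_compose2[OF continuous_on_stabch[OF a]]) (auto intro!: continuous_intros)
    then show ?thesis unfolding f_def by (intro continuous_intros)
  qed
  have f1: "norm (f t) \<le> 1" for t
    unfolding f_def norm_mult norm_exp_i norm_stabch[OF a] by simp
  have fG: "fourier f y = of_real (G y)" for y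
  proof -
    let ?z = "(y - d) / k"
    have "fourier f y = (\<integral>t. exp (- \<i> * of_real ((0 + k * t) * ?z)) * stabch a b (0 + k * t) \<partial>lborel)"
      unfolding fourier_def
    proof (rule Bochner_Integration.integral_cong[OF refl])
      fix t
      have "- \<i> * complex_of_real (t * y) + \<i> * of_real (d * t) = - \<i> * of_real ((0 + k * t) * ?z)"
        using k by (simp add: field_simps)
      then have "exp (- \<i> * complex_of_real (t * y)) * exp (\<i> * of_real (d * t)) = exp (- \<i> * of_real ((0 + k * t) * ?z))"
        by (simp only: exp_add[symmetric])
      then show "exp (- \<i> * complex_of_real (t * y)) * f t = exp (- \<i> * of_real ((0 + k * t) * ?z)) * stabch a b (0 + k * t)"
      proof -
        assume e: "exp (- \<i> * complex_of_real (t * y)) * exp (\<i> * of_real (d * t)) = exp (- \<i> * of_real ((0 + k * t) * ?z))"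
        have "exp (- \<i> * complex_of_real (t * y)) * f t =
            (exp (- \<i> * complex_of_real (t * y)) * exp (\<i> * of_real (d * t))) * stabch a b (0 + k * t)"
          unfolding f_def add_0 by (simp only: mult_ac)
        then show ?thesis unfolding e .
      qed
    qed
    also have "\<dots> = (\<integral>t. exp (- \<i> * of_real (t * ?z)) * stabch a b t \<partial>lborel) /\<^sub>R k"
      using lborel_integral_real_affine[of k "\<lambda>t. exp (- \<i> * of_real (t * ?z)) * stabch a b t" 0] k by simp
    also have "\<dots> = of_real (G y)"
      unfolding stabch_integral(2)[OF a] G_def by (simp add: scaleR_conv_of_real field_simps)
    finally show ?thesis .
  qed
  have G0: "G y \<ge> 0" for y using stabG_nonneg[OF a] b k by (simp add: G_def)
  have Gc: "continuous_on UNIV G"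
  proof -
    have "continuous_on UNIV (\<lambda>y. Re (fourier f y))"
      by (intro continuous_intros continuous_on_fourier fint)
    then show ?thesis by (simp add: fG)
  qed
  obtain c1 z1 where z1: "c1 > 0" "z1 \<ge> 1" "\<And>z. z \<ge> z1 \<Longrightarrow> stabG 0 0 0 z a b \<ge> c1 * z powr (- (a + 1))"
    using stabG_tail_lower[OF a b] by metis
  obtain c2 z2 where z2: "c2 > 0" "z2 \<ge> 1" "\<And>z. z \<ge> z2 \<Longrightarrow> stabG 0 0 0 z a (- b) \<ge> c2 * z powr (- (a + 1))"
    using stabG_tail_lower[OF a, of "- b"] b by auto
  \<comment> \<open>For y >= A the point y lies in the right tail of \<open>G\<close> and x - y in
    the left one, so both factors are positive; the left tail is the right tail of the reflected
    law.\<close>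
  define A where "A = max (d + k * z1) (x - d + k * z2)"
  have pos: "G y * G (x - y) > 0" if y: "y \<ge> A" for y
  proof -
    have "(y - d) / k \<ge> z1" "- ((x - y - d) / k) \<ge> z2"
      using y k by (auto simp: A_def field_simps)
    then have "stabG 0 0 0 ((y - d) / k) a b > 0" "stabG 0 0 0 (- ((x - y - d) / k)) a (- b) > 0"
      using z1 z2 less_le_trans[OF mult_pos_pos[OF z1(1)] z1(3)] less_le_trans[OF mult_pos_pos[OF z2(1)] z2(3)]
      by auto
    then show ?thesis
      using k stabG_reflect_0[OF a, of "(x - y - d) / k" b] by (simp add: G_def)
  qed
  \<comment> \<open>exp(- |y|) stands in for the Abel factors: \<open>dn n \<le> 1\<close> makes it
    a lower bound for all of them, so the minimum over this interval of length 1 bounds every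
    \<open>I n\<close> from below by the same m.\<close>
  have "continuous_on {A..A+1} (\<lambda>y. G y * G (x - y) * exp (- \<bar>y\<bar>))"
    by (intro continuous_intros continuous_on_subset[OF Gc] continuous_on_compose2[OF Gc]) auto
  then obtain y0 where y0: "y0 \<in> {A..A+1}" "\<And>y. y \<in> {A..A+1} \<Longrightarrow>
      G y0 * G (x - y0) * exp (- \<bar>y0\<bar>) \<le> G y * G (x - y) * exp (- \<bar>y\<bar>)"
    using continuous_attains_inf[of "{A..A+1}"] by force
  define m where "m = G y0 * G (x - y0) * exp (- \<bar>y0\<bar>)"
  have m: "m > 0" using pos[of y0] y0 by (simp add: m_def)
  define dn where "dn = (\<lambda>n. 1 / (real n + 1))"
  define I where "I = (\<lambda>n. \<integral>y. G y * G (x - y) * exp (- dn n * \<bar>y\<bar>) \<partial>lborel)"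
  have lim: "(\<lambda>n. complex_of_real (I n)) \<longlonglongrightarrow> of_real (2 * pi) * of_real (2 * pi * stabG 0 0 0 x a b)"
  proof -
    have "(\<integral>y. fourier f y * (fourier f (x - y) * of_real (exp (- (1 / (real n + 1)) * \<bar>y\<bar>))) \<partial>lborel) = of_real (I n)" for n
      unfolding fG I_def dn_def of_real_mult[symmetric] mult.assoc by (rule integral_complex_of_real)
    moreover have "(\<lambda>t. exp (- \<i> * of_real (t * x)) * (f t)\<^sup>2) = (\<lambda>t. exp (- \<i> * of_real (t * x)) * stabch a b t)"
      unfolding f_def d[symmetric] ..
    ultimately show ?thesis
      using fourier_convolution_abel[OF fint fc f1, of x]
      by (simp only: stabch_integral(2)[OF a])
  qed
  have Im: "I n \<ge> m" for n
  proof -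
    have dn: "dn n > 0" "dn n \<le> 1" by (auto simp: dn_def)
    have "(\<integral>y. indicator {A..A+1} y * m \<partial>lborel) \<le> I n"
      unfolding I_def
    proof (rule integral_mono)
      show "integrable lborel (\<lambda>y. indicator {A..A+1} y * m)"
        by (intro integrable_mult_left integrable_real_indicator) (auto simp: emeasure_lborel_Icc_eq)
      have e: "integrable lborel (\<lambda>y. of_real (exp (- dn n * \<bar>y\<bar>)) :: complex)"
        using integral_exp_abs(1)[OF dn(1), of 0] by simp
      have "integrable lborel (\<lambda>y. G y * G (x - y) * exp (- dn n * \<bar>y\<bar>))"
      proof (rule Bochner_Integration.integrable_bound)
        define M where "M = (\<integral>t. norm (f t) \<partial>lborel)"
        have GM: "\<bar>G y\<bar> \<le> M" for y using norm_fourier_le[of f y] by (simp add: fG M_def)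
        show "integrable lborel (\<lambda>y. M * M * norm (of_real (exp (- dn n * \<bar>y\<bar>)) :: complex))"
          by (rule integrable_mult_right[OF integrable_norm[OF e]])
        have "continuous_on UNIV (\<lambda>y. G y * G (x - y) * exp (- dn n * \<bar>y\<bar>))"
          by (intro continuous_intros Gc continuous_on_compose2[OF Gc]) auto
        then show "(\<lambda>y. G y * G (x - y) * exp (- dn n * \<bar>y\<bar>)) \<in> borel_measurable lborel"
          using borel_measurable_continuous_onI by simp
        have "\<bar>G y * G (x - y)\<bar> \<le> M * M" for y
          unfolding abs_mult using GM by (intro mult_mono) (auto intro: order_trans[OF abs_ge_zero GM])
        then show "AE y in lborel. norm (G y * G (x - y) * exp (- dn n * \<bar>y\<bar>)) \<le>
            norm (M * M * norm (of_real (exp (- dn n * \<bar>y\<bar>)) :: complex))"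
          by (intro AE_I2) (simp add: abs_mult mult_right_mono)
      qed
      then show "integrable lborel (\<lambda>y. G y * G (x - y) * exp (- dn n * \<bar>y\<bar>))" .
      fix y
      show "indicator {A..A+1} y * m \<le> G y * G (x - y) * exp (- dn n * \<bar>y\<bar>)"
      proof (cases "y \<in> {A..A+1}")
        case True
        have "m \<le> G y * G (x - y) * exp (- \<bar>y\<bar>)" using y0(2)[OF True] by (simp add: m_def)
        also have "\<dots> \<le> G y * G (x - y) * exp (- dn n * \<bar>y\<bar>)"
          using dn mult_right_mono[OF dn(2), of "\<bar>y\<bar>"] G0 by (intro mult_left_mono) auto
        finally show ?thesis using True by simp
      qed (use G0 in simp)
    qed
    moreover have "(\<integral>y. indicator {A..A+1} y * m \<partial>lborel) = m" by simp
    ultimately show ?thesis by simp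
  qed
  have "I \<longlonglongrightarrow> 2 * pi * (2 * pi * stabG 0 0 0 x a b)"
    using lim unfolding of_real_mult[symmetric] tendsto_of_real_iff .
  then have "m \<le> 2 * pi * (2 * pi * stabG 0 0 0 x a b)"
    by (rule LIMSEQ_le_const) (use Im in auto)
  then have "0 < (2 * pi * (2 * pi)) * stabG 0 0 0 x a b" using m by simp
  then show ?thesis by (rule zero_less_mult_pos) simp
qed

section \<open>Derivatives of the log-density\<close>

text \<open>
  An entry \<open>(r, k, j, l, p, c)\<close> stands for
  \<open>r * z ^ p * stabG k j l z \<alpha> \<beta> / \<sigma> ^ c\<close> with \<open>z = (x - \<mu>) / \<sigma>\<close>; derivatives of the density in
  \<open>x\<close> and in the parameters are finite sums of such terms.
\<close>
type_synonym term_list = "(real \<times> nat \<times> nat \<times> nat \<times> nat \<times> nat) list"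

definition std_arg :: "real \<Rightarrow> real ^ 4 \<Rightarrow> real" where
  "std_arg x \<theta> = (x - \<theta> $ par_mu) / \<theta> $ par_sigma"

fun term_val :: "real \<times> nat \<times> nat \<times> nat \<times> nat \<times> nat \<Rightarrow> real \<Rightarrow> real ^ 4 \<Rightarrow> real" where
  "term_val (r, k, j, l, p, c) x \<theta> =
    r * (std_arg x \<theta> ^ p * stabG k j l (std_arg x \<theta>) (\<theta> $ par_alpha) (\<theta> $ par_beta) / (\<theta> $ par_sigma) ^ c)"

definition term_sum :: "term_list \<Rightarrow> real \<Rightarrow> real ^ 4 \<Rightarrow> real" where
  "term_sum L x \<theta> = (\<Sum>e\<leftarrow>L. term_val e x \<theta>)"

fun term_terms_dx :: "real \<times> nat \<times> nat \<times> nat \<times> nat \<times> nat \<Rightarrow> term_list" where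
  "term_terms_dx (r, k, j, l, p, c) = [(r * real p, k, j, l, p - 1, Suc c), (r, Suc k, j, l, p, Suc c)]"

text \<open>dz/d\<mu> = - 1 / \<sigma> and dz/d\<sigma> = - z / \<sigma>. In \<sigma> the power of z
  is thus preserved, so the derivatives of z^p and of \<sigma>^(- c) merge into one entry.\<close>

fun term_terms_dp :: "4 \<Rightarrow> real \<times> nat \<times> nat \<times> nat \<times> nat \<times> nat \<Rightarrow> term_list" where
  "term_terms_dp i (r, k, j, l, p, c) =
    (if i = par_mu then [(- r * real p, k, j, l, p - 1, Suc c), (- r, Suc k, j, l, p, Suc c)]
     else if i = par_sigma then [(- r * real (c + p), k, j, l, p, Suc c), (- r, Suc k, j, l, Suc p, Suc c)]
     else if i = par_alpha then [(r, k, Suc j, l, p, c)]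
     else [(r, k, j, Suc l, p, c)])"

definition terms_dx :: "term_list \<Rightarrow> term_list" where "terms_dx L = concat (map term_terms_dx L)"

definition terms_dp :: "4 \<Rightarrow> term_list \<Rightarrow> term_list" where "terms_dp i L = concat (map (term_terms_dp i) L)"

definition density_terms :: term_list where "density_terms = [(1, 0, 0, 0, 0, 1)]"

text \<open>
  The derivatives of \<open>stabG\<close> in \<open>\<alpha>\<close> and \<open>\<beta>\<close> are available up to total order two, which \<open>order_le\<close> keeps
  track of. A list of shape \<open>tail_shape K J\<close> is \<open>O(\<bar>x\<bar> powr (- \<alpha> - 1 - K) * ln \<bar>x\<bar> ^ J)\<close>: a factor \<open>z\<close> is
  compensated by a further derivative in \<open>z\<close>. Entries with \<open>r = 0\<close> are exempt, because
  differentiating \<open>z ^ 0\<close> leaves a zero term with truncated exponent \<open>0 - 1 = 0\<close>.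
\<close>
definition order_le :: "nat \<Rightarrow> term_list \<Rightarrow> bool" where
  "order_le n L \<longleftrightarrow> (\<forall>(r, k, j, l, p, c)\<in>set L. j + l \<le> n)"

definition tail_shape :: "nat \<Rightarrow> nat \<Rightarrow> term_list \<Rightarrow> bool" where
  "tail_shape K J L \<longleftrightarrow> (\<forall>(r, k, j, l, p, c)\<in>set L. r = 0 \<or> k = K + p \<and> j = J)"

text \<open>A derivative in the location gains a power of 1 / |x|, one in \<alpha> costs a
  logarithm, and the other two leave the order of the tail unchanged.\<close>

definition decay_weight :: "4 \<Rightarrow> nat" where "decay_weight i = (if i = par_mu then 1 else 0)"
definition log_weight :: "4 \<Rightarrow> nat" where "log_weight i = (if i = par_alpha then 1 else 0)"

section \<open>Calculus of term lists\<close>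

lemma term_sum_Nil [simp]: "term_sum [] x \<theta> = 0"
  by (simp add: term_sum_def)

lemma term_sum_Cons: "term_sum (e # L) x \<theta> = term_val e x \<theta> + term_sum L x \<theta>"
  by (simp add: term_sum_def)

lemma term_sum_append: "term_sum (L @ M) x \<theta> = term_sum L x \<theta> + term_sum M x \<theta>"
  by (simp add: term_sum_def)

lemma terms_dx_Nil [simp]: "terms_dx [] = []" and terms_dx_Cons: "terms_dx (e # L) = term_terms_dx e @ terms_dx L"
  and terms_dp_Nil [simp]: "terms_dp i [] = []" and terms_dp_Cons: "terms_dp i (e # L) = term_terms_dp i e @ terms_dp i L"
  by (simp_all add: terms_dx_def terms_dp_def)

lemma order_le_density_terms: "order_le 0 density_terms" and tail_shape_density_terms: "tail_shape 0 0 density_terms"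
  by (auto simp: order_le_def tail_shape_def density_terms_def)

lemma order_le_terms_dp: "order_le n L \<Longrightarrow> order_le (Suc n) (terms_dp i L)"
  by (fastforce simp: order_le_def terms_dp_def split: if_splits)

lemma order_le_mono: "order_le n L \<Longrightarrow> n \<le> m \<Longrightarrow> order_le m L"
  by (fastforce simp: order_le_def)

text \<open>In \<mu> either p drops or k rises by one, so k - p grows by one. In \<sigma> both rise
  or neither does, in \<alpha> only j changes, and in \<beta> none of the three.\<close>

lemma tail_shape_terms_dp:
  assumes "tail_shape K J L" shows "tail_shape (K + decay_weight i) (J + log_weight i) (terms_dp i L)"
  unfolding tail_shape_def
proof (intro ballI, clarify)
  fix r k j l p c
  assume a: "(r, k, j, l, p, c) \<in> set (terms_dp i L)" "\<not> (k = K + decay_weight i + p \<and> j = J + log_weight i)"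
  then obtain r' k' j' l' p' c' where *: "(r', k', j', l', p', c') \<in> set L"
    "(r, k, j, l, p, c) \<in> set (term_terms_dp i (r', k', j', l', p', c'))"
    by (auto simp: terms_dp_def simp del: term_terms_dp.simps)
  then have "r' = 0 \<or> k' = K + p' \<and> j' = J" using assms by (auto simp: tail_shape_def)
  \<comment> \<open>For p' = 0 the truncated p' - 1 would break the balance of k and p, but the
    coefficient of that entry is then 0.\<close>
  then show "r = 0" using * a(2)
    by (cases p') (auto simp: decay_weight_def log_weight_def split: if_splits)
qed

lemma open_Theta_int: "open Theta_int"
proof -
  have eq: "Theta_int = {\<theta>. 0 < \<theta> $ par_sigma} \<inter> {\<theta>. 0 < \<theta> $ par_alpha} \<inter> {\<theta>. \<theta> $ par_alpha < 2} \<inter>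
      {\<theta>. - 1 < \<theta> $ par_beta} \<inter> {\<theta>. \<theta> $ par_beta < 1}"
    by (auto simp: Theta_int_def)
  show ?thesis unfolding eq by (intro open_Int open_Collect_less continuous_intros)
qed

definition par_DERIV :: "4 \<Rightarrow> (real ^ 4 \<Rightarrow> real) \<Rightarrow> real ^ 4 \<Rightarrow> real \<Rightarrow> bool" where
  "par_DERIV i F \<theta> D \<longleftrightarrow> ((\<lambda>h. F (\<theta> + h *\<^sub>R axis i 1)) has_real_derivative D) (at 0)"

lemma par_DERIV_D:
  assumes "par_DERIV i F \<theta> D"
  shows "par_differentiable i F \<theta>" "par_deriv i F \<theta> = D"
  using assms real_differentiable_def
  by (auto simp: par_DERIV_def par_differentiable_def par_deriv_def intro: DERIV_imp_deriv)

text \<open>The formula for the density is available on \<open>Theta_int\<close> only; since that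
  set is open, agreement on it suffices to transfer derivatives.\<close>

lemma par_DERIV_cong:
  assumes "par_DERIV i F \<theta> D" "\<theta> \<in> Theta_int" "\<And>\<theta>. \<theta> \<in> Theta_int \<Longrightarrow> F \<theta> = G \<theta>"
  shows "par_DERIV i G \<theta> D"
proof -
  let ?g = "\<lambda>h::real. \<theta> + h *\<^sub>R axis i 1"
  have "open (?g -` Theta_int)"
    by (intro open_vimage open_Theta_int continuous_intros)
  then show ?thesis
    using assms unfolding par_DERIV_def
    by (elim has_field_derivative_transform_within_open) auto
qed

lemma std_arg_deriv_x: "((\<lambda>y. std_arg y \<theta>) has_real_derivative 1 / \<theta> $ par_sigma) (at x)"
  unfolding std_arg_def by (rule DERIV_cdivide) (auto intro!: derivative_eq_intros)

lemma term_val_deriv_x: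
  assumes "\<theta> \<in> Theta_int"
  shows "((\<lambda>y. term_val (r, k, j, l, p, c) y \<theta>) has_real_derivative term_sum (term_terms_dx (r, k, j, l, p, c)) x \<theta>) (at x)"
proof -
  have a: "0 < \<theta> $ par_alpha" "\<theta> $ par_alpha < 2" "\<theta> $ par_sigma \<noteq> 0"
    using assms by (auto simp: Theta_int_def)
  note d = DERIV_chain2[OF stabG_deriv_z[OF a(1,2)] std_arg_deriv_x]
  have "((\<lambda>y. r * (std_arg y \<theta> ^ p * stabG k j l (std_arg y \<theta>) (\<theta> $ par_alpha) (\<theta> $ par_beta) / (\<theta> $ par_sigma) ^ c))
     has_real_derivative r * ((real p * std_arg x \<theta> ^ (p - 1) * (1 / \<theta> $ par_sigma) *
        stabG k j l (std_arg x \<theta>) (\<theta> $ par_alpha) (\<theta> $ par_beta) +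
        stabG (Suc k) j l (std_arg x \<theta>) (\<theta> $ par_alpha) (\<theta> $ par_beta) * (1 / \<theta> $ par_sigma) * std_arg x \<theta> ^ p)
        / (\<theta> $ par_sigma) ^ c)) (at x)"
    by (rule DERIV_cmult DERIV_cdivide DERIV_mult' d std_arg_deriv_x derivative_eq_intros refl
        | simp add: mult_ac)+
  then show ?thesis using a by (simp add: term_sum_Cons field_simps)
qed

lemma term_sum_deriv_x:
  assumes "\<theta> \<in> Theta_int"
  shows "((\<lambda>y. term_sum L y \<theta>) has_real_derivative term_sum (terms_dx L) x \<theta>) (at x)"
proof (induction L)
  case (Cons e L)
  obtain r k j l p c where e: "e = (r, k, j, l, p, c)" by (cases e)
  show ?case
    unfolding term_sum_Cons terms_dx_Cons term_sum_append e by (intro DERIV_add term_val_deriv_x[OF assms] Cons)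
qed simp

lemma term_val_par_DERIV:
  assumes th: "\<theta> \<in> Theta_int" and jl: "j + l \<le> 1"
  shows "par_DERIV i (term_val (r, k, j, l, p, c) x) \<theta> (term_sum (term_terms_dp i (r, k, j, l, p, c)) x \<theta>)"
proof -
  define \<mu> \<sigma> a b where d: "\<mu> = \<theta> $ par_mu" "\<sigma> = \<theta> $ par_sigma" "a = \<theta> $ par_alpha" "b = \<theta> $ par_beta"
  have a: "0 < a" "a < 2" "\<sigma> \<noteq> 0" using th by (auto simp: Theta_int_def d)
  define z where "z = (x - \<mu>) / \<sigma>"
  have sc: "Suc c - 1 = c" by simp
  from exhaust_4[of i] consider "i = par_mu" | "i = par_sigma" | "i = par_alpha" | "i = par_beta" by auto
  then show ?thesis
  proof cases
    case 1
    have zd: "((\<lambda>h. (x - (\<mu> + h)) / \<sigma>) has_real_derivative - 1 / \<sigma>) (at 0)"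
      by (rule DERIV_cdivide) (auto intro!: derivative_eq_intros)
    have zd': "((\<lambda>h. ((x - (\<mu> + h)) / \<sigma>) ^ p) has_real_derivative real p * z ^ (p - 1) * (- 1 / \<sigma>)) (at 0)"
      using DERIV_power[OF zd, of p] by (simp add: z_def mult_ac)
    have gd: "((\<lambda>h. stabG k j l ((x - (\<mu> + h)) / \<sigma>) a b) has_real_derivative stabG (Suc k) j l z a b * (- 1 / \<sigma>)) (at 0)"
      using DERIV_chain2[OF stabG_deriv_z[OF a(1,2)] zd] by (simp add: z_def)
    have f: "(\<lambda>h. term_val (r, k, j, l, p, c) x (\<theta> + h *\<^sub>R axis i 1)) =
        (\<lambda>h. r * (((x - (\<mu> + h)) / \<sigma>) ^ p * stabG k j l ((x - (\<mu> + h)) / \<sigma>) a b / \<sigma> ^ c))"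
      by (simp add: 1 std_arg_def axis_def d)
    have "term_sum (term_terms_dp i (r, k, j, l, p, c)) x \<theta> = r * ((z ^ p * (stabG (Suc k) j l z a b * (- 1 / \<sigma>)) +
        real p * z ^ (p - 1) * (- 1 / \<sigma>) * stabG k j l z a b) / \<sigma> ^ c)"
      using a by (simp add: 1 std_arg_def term_sum_Cons d[symmetric] z_def[symmetric] field_simps)
    then show ?thesis
      unfolding par_DERIV_def f
      using DERIV_cmult[OF DERIV_cdivide[OF DERIV_mult'[OF zd' gd], of "\<sigma> ^ c"], of r]
      by (simp add: z_def)
  next
    case 2
    have sd: "((\<lambda>h. \<sigma> + h) has_real_derivative 1) (at 0)" by (auto intro!: derivative_eq_intros)
    have zd: "((\<lambda>h. (x - \<mu>) / (\<sigma> + h)) has_real_derivative - z / \<sigma>) (at 0)"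
      using a by (auto intro!: derivative_eq_intros simp: z_def field_simps power2_eq_square)
    have zd': "((\<lambda>h. ((x - \<mu>) / (\<sigma> + h)) ^ p) has_real_derivative real p * z ^ (p - 1) * (- z / \<sigma>)) (at 0)"
      using DERIV_power[OF zd, of p] by (simp add: z_def mult_ac)
    \<comment> \<open>Clears the truncated exponent: z^(p - 1) times z is z^p, and for p = 0 both
      sides vanish.\<close>
    have zp: "real p * z ^ (p - 1) * (- z / \<sigma>) = - real p * z ^ p / \<sigma>" using a by (cases p) (auto simp: field_simps)
    have gd: "((\<lambda>h. stabG k j l ((x - \<mu>) / (\<sigma> + h)) a b) has_real_derivative stabG (Suc k) j l z a b * (- z / \<sigma>)) (at 0)"
      using DERIV_chain2[OF stabG_deriv_z[OF a(1,2)] zd] by (simp add: z_def)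
    have cd: "((\<lambda>h. inverse ((\<sigma> + h) ^ c)) has_real_derivative - real c / \<sigma> ^ Suc c) (at 0)"
    proof -
      have "((\<lambda>h. (\<sigma> + h) ^ c) has_real_derivative real c * (1 * \<sigma> ^ (c - 1))) (at 0)"
        using DERIV_power[OF sd, of c] by simp
      from DERIV_inverse_fun[OF this] a
      have "((\<lambda>h. inverse ((\<sigma> + h) ^ c)) has_real_derivative
          - (inverse (\<sigma> ^ c) * (real c * (1 * \<sigma> ^ (c - 1))) * inverse (\<sigma> ^ c))) (at 0)" by (simp add: mult_ac)
      also have "- (inverse (\<sigma> ^ c) * (real c * (1 * \<sigma> ^ (c - 1))) * inverse (\<sigma> ^ c)) = - real c / \<sigma> ^ Suc c"
        using a by (cases c) (auto simp: field_simps)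
      finally show ?thesis .
    qed
    have f: "(\<lambda>h. term_val (r, k, j, l, p, c) x (\<theta> + h *\<^sub>R axis i 1)) =
        (\<lambda>h. r * (((x - \<mu>) / (\<sigma> + h)) ^ p * stabG k j l ((x - \<mu>) / (\<sigma> + h)) a b * inverse ((\<sigma> + h) ^ c)))"
      by (simp add: 2 std_arg_def axis_def d divide_inverse)
    have "term_sum (term_terms_dp i (r, k, j, l, p, c)) x \<theta> = r * (z ^ p * stabG k j l z a b * (- real c / \<sigma> ^ Suc c) +
        (z ^ p * (stabG (Suc k) j l z a b * (- z / \<sigma>)) +
        real p * z ^ (p - 1) * (- z / \<sigma>) * stabG k j l z a b) * inverse (\<sigma> ^ c))"
      unfolding zp
      using a by (simp add: 2 std_arg_def term_sum_Cons d[symmetric] z_def[symmetric] field_simps)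
    then show ?thesis
      unfolding par_DERIV_def f
      using DERIV_cmult[OF DERIV_mult'[OF DERIV_mult'[OF zd' gd] cd], of r]
      by (simp add: z_def)
  next
    case 3
    have "((\<lambda>h. stabG k j l z (a + h) b) has_real_derivative stabG k (Suc j) l z a b * 1) (at 0)"
      by (rule DERIV_chain2[where g="\<lambda>h. a + h"])
        (use stabG_deriv_a[OF a(1,2), of j l k z b] jl in \<open>auto intro!: derivative_eq_intros\<close>)
    from DERIV_cmult[OF DERIV_cdivide[OF DERIV_cmult[OF this, of "z ^ p"], of "\<sigma> ^ c"], of r]
    show ?thesis
      unfolding par_DERIV_def using a
      by (simp add: 3 std_arg_def axis_def term_sum_Cons d[symmetric] z_def[symmetric])
  next
    case 4
    have "((\<lambda>h. stabG k j l z a (b + h)) has_real_derivative stabG k j (Suc l) z a b * 1) (at 0)"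
      by (rule DERIV_chain2[where g="\<lambda>h. b + h"])
        (use stabG_deriv_b[OF a(1,2), of j l k z b] jl in \<open>auto intro!: derivative_eq_intros\<close>)
    from DERIV_cmult[OF DERIV_cdivide[OF DERIV_cmult[OF this, of "z ^ p"], of "\<sigma> ^ c"], of r]
    show ?thesis
      unfolding par_DERIV_def using a
      by (simp add: 4 std_arg_def axis_def term_sum_Cons d[symmetric] z_def[symmetric])
  qed
qed

lemma term_sum_par_DERIV:
  assumes "\<theta> \<in> Theta_int" "order_le 1 L"
  shows "par_DERIV i (term_sum L x) \<theta> (term_sum (terms_dp i L) x \<theta>)"
  using assms(2)
proof (induction L)
  case Nil
  then show ?case by (simp add: par_DERIV_def term_sum_def[abs_def])
next
  case (Cons e L)
  obtain r k j l p c where e: "e = (r, k, j, l, p, c)" by (cases e)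
  have "j + l \<le> 1" "order_le 1 L" using Cons.prems by (auto simp: order_le_def e)
  then show ?case
    using term_val_par_DERIV[OF assms(1), of j l i r k p c x] Cons.IH
    unfolding par_DERIV_def term_sum_Cons terms_dp_Cons term_sum_append e by (intro DERIV_add) auto
qed

lemma continuous_on_term_sum: "continuous_on (UNIV \<times> Theta_int) (\<lambda>(x, \<theta>). term_sum L x \<theta>)"
proof (induction L)
  case Nil
  then show ?case by (simp add: split_beta')
next
  case (Cons e L)
  obtain r k j l p c where e: "e = (r, k, j, l, p, c)" by (cases e)
  have z: "continuous_on (UNIV \<times> Theta_int) (\<lambda>q. std_arg (fst q) (snd q))"
    unfolding std_arg_def by (intro continuous_intros) (auto simp: Theta_int_def)
  have "continuous_on (UNIV \<times> Theta_int)
      (\<lambda>q. (\<lambda>(z, a, b). stabG k j l z a b) (std_arg (fst q) (snd q), snd q $ par_alpha, snd q $ par_beta))"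
    by (rule continuous_on_compose2[OF continuous_on_stabG], intro continuous_intros z)
      (auto simp: Theta_int_def)
  then have "continuous_on (UNIV \<times> Theta_int) (\<lambda>q. term_val e (fst q) (snd q))"
    unfolding e term_val.simps by (intro continuous_intros z) (auto simp: Theta_int_def)
  with Cons show ?case unfolding term_sum_Cons split_beta' by (intro continuous_intros)
qed

section \<open>Tails of the terms and of their quotients\<close>

lemma stabG_tail_abs:
  assumes "0 < a" "a < 2" "j + l \<le> 2"
  obtains C where "C \<ge> 0"
    "\<And>z. \<bar>z\<bar> \<ge> 1 \<Longrightarrow> \<bar>stabG k j l z a b\<bar> \<le> C * (\<bar>z\<bar> powr (- (a + 1)) / \<bar>z\<bar> ^ k * (1 + ln \<bar>z\<bar>) ^ j)"
proof -
  obtain C1 where C1: "C1 \<ge> 0"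
    "\<And>z. z \<ge> 1 \<Longrightarrow> \<bar>stabG k j l z a b\<bar> \<le> C1 * (z powr (- (a + 1)) / z ^ k * (1 + ln z) ^ j)"
    using stabG_tail_upper[OF assms(1,2), of k j l b] by metis
  obtain C2 where C2: "C2 \<ge> 0"
    "\<And>z. z \<ge> 1 \<Longrightarrow> \<bar>stabG k j l z a (- b)\<bar> \<le> C2 * (z powr (- (a + 1)) / z ^ k * (1 + ln z) ^ j)"
    using stabG_tail_upper[OF assms(1,2), of k j l "- b"] by metis
  show ?thesis
  proof (rule that[of "C1 + C2"])
    show "C1 + C2 \<ge> 0" using C1 C2 by simp
    fix z :: real assume z: "\<bar>z\<bar> \<ge> 1"
    define w where "w = \<bar>z\<bar> powr (- (a + 1)) / \<bar>z\<bar> ^ k * (1 + ln \<bar>z\<bar>) ^ j"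
    have w: "w \<ge> 0" using z by (simp add: w_def)
    have "\<bar>stabG k j l z a b\<bar> \<le> C1 * w \<or> \<bar>stabG k j l z a b\<bar> \<le> C2 * w"
    proof (cases "z \<ge> 0")
      case True
      then show ?thesis using C1(2)[of z] z by (simp add: w_def)
    next
      case False
      have "\<bar>stabG k j l z a b\<bar> = \<bar>stabG k j l (- z) a (- b)\<bar>"
        by (subst stabG_reflect[OF assms(3,1,2)]) (simp add: abs_mult)
      then show ?thesis using C2(2)[of "- z"] z False by (simp add: w_def)
    qed
    then show "\<bar>stabG k j l z a b\<bar> \<le> (C1 + C2) * w"
      using w C1(1) C2(1) by (auto simp: distrib_right intro: add_increasing add_increasing2)
  qed
qed

lemma term_sum_tail:
  assumes th: "\<theta> \<in> Theta_int" and "tail_shape K J L" "order_le 2 L"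
  shows "\<exists>C\<ge>0. \<forall>x. \<bar>std_arg x \<theta>\<bar> \<ge> 1 \<longrightarrow> \<bar>term_sum L x \<theta>\<bar> \<le>
    C * (\<bar>std_arg x \<theta>\<bar> powr (- (\<theta> $ par_alpha + 1)) / \<bar>std_arg x \<theta>\<bar> ^ K * (1 + ln \<bar>std_arg x \<theta>\<bar>) ^ J)"
  using assms(2,3)
proof (induction L)
  case Nil
  show ?case by (intro exI[of _ 0]) simp
next
  case (Cons e L)
  obtain r k j l p c where e: "e = (r, k, j, l, p, c)" by (cases e)
  define W where "W = (\<lambda>x. \<bar>std_arg x \<theta>\<bar> powr (- (\<theta> $ par_alpha + 1)) / \<bar>std_arg x \<theta>\<bar> ^ K * (1 + ln \<bar>std_arg x \<theta>\<bar>) ^ J)"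
  have h: "r = 0 \<or> k = K + p \<and> j = J" "j + l \<le> 2" "tail_shape K J L" "order_le 2 L"
    using Cons.prems by (auto simp: tail_shape_def order_le_def e)
  from Cons.IH[OF h(3,4)] obtain C where C: "C \<ge> 0" "\<And>x. \<bar>std_arg x \<theta>\<bar> \<ge> 1 \<Longrightarrow> \<bar>term_sum L x \<theta>\<bar> \<le> C * W x"
    unfolding W_def by blast
  have a: "0 < \<theta> $ par_alpha" "\<theta> $ par_alpha < 2" "0 < \<theta> $ par_sigma"
    using th by (auto simp: Theta_int_def)
  obtain D where D: "D \<ge> 0" "\<And>x. \<bar>std_arg x \<theta>\<bar> \<ge> 1 \<Longrightarrow> \<bar>term_val e x \<theta>\<bar> \<le> D * W x"
  proof (cases "r = 0")
    case True
    show ?thesis by (rule that[of 0]) (simp_all add: e True)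
  next
    case False
    then have kj: "k = K + p" "j = J" using h by auto
    obtain D where D: "D \<ge> 0" "\<And>z. \<bar>z\<bar> \<ge> 1 \<Longrightarrow> \<bar>stabG k j l z (\<theta> $ par_alpha) (\<theta> $ par_beta)\<bar> \<le>
        D * (\<bar>z\<bar> powr (- (\<theta> $ par_alpha + 1)) / \<bar>z\<bar> ^ k * (1 + ln \<bar>z\<bar>) ^ j)"
      using stabG_tail_abs[OF a(1,2) h(2)] by metis
    show ?thesis
    proof (rule that[of "\<bar>r\<bar> / (\<theta> $ par_sigma) ^ c * D"])
      show "\<bar>r\<bar> / (\<theta> $ par_sigma) ^ c * D \<ge> 0" using a D by simp
      fix x assume x: "\<bar>std_arg x \<theta>\<bar> \<ge> 1"
      have "\<bar>term_val e x \<theta>\<bar> = \<bar>r\<bar> / (\<theta> $ par_sigma) ^ c *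
          (\<bar>std_arg x \<theta>\<bar> ^ p * \<bar>stabG k j l (std_arg x \<theta>) (\<theta> $ par_alpha) (\<theta> $ par_beta)\<bar>)"
        using a by (simp add: e abs_mult power_abs)
      also have "\<dots> \<le> \<bar>r\<bar> / (\<theta> $ par_sigma) ^ c * (\<bar>std_arg x \<theta>\<bar> ^ p *
          (D * (\<bar>std_arg x \<theta>\<bar> powr (- (\<theta> $ par_alpha + 1)) / \<bar>std_arg x \<theta>\<bar> ^ k * (1 + ln \<bar>std_arg x \<theta>\<bar>) ^ j)))"
        using D(2)[OF x] a by (intro mult_left_mono) auto
      also have "\<dots> = \<bar>r\<bar> / (\<theta> $ par_sigma) ^ c * D * W x"
      proof -
        have "\<bar>std_arg x \<theta>\<bar> \<noteq> 0" using x by auto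
        then have "\<bar>std_arg x \<theta>\<bar> ^ p * (q / \<bar>std_arg x \<theta>\<bar> ^ (K + p)) = q / \<bar>std_arg x \<theta>\<bar> ^ K" for q
          by (simp add: power_add)
        note e = this[of "\<bar>std_arg x \<theta>\<bar> powr (- (\<theta> $ par_alpha + 1))"]
        have "u * (D * (v * y)) = D * ((u * v) * y)" for u v y :: real by simp
        note m = this[of "\<bar>std_arg x \<theta>\<bar> ^ p" "\<bar>std_arg x \<theta>\<bar> powr (- (\<theta> $ par_alpha + 1)) / \<bar>std_arg x \<theta>\<bar> ^ (K + p)"]
        show ?thesis unfolding W_def kj m e by (simp only: mult.assoc)
      qed
      finally show "\<bar>term_val e x \<theta>\<bar> \<le> \<bar>r\<bar> / (\<theta> $ par_sigma) ^ c * D * W x" .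
    qed
  qed
  show ?case
  proof (intro exI[of _ "D + C"] conjI allI impI)
    fix x assume x: "\<bar>std_arg x \<theta>\<bar> \<ge> 1"
    have "\<bar>term_sum (e # L) x \<theta>\<bar> \<le> \<bar>term_val e x \<theta>\<bar> + \<bar>term_sum L x \<theta>\<bar>" unfolding term_sum_Cons by (rule abs_triangle_ineq)
    also have "\<dots> \<le> D * W x + C * W x" using C(2)[OF x] D(2)[OF x] by simp
    finally show "\<bar>term_sum (e # L) x \<theta>\<bar> \<le> (D + C) *
      (\<bar>std_arg x \<theta>\<bar> powr (- (\<theta> $ par_alpha + 1)) / \<bar>std_arg x \<theta>\<bar> ^ K * (1 + ln \<bar>std_arg x \<theta>\<bar>) ^ J)"
      by (simp only: W_def distrib_right)
  qed (use C D in simp)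
qed

lemma term_sum_density_terms: "term_sum density_terms x \<theta> = stabG 0 0 0 (std_arg x \<theta>) (\<theta> $ par_alpha) (\<theta> $ par_beta) / \<theta> $ par_sigma"
  by (simp add: density_terms_def term_sum_Cons)

lemma stable_density_term_sum: "\<theta> \<in> Theta_int \<Longrightarrow> stable_density x \<theta> = term_sum density_terms x \<theta>"
  by (simp add: stable_density_eq term_sum_density_terms std_arg_def)

lemma term_sum_density_terms_pos: "\<theta> \<in> Theta_int \<Longrightarrow> term_sum density_terms x \<theta> > 0"
  unfolding term_sum_density_terms by (intro divide_pos_pos stabG_pos) (auto simp: Theta_int_def)

lemma term_sum_density_terms_lower:
  assumes th: "\<theta> \<in> Theta_int"
  obtains c z0 where "c > 0" "z0 \<ge> 1" "\<And>x. \<bar>std_arg x \<theta>\<bar> \<ge> z0 \<Longrightarrow> term_sum density_terms x \<theta> \<ge> c * \<bar>std_arg x \<theta>\<bar> powr (- (\<theta> $ par_alpha + 1))"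
proof -
  define a b s where d: "a = \<theta> $ par_alpha" "b = \<theta> $ par_beta" "s = \<theta> $ par_sigma"
  have a: "0 < a" "a < 2" "s > 0" "\<bar>b\<bar> < 1" "\<bar>- b\<bar> < 1" using th by (auto simp: Theta_int_def d)
  obtain c1 z1 where z1: "c1 > 0" "z1 \<ge> 1" "\<And>z. z \<ge> z1 \<Longrightarrow> stabG 0 0 0 z a b \<ge> c1 * z powr (- (a + 1))"
    using stabG_tail_lower[OF a(1,2,4)] by metis
  obtain c2 z2 where z2: "c2 > 0" "z2 \<ge> 1" "\<And>z. z \<ge> z2 \<Longrightarrow> stabG 0 0 0 z a (- b) \<ge> c2 * z powr (- (a + 1))"
    using stabG_tail_lower[OF a(1,2,5)] by metis
  show ?thesis
  proof (rule that[of "min c1 c2 / s" "max z1 z2"])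
    show "min c1 c2 / s > 0" "max z1 z2 \<ge> 1" using z1 z2 a by auto
    fix x assume x: "\<bar>std_arg x \<theta>\<bar> \<ge> max z1 z2"
    define z where "z = std_arg x \<theta>"
    have "stabG 0 0 0 z a b \<ge> min c1 c2 * \<bar>z\<bar> powr (- (a + 1))"
    proof (cases "z \<ge> 0")
      case True
      have "min c1 c2 * \<bar>z\<bar> powr (- (a + 1)) \<le> c1 * \<bar>z\<bar> powr (- (a + 1))" by (intro mult_right_mono) auto
      also have "\<dots> \<le> stabG 0 0 0 z a b" using z1(3)[of z] x True by (simp add: z_def)
      finally show ?thesis .
    next
      case False
      have "min c1 c2 * \<bar>z\<bar> powr (- (a + 1)) \<le> c2 * \<bar>z\<bar> powr (- (a + 1))" by (intro mult_right_mono) auto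
      also have "\<dots> \<le> stabG 0 0 0 (- z) a (- b)" using z2(3)[of "- z"] x False by (simp add: z_def)
      also have "\<dots> = stabG 0 0 0 z a b" by (rule stabG_reflect_0[OF a(1,2), symmetric])
      finally show ?thesis .
    qed
    then have "stabG 0 0 0 z a b / s \<ge> min c1 c2 * \<bar>z\<bar> powr (- (a + 1)) / s"
      using a by (intro divide_right_mono) auto
    then show "term_sum density_terms x \<theta> \<ge> min c1 c2 / s * \<bar>std_arg x \<theta>\<bar> powr (- (\<theta> $ par_alpha + 1))"
      unfolding term_sum_density_terms d[symmetric] z_def[symmetric] by simp
  qed
qed

lemma std_arg_log_bound:
  assumes th: "\<theta> \<in> Theta_int"
  obtains C X where "C \<ge> 1" "X \<ge> 3"
    "\<And>x. \<bar>x\<bar> \<ge> X \<Longrightarrow> \<bar>std_arg x \<theta>\<bar> \<ge> z0 \<and> 1 / \<bar>std_arg x \<theta>\<bar> \<le> C * inverse \<bar>x\<bar> \<and> 1 + ln \<bar>std_arg x \<theta>\<bar> \<le> C * ln \<bar>x\<bar>"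
proof -
  define m s where d: "m = \<theta> $ par_mu" "s = \<theta> $ par_sigma"
  have s: "s > 0" using th by (auto simp: Theta_int_def d)
  \<comment> \<open>The entry 2 |m| gives |x| / 2 <= |x - m| <= 2 |x|, then 2 s |z0| brings |z|
    above z0, and 3 > e makes ln |x| >= 1, so that constants are absorbed by the logarithm.\<close>
  define X where "X = Max {3, 2 * \<bar>m\<bar>, 2 * s * \<bar>z0\<bar>, 2 * s}"
  have X: "X \<ge> 3" "X \<ge> 2 * \<bar>m\<bar>" "X \<ge> 2 * s * \<bar>z0\<bar>" "X \<ge> 2 * s" by (auto simp: X_def)
  define C where "C = Max {1, 2 * s, 2 + \<bar>ln (2 / s)\<bar>}"
  have C: "C \<ge> 1" "C \<ge> 2 * s" "C \<ge> 2 + \<bar>ln (2 / s)\<bar>" by (auto simp: C_def)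
  show ?thesis
  proof (rule that[OF C(1) X(1)])
    fix x assume x: "\<bar>x\<bar> \<ge> X"
    have z: "\<bar>std_arg x \<theta>\<bar> = \<bar>x - m\<bar> / s" using s by (simp add: std_arg_def d abs_divide)
    have lo: "\<bar>x - m\<bar> \<ge> \<bar>x\<bar> / 2" and hi: "\<bar>x - m\<bar> \<le> 2 * \<bar>x\<bar>" using x X by linarith+
    have x3: "\<bar>x\<bar> \<ge> 3" using x X by linarith
    have 1: "\<bar>x\<bar> / (2 * s) \<le> \<bar>std_arg x \<theta>\<bar>" unfolding z using lo s by (simp add: field_simps)
    have pos: "\<bar>x\<bar> / (2 * s) > 0" using x3 s by (intro divide_pos_pos) linarith+
    note zp = less_le_trans[OF pos 1]
    have "z0 \<le> \<bar>x\<bar> / (2 * s)"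
    proof -
      have "2 * s * z0 \<le> 2 * s * \<bar>z0\<bar>" using s by (intro mult_left_mono) auto
      then have "z0 * (2 * s) \<le> \<bar>x\<bar>" using X x by (simp add: mult_ac)
      then show ?thesis using s by (simp add: pos_le_divide_eq)
    qed
    moreover have "1 / \<bar>std_arg x \<theta>\<bar> \<le> C * inverse \<bar>x\<bar>"
    proof -
      have "1 / \<bar>std_arg x \<theta>\<bar> \<le> 1 / (\<bar>x\<bar> / (2 * s))"
        using 1 pos by (intro frac_le) auto
      also have "\<dots> = 2 * s * inverse \<bar>x\<bar>" using x3 by (auto simp: field_simps)
      also have "\<dots> \<le> C * inverse \<bar>x\<bar>" using C by (intro mult_right_mono) auto
      finally show ?thesis .
    qed
    moreover have "1 + ln \<bar>std_arg x \<theta>\<bar> \<le> C * ln \<bar>x\<bar>"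
    proof -
      have "\<bar>std_arg x \<theta>\<bar> \<le> 2 / s * \<bar>x\<bar>" unfolding z using hi s by (simp add: field_simps)
      then have "ln \<bar>std_arg x \<theta>\<bar> \<le> ln (2 / s * \<bar>x\<bar>)" using zp s x3 by (subst ln_le_cancel_iff) auto
      also have "\<dots> = ln (2 / s) + ln \<bar>x\<bar>" using s x3 by (subst ln_mult) auto
      finally have l1: "ln \<bar>std_arg x \<theta>\<bar> \<le> \<bar>ln (2 / s)\<bar> + ln \<bar>x\<bar>" by linarith
      have "exp 1 \<le> \<bar>x\<bar>" using exp_le x3 by linarith
      then have l2: "ln \<bar>x\<bar> \<ge> 1" using x3 by (subst ln_ge_iff) auto
      have "1 + ln \<bar>std_arg x \<theta>\<bar> \<le> 1 * 1 + \<bar>ln (2 / s)\<bar> * 1 + ln \<bar>x\<bar>" using l1 by simp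
      also have "\<dots> \<le> 1 * ln \<bar>x\<bar> + \<bar>ln (2 / s)\<bar> * ln \<bar>x\<bar> + ln \<bar>x\<bar>"
        using l2 by (intro add_mono mult_left_mono) auto
      also have "\<dots> = (2 + \<bar>ln (2 / s)\<bar>) * ln \<bar>x\<bar>" by (simp add: algebra_simps)
      also have "\<dots> \<le> C * ln \<bar>x\<bar>" using C l2 by (intro mult_right_mono) auto
      finally show ?thesis .
    qed
    ultimately show "\<bar>std_arg x \<theta>\<bar> \<ge> z0 \<and> 1 / \<bar>std_arg x \<theta>\<bar> \<le> C * inverse \<bar>x\<bar> \<and> 1 + ln \<bar>std_arg x \<theta>\<bar> \<le> C * ln \<bar>x\<bar>"
      using 1 by linarith
  qed
qed

text \<open>The power |z|^(- \<alpha> - 1) occurs in the upper bound of the numerator and in the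
  lower bound of the density. It cancels, and only the gain in 1 / |x| and the logarithms of the
  shape remain.\<close>

lemma term_sum_ratio_bigo:
  assumes th: "\<theta> \<in> Theta_int" and g: "tail_shape K J L" "order_le 2 L"
  shows "(\<lambda>x. term_sum L x \<theta> / term_sum density_terms x \<theta>) \<in> O[at_infinity](\<lambda>x. inverse \<bar>x\<bar> ^ K * ln \<bar>x\<bar> ^ J)"
proof -
  define a where "a = \<theta> $ par_alpha"
  obtain C where C: "C \<ge> 0" "\<And>x. \<bar>std_arg x \<theta>\<bar> \<ge> 1 \<Longrightarrow> \<bar>term_sum L x \<theta>\<bar> \<le>
    C * (\<bar>std_arg x \<theta>\<bar> powr (- (a + 1)) / \<bar>std_arg x \<theta>\<bar> ^ K * (1 + ln \<bar>std_arg x \<theta>\<bar>) ^ J)"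
    using term_sum_tail[OF assms] unfolding a_def by blast
  obtain c z0 where z0: "c > 0" "z0 \<ge> 1" "\<And>x. \<bar>std_arg x \<theta>\<bar> \<ge> z0 \<Longrightarrow> term_sum density_terms x \<theta> \<ge> c * \<bar>std_arg x \<theta>\<bar> powr (- (a + 1))"
    using term_sum_density_terms_lower[OF th] unfolding a_def by metis
  obtain E X where E: "E \<ge> 1" "X \<ge> 3"
    "\<And>x. \<bar>x\<bar> \<ge> X \<Longrightarrow> \<bar>std_arg x \<theta>\<bar> \<ge> z0 \<and> 1 / \<bar>std_arg x \<theta>\<bar> \<le> E * inverse \<bar>x\<bar> \<and> 1 + ln \<bar>std_arg x \<theta>\<bar> \<le> E * ln \<bar>x\<bar>"
    using std_arg_log_bound[OF th, of z0] by metis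
  have "norm (term_sum L x \<theta> / term_sum density_terms x \<theta>) \<le> (C / c * E ^ K * E ^ J) * norm (inverse \<bar>x\<bar> ^ K * ln \<bar>x\<bar> ^ J)"
    if x: "\<bar>x\<bar> \<ge> X" for x
  proof -
    define z where "z = \<bar>std_arg x \<theta>\<bar>"
    have z: "z \<ge> z0" "1 / z \<le> E * inverse \<bar>x\<bar>" "1 + ln z \<le> E * ln \<bar>x\<bar>" using E(3)[OF x] by (auto simp: z_def)
    have z1: "z \<ge> 1" using z z0 by linarith
    have P: "z powr (- (a + 1)) > 0" using z1 by simp
    have "\<bar>term_sum L x \<theta> / term_sum density_terms x \<theta>\<bar> = \<bar>term_sum L x \<theta>\<bar> / term_sum density_terms x \<theta>"
      using term_sum_density_terms_pos[OF th, of x] by (simp add: abs_divide)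
    also have "\<dots> \<le> (C * (z powr (- (a + 1)) / z ^ K * (1 + ln z) ^ J)) / (c * z powr (- (a + 1)))"
      using C(2)[of x] z0(3)[of x] z z1 z0 P C(1) by (intro frac_le) (auto simp: z_def)
    also have "\<dots> = C / c * ((1 / z) ^ K * (1 + ln z) ^ J)"
      using P z0 by (simp add: power_divide)
    also have "\<dots> \<le> C / c * ((E * inverse \<bar>x\<bar>) ^ K * (E * ln \<bar>x\<bar>) ^ J)"
      using C(1) z0(1) z(2,3) z1 ln_ge_zero[OF z1] order_trans[OF _ z(3), of 0] E(1)
      by (intro mult_left_mono mult_mono power_mono zero_le_power mult_nonneg_nonneg) auto
    also have "\<dots> = (C / c * E ^ K * E ^ J) * (inverse \<bar>x\<bar> ^ K * ln \<bar>x\<bar> ^ J)"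
      by (simp add: power_mult_distrib)
    also have "inverse \<bar>x\<bar> ^ K * ln \<bar>x\<bar> ^ J = norm (inverse \<bar>x\<bar> ^ K * ln \<bar>x\<bar> ^ J)"
      using E(2) x by (simp add: abs_mult power_abs)
    finally show ?thesis by simp
  qed
  then have "\<forall>\<^sub>F x in at_infinity. norm (term_sum L x \<theta> / term_sum density_terms x \<theta>) \<le>
      (C / c * E ^ K * E ^ J) * norm (inverse \<bar>x\<bar> ^ K * ln \<bar>x\<bar> ^ J)"
    unfolding eventually_at_infinity by (intro exI[of _ X]) auto
  then show ?thesis by (rule bigoI)
qed

section \<open>The log-density in terms of the lists\<close>

lemma stable_density_par_DERIV:
  assumes "\<theta> \<in> Theta_int"
  shows "par_DERIV i (stable_density x) \<theta> (term_sum (terms_dp i density_terms) x \<theta>)"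
  by (rule par_DERIV_cong[OF term_sum_par_DERIV[OF assms order_le_mono[OF order_le_density_terms]] assms])
    (auto simp: stable_density_term_sum)

lemma density_par_eq: "\<theta> \<in> Theta_int \<Longrightarrow> density_par i x \<theta> = term_sum (terms_dp i density_terms) x \<theta>"
  unfolding density_par_def by (rule par_DERIV_D(2)[OF stable_density_par_DERIV])

lemma density_par_par_DERIV:
  assumes "\<theta> \<in> Theta_int"
  shows "par_DERIV j (density_par i x) \<theta> (term_sum (terms_dp j (terms_dp i density_terms)) x \<theta>)"
  by (rule par_DERIV_cong[OF term_sum_par_DERIV[OF assms] assms])
    (use order_le_terms_dp[OF order_le_density_terms, of i] density_par_eq in auto)

lemma loglik_par_DERIV:
  assumes th: "\<theta> \<in> Theta_int"
  shows "par_DERIV i (loglik x) \<theta> (term_sum (terms_dp i density_terms) x \<theta> / term_sum density_terms x \<theta>)"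
proof (rule par_DERIV_cong[OF _ th])
  have "((\<lambda>h. term_sum density_terms x (\<theta> + h *\<^sub>R axis i 1)) has_real_derivative term_sum (terms_dp i density_terms) x \<theta>) (at 0)"
    using term_sum_par_DERIV[OF th order_le_mono[OF order_le_density_terms]] by (simp add: par_DERIV_def)
  from DERIV_chain2[OF DERIV_ln this] term_sum_density_terms_pos[OF th, of x]
  show "par_DERIV i (\<lambda>\<theta>. ln (term_sum density_terms x \<theta>)) \<theta> (term_sum (terms_dp i density_terms) x \<theta> / term_sum density_terms x \<theta>)"
    by (simp add: par_DERIV_def divide_inverse mult.commute)
qed (simp add: loglik_def stable_density_term_sum)

lemma loglik_par_eq:
  "\<theta> \<in> Theta_int \<Longrightarrow> loglik_par i x \<theta> = term_sum (terms_dp i density_terms) x \<theta> / term_sum density_terms x \<theta>"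
  unfolding loglik_par_def by (rule par_DERIV_D(2)[OF loglik_par_DERIV])

lemma loglik_par_par_DERIV:
  assumes th: "\<theta> \<in> Theta_int"
  shows "par_DERIV j (loglik_par i x) \<theta>
    ((term_sum (terms_dp j (terms_dp i density_terms)) x \<theta> * term_sum density_terms x \<theta> - term_sum (terms_dp i density_terms) x \<theta> * term_sum (terms_dp j density_terms) x \<theta>)
      / (term_sum density_terms x \<theta>)\<^sup>2)"
proof (rule par_DERIV_cong[OF _ th])
  have 1: "((\<lambda>h. term_sum density_terms x (\<theta> + h *\<^sub>R axis j 1)) has_real_derivative term_sum (terms_dp j density_terms) x \<theta>) (at 0)"
    using term_sum_par_DERIV[OF th order_le_mono[OF order_le_density_terms]] by (simp add: par_DERIV_def)
  have 2: "((\<lambda>h. term_sum (terms_dp i density_terms) x (\<theta> + h *\<^sub>R axis j 1)) has_real_derivative term_sum (terms_dp j (terms_dp i density_terms)) x \<theta>) (at 0)"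
    using term_sum_par_DERIV[OF th, of "terms_dp i density_terms"] order_le_terms_dp[OF order_le_density_terms, of i] by (simp add: par_DERIV_def)
  from DERIV_divide[OF 2 1] term_sum_density_terms_pos[OF th, of x]
  show "par_DERIV j (\<lambda>\<theta>. term_sum (terms_dp i density_terms) x \<theta> / term_sum density_terms x \<theta>) \<theta>
    ((term_sum (terms_dp j (terms_dp i density_terms)) x \<theta> * term_sum density_terms x \<theta> - term_sum (terms_dp i density_terms) x \<theta> * term_sum (terms_dp j density_terms) x \<theta>)
      / (term_sum density_terms x \<theta>)\<^sup>2)"
    by (simp add: par_DERIV_def power2_eq_square)
qed (simp add: loglik_par_eq)

lemma loglik_par_par_eq: "\<theta> \<in> Theta_int \<Longrightarrow> loglik_par_par i j x \<theta> =
    (term_sum (terms_dp j (terms_dp i density_terms)) x \<theta> * term_sum density_terms x \<theta> - term_sum (terms_dp i density_terms) x \<theta> * term_sum (terms_dp j density_terms) x \<theta>)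
      / (term_sum density_terms x \<theta>)\<^sup>2"
  unfolding loglik_par_par_def by (rule par_DERIV_D(2)[OF loglik_par_par_DERIV])

lemma density_deriv_x:
  assumes "\<theta> \<in> Theta_int"
  shows "((\<lambda>y. stable_density y \<theta>) has_real_derivative term_sum (terms_dx density_terms) x \<theta>) (at x)"
    "((\<lambda>y. density_par i y \<theta>) has_real_derivative term_sum (terms_dx (terms_dp i density_terms)) x \<theta>) (at x)"
    "((\<lambda>y. loglik_par i y \<theta>) has_real_derivative
      (term_sum (terms_dx (terms_dp i density_terms)) x \<theta> * term_sum density_terms x \<theta> - term_sum (terms_dp i density_terms) x \<theta> * term_sum (terms_dx density_terms) x \<theta>)
      / (term_sum density_terms x \<theta>)\<^sup>2) (at x)"
  using DERIV_divide[OF term_sum_deriv_x[OF assms, of "terms_dp i density_terms" x] term_sum_deriv_x[OF assms, of density_terms x]]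
    term_sum_density_terms_pos[OF assms, of x]
  by (simp_all add: stable_density_term_sum density_par_eq loglik_par_eq assms term_sum_deriv_x power2_eq_square)

lemma loglik_par_x_eq: "\<theta> \<in> Theta_int \<Longrightarrow> loglik_par_x i x \<theta> =
    (term_sum (terms_dx (terms_dp i density_terms)) x \<theta> * term_sum density_terms x \<theta> - term_sum (terms_dp i density_terms) x \<theta> * term_sum (terms_dx density_terms) x \<theta>)
      / (term_sum density_terms x \<theta>)\<^sup>2"
  unfolding loglik_par_x_def by (rule DERIV_imp_deriv[OF density_deriv_x(3)])

lemma loglik_well_defined:
  assumes th: "\<theta> \<in> Theta_int"
  shows "loglik_derivs_well_defined x \<theta>"
proof -
  have "density_x x \<theta> = term_sum (terms_dx density_terms) x \<theta>"
    unfolding density_x_def by (rule DERIV_imp_deriv[OF density_deriv_x(1)[OF th]])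
  moreover have "density_par_x i x \<theta> = term_sum (terms_dx (terms_dp i density_terms)) x \<theta>" for i
    unfolding density_par_x_def by (rule DERIV_imp_deriv[OF density_deriv_x(2)[OF th]])
  moreover have "density_par_par i j x \<theta> = term_sum (terms_dp j (terms_dp i density_terms)) x \<theta>" for i j
    unfolding density_par_par_def by (rule par_DERIV_D(2)[OF density_par_par_DERIV[OF th]])
  moreover have "(\<lambda>y. stable_density y \<theta>) differentiable (at x)"
    "(\<lambda>y. density_par i y \<theta>) differentiable (at x)"
    "(\<lambda>y. loglik_par i y \<theta>) differentiable (at x)" for i
    unfolding real_differentiable_def using density_deriv_x[OF th] by blast+
  moreover have "par_differentiable i (stable_density x) \<theta>" "par_differentiable i (loglik x) \<theta>"
    "par_differentiable j (density_par i x) \<theta>" "par_differentiable j (loglik_par i x) \<theta>" for i j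
    using par_DERIV_D(1)[OF stable_density_par_DERIV[OF th]] par_DERIV_D(1)[OF loglik_par_DERIV[OF th]]
      par_DERIV_D(1)[OF density_par_par_DERIV[OF th]] par_DERIV_D(1)[OF loglik_par_par_DERIV[OF th]] by auto
  ultimately show ?thesis
    unfolding loglik_derivs_well_defined_def
    using term_sum_density_terms_pos[OF th, of x]
    by (simp add: stable_density_term_sum density_par_eq loglik_par_eq loglik_par_x_eq loglik_par_par_eq th)
qed

section \<open>Continuity, the role of the location, and the orders\<close>

lemma continuous_on_section:
  assumes "continuous_on (UNIV \<times> S) (\<lambda>(x, \<theta>). F x \<theta>)"
  shows "continuous_on S (F x)"
proof -
  have "continuous_on S (\<lambda>\<theta>. (x, \<theta>))"
    by (intro continuous_intros)
  then have "continuous_on S (\<lambda>\<theta>. (\<lambda>(x, \<theta>). F x \<theta>) (x, \<theta>))"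
    by (intro continuous_on_compose2[OF assms]) auto
  then show ?thesis by simp
qed

lemma continuous_on_loglik:
  "continuous_on (UNIV \<times> Theta_int) (\<lambda>(x, \<theta>). loglik_par i x \<theta>)"
  "continuous_on (UNIV \<times> Theta_int) (\<lambda>(x, \<theta>). loglik_par_x i x \<theta>)"
  "continuous_on (UNIV \<times> Theta_int) (\<lambda>(x, \<theta>). loglik_par_par i j x \<theta>)"
proof -
  note c = continuous_on_term_sum[unfolded split_beta']
  have nz: "term_sum density_terms (fst q) (snd q) \<noteq> 0" if "q \<in> UNIV \<times> Theta_int" for q
    using term_sum_density_terms_pos[of "snd q" "fst q"] that by auto
  have "continuous_on (UNIV \<times> Theta_int) (\<lambda>q. term_sum (terms_dp i density_terms) (fst q) (snd q) / term_sum density_terms (fst q) (snd q))"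
    using nz by (intro continuous_intros c) auto
  then show "continuous_on (UNIV \<times> Theta_int) (\<lambda>(x, \<theta>). loglik_par i x \<theta>)"
    by (rule continuous_on_eq) (auto simp: loglik_par_eq)
  have "continuous_on (UNIV \<times> Theta_int) (\<lambda>q. (term_sum (terms_dx (terms_dp i density_terms)) (fst q) (snd q) * term_sum density_terms (fst q) (snd q) -
      term_sum (terms_dp i density_terms) (fst q) (snd q) * term_sum (terms_dx density_terms) (fst q) (snd q)) / (term_sum density_terms (fst q) (snd q))\<^sup>2)"
    using nz by (intro continuous_intros c) auto
  then show "continuous_on (UNIV \<times> Theta_int) (\<lambda>(x, \<theta>). loglik_par_x i x \<theta>)"
    by (rule continuous_on_eq) (auto simp: loglik_par_x_eq)
  have "continuous_on (UNIV \<times> Theta_int) (\<lambda>q. (term_sum (terms_dp j (terms_dp i density_terms)) (fst q) (snd q) * term_sum density_terms (fst q) (snd q) -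
      term_sum (terms_dp i density_terms) (fst q) (snd q) * term_sum (terms_dp j density_terms) (fst q) (snd q)) / (term_sum density_terms (fst q) (snd q))\<^sup>2)"
    using nz by (intro continuous_intros c) auto
  then show "continuous_on (UNIV \<times> Theta_int) (\<lambda>(x, \<theta>). loglik_par_par i j x \<theta>)"
    by (rule continuous_on_eq) (auto simp: loglik_par_par_eq)
qed

text \<open>The density depends on x and \<mu> only through x - \<mu>, so d/d\<mu> = - d/dx. For the
  mixed derivatives the two lists are evaluated for each parameter, and their values agree up to
  sign; the order of differentiation is thereby interchanged by computation.\<close>

lemma loglik_par_mu:
  assumes th: "\<theta> \<in> Theta_int"
  shows "loglik_par_par par_mu i x \<theta> = - loglik_par_x i x \<theta>"
proof -
  have "term_sum (terms_dp i (terms_dp par_mu density_terms)) x \<theta> = - term_sum (terms_dx (terms_dp i density_terms)) x \<theta>"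
    using exhaust_4[of i] by (auto simp: density_terms_def terms_dp_Cons terms_dx_Cons term_sum_Cons algebra_simps)
  moreover have "term_sum (terms_dp par_mu density_terms) x \<theta> = - term_sum (terms_dx density_terms) x \<theta>"
    by (simp add: density_terms_def terms_dp_Cons terms_dx_Cons term_sum_Cons)
  ultimately show ?thesis
    by (simp add: loglik_par_par_eq[OF th] loglik_par_x_eq[OF th] algebra_simps minus_divide_left)
qed

lemma loglik_par_bigo:
  assumes th: "\<theta> \<in> Theta_int"
  shows "(\<lambda>x. loglik_par i x \<theta>) \<in> O[at_infinity](\<lambda>x. inverse \<bar>x\<bar> ^ decay_weight i * ln \<bar>x\<bar> ^ log_weight i)"
  unfolding loglik_par_eq[OF th]
  using term_sum_ratio_bigo[OF th tail_shape_terms_dp[OF tail_shape_density_terms] order_le_mono[OF order_le_terms_dp[OF order_le_density_terms]], of i] by simp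

text \<open>The second derivative is f_ij / f minus the product of two first derivatives of log f.
  The weights add up, so that product has the same order as f_ij / f.\<close>

lemma loglik_par_par_bigo:
  assumes th: "\<theta> \<in> Theta_int"
  shows "(\<lambda>x. loglik_par_par i j x \<theta>) \<in>
    O[at_infinity](\<lambda>x. inverse \<bar>x\<bar> ^ (decay_weight i + decay_weight j) * ln \<bar>x\<bar> ^ (log_weight i + log_weight j))"
proof -
  have "(\<lambda>x. loglik_par_par i j x \<theta>) =
      (\<lambda>x. term_sum (terms_dp j (terms_dp i density_terms)) x \<theta> / term_sum density_terms x \<theta> - loglik_par i x \<theta> * loglik_par j x \<theta>)"
  proof
    fix x
    show "loglik_par_par i j x \<theta> =
      term_sum (terms_dp j (terms_dp i density_terms)) x \<theta> / term_sum density_terms x \<theta> - loglik_par i x \<theta> * loglik_par j x \<theta>"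
      using term_sum_density_terms_pos[OF th, of x]
      by (simp add: loglik_par_par_eq[OF th] loglik_par_eq[OF th] power2_eq_square field_simps)
  qed
  moreover have "(\<lambda>x. term_sum (terms_dp j (terms_dp i density_terms)) x \<theta> / term_sum density_terms x \<theta>) \<in>
      O[at_infinity](\<lambda>x. inverse \<bar>x\<bar> ^ (decay_weight i + decay_weight j) * ln \<bar>x\<bar> ^ (log_weight i + log_weight j))"
    using term_sum_ratio_bigo[OF th tail_shape_terms_dp[OF tail_shape_terms_dp[OF tail_shape_density_terms]] order_le_mono[OF order_le_terms_dp[OF order_le_terms_dp[OF order_le_density_terms]]], of j i]
    by simp
  moreover have "(\<lambda>x. loglik_par i x \<theta> * loglik_par j x \<theta>) \<in>
      O[at_infinity](\<lambda>x. inverse \<bar>x\<bar> ^ (decay_weight i + decay_weight j) * ln \<bar>x\<bar> ^ (log_weight i + log_weight j))"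
    using landau_o.big_mult[OF loglik_par_bigo[OF th, of i] loglik_par_bigo[OF th, of j]]
    by (simp add: power_add mult_ac)
  ultimately show ?thesis by (simp add: sum_in_bigo)
qed

theorem proposition2p3:
  shows "(\<forall>x. \<forall>\<theta>\<in>Theta_int. loglik_derivs_well_defined x \<theta>) \<and>
    (\<forall>x i. continuous_on Theta_int (\<lambda>\<theta>. loglik_par i x \<theta>)) \<and>
    (\<forall>x i. continuous_on Theta_int (\<lambda>\<theta>. loglik_par_x i x \<theta>)) \<and>
    (\<forall>x i j. continuous_on Theta_int (\<lambda>\<theta>. loglik_par_par i j x \<theta>)) \<and>
    (\<forall>i. continuous_on (UNIV \<times> Theta_int) (\<lambda>(x, \<theta>). loglik_par i x \<theta>)) \<and>
    (\<forall>i. continuous_on (UNIV \<times> Theta_int) (\<lambda>(x, \<theta>). loglik_par_x i x \<theta>)) \<and>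
    (\<forall>i j. continuous_on (UNIV \<times> Theta_int) (\<lambda>(x, \<theta>). loglik_par_par i j x \<theta>)) \<and>
    (\<forall>\<theta>\<in>Theta_int.
      (\<lambda>x. loglik_par par_mu x \<theta>) \<in> O[at_infinity](\<lambda>x. inverse \<bar>x\<bar>) \<and>
      (\<forall>x. loglik_par_par par_mu par_mu x \<theta> = - loglik_par_x par_mu x \<theta>) \<and>
      (\<lambda>x. loglik_par_par par_mu par_mu x \<theta>) \<in> O[at_infinity](\<lambda>x. inverse (\<bar>x\<bar>\<^sup>2)) \<and>
      (\<lambda>x. loglik_par par_sigma x \<theta>) \<in> O[at_infinity](\<lambda>x. 1) \<and>
      (\<forall>x. loglik_par_par par_mu par_sigma x \<theta> = - loglik_par_x par_sigma x \<theta>) \<and>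
      (\<lambda>x. loglik_par_par par_mu par_sigma x \<theta>) \<in> O[at_infinity](\<lambda>x. inverse \<bar>x\<bar>) \<and>
      (\<lambda>x. loglik_par par_alpha x \<theta>) \<in> O[at_infinity](\<lambda>x. ln \<bar>x\<bar>) \<and>
      (\<forall>x. loglik_par_par par_mu par_alpha x \<theta> = - loglik_par_x par_alpha x \<theta>) \<and>
      (\<lambda>x. loglik_par_par par_mu par_alpha x \<theta>) \<in> O[at_infinity](\<lambda>x. inverse \<bar>x\<bar> * ln \<bar>x\<bar>) \<and>
      (\<lambda>x. loglik_par par_beta x \<theta>) \<in> O[at_infinity](\<lambda>x. 1) \<and>
      (\<forall>x. loglik_par_par par_mu par_beta x \<theta> = - loglik_par_x par_beta x \<theta>) \<and>
      (\<lambda>x. loglik_par_par par_mu par_beta x \<theta>) \<in> O[at_infinity](\<lambda>x. inverse \<bar>x\<bar>) \<and>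
      (\<lambda>x. loglik_par_par par_sigma par_sigma x \<theta>) \<in> O[at_infinity](\<lambda>x. 1) \<and>
      (\<lambda>x. loglik_par_par par_sigma par_alpha x \<theta>) \<in> O[at_infinity](\<lambda>x. ln \<bar>x\<bar>) \<and>
      (\<lambda>x. loglik_par_par par_sigma par_beta x \<theta>) \<in> O[at_infinity](\<lambda>x. 1) \<and>
      (\<lambda>x. loglik_par_par par_alpha par_alpha x \<theta>) \<in> O[at_infinity](\<lambda>x. (ln \<bar>x\<bar>)\<^sup>2) \<and>
      (\<lambda>x. loglik_par_par par_alpha par_beta x \<theta>) \<in> O[at_infinity](\<lambda>x. ln \<bar>x\<bar>) \<and>
      (\<lambda>x. loglik_par_par par_beta par_beta x \<theta>) \<in> O[at_infinity](\<lambda>x. 1))"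
proof (intro conjI allI ballI)
  show "loglik_derivs_well_defined x \<theta>" if "\<theta> \<in> Theta_int" for x \<theta>
    by (rule loglik_well_defined[OF that])
  show "continuous_on (UNIV \<times> Theta_int) (\<lambda>(x, \<theta>). loglik_par i x \<theta>)"
    "continuous_on (UNIV \<times> Theta_int) (\<lambda>(x, \<theta>). loglik_par_x i x \<theta>)"
    "continuous_on (UNIV \<times> Theta_int) (\<lambda>(x, \<theta>). loglik_par_par i j x \<theta>)" for i j
    by (rule continuous_on_loglik)+
  then show "continuous_on Theta_int (\<lambda>\<theta>. loglik_par i x \<theta>)"
    "continuous_on Theta_int (\<lambda>\<theta>. loglik_par_x i x \<theta>)"
    "continuous_on Theta_int (\<lambda>\<theta>. loglik_par_par i j x \<theta>)" for i j x
    by (auto intro: continuous_on_section)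
  show "loglik_par_par par_mu par_mu x \<theta> = - loglik_par_x par_mu x \<theta>"
    "loglik_par_par par_mu par_sigma x \<theta> = - loglik_par_x par_sigma x \<theta>"
    "loglik_par_par par_mu par_alpha x \<theta> = - loglik_par_x par_alpha x \<theta>"
    "loglik_par_par par_mu par_beta x \<theta> = - loglik_par_x par_beta x \<theta>" if "\<theta> \<in> Theta_int" for x \<theta>
    by (rule loglik_par_mu[OF that])+
next
  fix \<theta> assume th: "\<theta> \<in> Theta_int"
  note a = loglik_par_bigo[OF th] and b = loglik_par_par_bigo[OF th]
  note w = decay_weight_def log_weight_def
  show "(\<lambda>x. loglik_par par_mu x \<theta>) \<in> O[at_infinity](\<lambda>x. inverse \<bar>x\<bar>)"
    using a[of par_mu] by (simp add: w)
  show "(\<lambda>x. loglik_par par_sigma x \<theta>) \<in> O[at_infinity](\<lambda>x. 1)"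
    using a[of par_sigma] by (simp add: w)
  show "(\<lambda>x. loglik_par par_alpha x \<theta>) \<in> O[at_infinity](\<lambda>x. ln \<bar>x\<bar>)"
    using a[of par_alpha] by (simp add: w)
  show "(\<lambda>x. loglik_par par_beta x \<theta>) \<in> O[at_infinity](\<lambda>x. 1)"
    using a[of par_beta] by (simp add: w)
  show "(\<lambda>x. loglik_par_par par_mu par_mu x \<theta>) \<in> O[at_infinity](\<lambda>x. inverse (\<bar>x\<bar>\<^sup>2))"
  proof -
    have e: "inverse \<bar>x\<bar> ^ (decay_weight par_mu + decay_weight par_mu) * ln \<bar>x\<bar> ^ (log_weight par_mu + log_weight par_mu) = inverse (\<bar>x\<bar>\<^sup>2)"
      for x :: real by (simp add: w power2_eq_square flip: abs_inverse)
    show ?thesis using b[of par_mu par_mu] unfolding e .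
  qed
  show "(\<lambda>x. loglik_par_par par_mu par_sigma x \<theta>) \<in> O[at_infinity](\<lambda>x. inverse \<bar>x\<bar>)"
    using b[of par_mu par_sigma] by (simp add: w)
  show "(\<lambda>x. loglik_par_par par_mu par_alpha x \<theta>) \<in> O[at_infinity](\<lambda>x. inverse \<bar>x\<bar> * ln \<bar>x\<bar>)"
    using b[of par_mu par_alpha] by (simp add: w)
  show "(\<lambda>x. loglik_par_par par_mu par_beta x \<theta>) \<in> O[at_infinity](\<lambda>x. inverse \<bar>x\<bar>)"
    using b[of par_mu par_beta] by (simp add: w)
  show "(\<lambda>x. loglik_par_par par_sigma par_sigma x \<theta>) \<in> O[at_infinity](\<lambda>x. 1)"
    using b[of par_sigma par_sigma] by (simp add: w)
  show "(\<lambda>x. loglik_par_par par_sigma par_alpha x \<theta>) \<in> O[at_infinity](\<lambda>x. ln \<bar>x\<bar>)"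
    using b[of par_sigma par_alpha] by (simp add: w)
  show "(\<lambda>x. loglik_par_par par_sigma par_beta x \<theta>) \<in> O[at_infinity](\<lambda>x. 1)"
    using b[of par_sigma par_beta] by (simp add: w)
  show "(\<lambda>x. loglik_par_par par_alpha par_alpha x \<theta>) \<in> O[at_infinity](\<lambda>x. (ln \<bar>x\<bar>)\<^sup>2)"
    using b[of par_alpha par_alpha] by (simp add: w power2_eq_square)
  show "(\<lambda>x. loglik_par_par par_alpha par_beta x \<theta>) \<in> O[at_infinity](\<lambda>x. ln \<bar>x\<bar>)"
    using b[of par_alpha par_beta] by (simp add: w)
  show "(\<lambda>x. loglik_par_par par_beta par_beta x \<theta>) \<in> O[at_infinity](\<lambda>x. 1)"
    using b[of par_beta par_beta] by (simp add: w)
qed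

end
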